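(* Let $\varphi:\Omega_1\rightarrow\Omega_2\subset\widehat{\mathbb{C}}$ be a conformal homeomorphism of a generalized Jordan domain $\Omega_1$ onto a domain $\Omega_2$. Suppose that the point components of $\partial\Omega_1$ form a set with $\sigma$-finite linear measure and that $\partial\Omega_2$ has at most countably many non-degenerate components $\{P_n\}$ with $\sum_n\mathrm{diam}(P_n)<\infty$. Then $\varphi$ extends continuously to the closure $\overline{\Omega_1}$ if and only if $\partial\Omega_2$ is a Peano compactum.
   Context: A domain is a connected open subset of the extended complex plane $\widehat{\mathbb{C}}$; diameters, closures and boundaries are taken in $\widehat{\mathbb{C}}$ with the spherical metric. A generalized Jordan domain is a domain $U\subset\widehat{\mathbb{C}}$ every component of whose boundary is a point or a Jordan curve, such that at most countably many boundary components are non-degenerate (i.e. Jordan curves) and the diameters of these form a null sequence (a finite sequence, or an infinite one converging to zero). A point component is a component that is a singleton; a non-degenerate component is one with more than one point. A Peano continuum is the image of $[0,1]$ under a continuous map. A Peano compactum is a compact metrisable space each of whose components is a Peano continuum (possibly a single point), such that for any $C>0$ at most finitely many of the components have diameter $>C$. Linear measure is one-dimensional Hausdorff measure. That $\varphi$ extends continuously to $\overline{\Omega_1}$ means that there is a continuous map $\overline{\varphi}:\overline{\Omega_1}\to\overline{\Omega_2}$ with $\overline{\varphi}|_{\Omega_1}=\varphi$. *)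

theory Defs
  imports "HOL-Analysis.Analysis"
begin

datatype ext_complex = Fin complex | Infty

text \<open>Inverse stereographic projection onto the unit sphere of \<open>complex \<times> real\<close>,
  projecting from the north pole \<open>(0, 1)\<close>.\<close>

fun stereo :: "ext_complex \<Rightarrow> complex \<times> real" where
  "stereo (Fin z) = ((2 / (1 + (cmod z)\<^sup>2)) *\<^sub>R z, ((cmod z)\<^sup>2 - 1) / ((cmod z)\<^sup>2 + 1))"
| "stereo Infty = (0, 1)"

lemma norm_stereo [simp]: "norm (stereo p) = 1"
proof (cases p)
  case (Fin z)
  have pos: "1 + (cmod z)\<^sup>2 > 0"
    by (simp add: add_pos_nonneg)
  have "(2 / (1 + (cmod z)\<^sup>2) * cmod z)\<^sup>2 + (((cmod z)\<^sup>2 - 1) / ((cmod z)\<^sup>2 + 1))\<^sup>2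
      = (4 * (cmod z)\<^sup>2 + ((cmod z)\<^sup>2 - 1)\<^sup>2) / (1 + (cmod z)\<^sup>2)\<^sup>2"
    by (simp add: power_mult_distrib power_divide add_divide_distrib add.commute)
  also have "4 * (cmod z)\<^sup>2 + ((cmod z)\<^sup>2 - 1)\<^sup>2 = (1 + (cmod z)\<^sup>2)\<^sup>2"
    by (simp add: power2_eq_square algebra_simps)
  also have "(1 + (cmod z)\<^sup>2)\<^sup>2 / (1 + (cmod z)\<^sup>2)\<^sup>2 = 1"
    using pos by simp
  finally show ?thesis
    using Fin pos by (simp add: norm_Pair power_mult_distrib power_divide)
qed (simp add: norm_Pair)

lemma stereo_eq_iff [simp]: "stereo p = stereo q \<longleftrightarrow> p = q"
proof
  have height: "(t - 1) / (t + 1) = 1 - 2 / (1 + t)" if "t \<ge> 0" for t :: real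
    using that by (simp add: field_simps)
  have pos: "1 + (cmod z)\<^sup>2 > 0" for z
    by (simp add: add_pos_nonneg)
  assume eq: "stereo p = stereo q"
  show "p = q"
  proof (cases p; cases q)
    fix z w assume pq: "p = Fin z" "q = Fin w"
    have *: "2 / (1 + (cmod z)\<^sup>2) = 2 / (1 + (cmod w)\<^sup>2)"
      using eq pq by (simp add: height)
    have "(2 / (1 + (cmod z)\<^sup>2)) *\<^sub>R z = (2 / (1 + (cmod w)\<^sup>2)) *\<^sub>R w"
      using eq pq by simp
    then have "(2 / (1 + (cmod z)\<^sup>2)) *\<^sub>R z = (2 / (1 + (cmod z)\<^sup>2)) *\<^sub>R w"
      by (simp only: *)
    then show ?thesis
      using pq pos[of z] by (simp del: scaleR_conv_of_real)
  next
    fix z assume pq: "p = Fin z" "q = Infty"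
    then show ?thesis using eq pos[of z] by (simp add: height)
  next
    fix w assume pq: "p = Infty" "q = Fin w"
    then show ?thesis using eq pos[of w] by (simp add: height)
  qed simp
qed simp

lemma abs_inner_stereo_le_1: "\<bar>stereo p \<bullet> stereo q\<bar> \<le> 1"
  using Cauchy_Schwarz_ineq2[of "stereo p" "stereo q"] by simp

lemma arccos_inner_triangle:
  fixes x y z :: "'a::real_inner"
  assumes n: "norm x = 1" "norm y = 1" "norm z = 1"
  shows "arccos (x \<bullet> y) \<le> arccos (x \<bullet> z) + arccos (y \<bullet> z)"
proof -
  define a b where "a = x \<bullet> z" and "b = y \<bullet> z"
  have bounds: "\<bar>a\<bar> \<le> 1" "\<bar>b\<bar> \<le> 1" "\<bar>x \<bullet> y\<bar> \<le> 1"
    using Cauchy_Schwarz_ineq2[of x z] Cauchy_Schwarz_ineq2[of y z]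
      Cauchy_Schwarz_ineq2[of x y] n by (simp_all add: a_def b_def)
  have ii: "x \<bullet> x = 1" "y \<bullet> y = 1" "z \<bullet> z = 1"
    using n by (simp_all add: dot_square_norm)
  have nx: "norm (x - a *\<^sub>R z) = sqrt (1 - a\<^sup>2)"
    by (simp add: norm_eq_sqrt_inner inner_diff_left inner_diff_right ii a_def
        inner_commute[of z x] power2_eq_square)
  have ny: "norm (y - b *\<^sub>R z) = sqrt (1 - b\<^sup>2)"
    by (simp add: norm_eq_sqrt_inner inner_diff_left inner_diff_right ii b_def
        inner_commute[of z y] power2_eq_square)
  have "(x - a *\<^sub>R z) \<bullet> (y - b *\<^sub>R z) = x \<bullet> y - a * b"
    by (simp add: inner_diff_left inner_diff_right ii a_def b_def
        inner_commute[of z y] inner_commute[of z x])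
  then have cs: "a * b - sqrt (1 - a\<^sup>2) * sqrt (1 - b\<^sup>2) \<le> x \<bullet> y"
    using Cauchy_Schwarz_ineq2[of "x - a *\<^sub>R z" "y - b *\<^sub>R z"] by (simp add: nx ny)
  have cos_sum: "cos (arccos a + arccos b) = a * b - sqrt (1 - a\<^sup>2) * sqrt (1 - b\<^sup>2)"
    using bounds by (simp add: cos_add cos_arccos_abs sin_arccos_abs)
  show ?thesis
  proof (cases "arccos a + arccos b \<le> pi")
    case True
    have "0 \<le> arccos a + arccos b"
      using bounds by (intro add_nonneg_nonneg arccos_lbound) auto
    then have "arccos a + arccos b = arccos (cos (arccos a + arccos b))"
      using True by (simp add: arccos_cos)
    also have "\<dots> \<ge> arccos (x \<bullet> y)"
      using cs cos_sum bounds cos_ge_minus_one[of "arccos a + arccos b"]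
      by (intro arccos_le_arccos) auto
    finally show ?thesis by (simp add: a_def b_def)
  next
    case False
    moreover have "arccos (x \<bullet> y) \<le> pi"
      using bounds by (intro arccos_ubound) auto
    ultimately show ?thesis by (simp add: a_def b_def)
  qed
qed

instantiation ext_complex :: metric_space
begin

text \<open>The spherical metric: length of the shorter great-circle arc between the images on the
  unit sphere.\<close>

definition dist_ext_complex :: "ext_complex \<Rightarrow> ext_complex \<Rightarrow> real" where
  "dist p q = arccos (stereo p \<bullet> stereo q)"

definition uniformity_ext_complex :: "(ext_complex \<times> ext_complex) filter" where
  "uniformity_ext_complex = (INF e\<in>{0<..}. principal {(p, q). dist p q < e})"

definition open_ext_complex :: "ext_complex set \<Rightarrow> bool" where
  "open_ext_complex U \<longleftrightarrow> (\<forall>p\<in>U. eventually (\<lambda>(p', q). p' = p \<longrightarrow> q \<in> U) uniformity)"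

instance
proof
  fix p q r :: ext_complex
  have ii: "stereo p \<bullet> stereo p = 1" for p
    by (simp add: dot_square_norm)
  show "dist p q = 0 \<longleftrightarrow> p = q"
  proof
    assume "dist p q = 0"
    then have "cos (arccos (stereo p \<bullet> stereo q)) = 1"
      by (simp add: dist_ext_complex_def)
    then have "stereo p \<bullet> stereo q = 1"
      using abs_inner_stereo_le_1[of p q] by (simp add: cos_arccos_abs)
    then have "(stereo p - stereo q) \<bullet> (stereo p - stereo q) = 0"
      by (simp add: inner_diff_left inner_diff_right ii inner_commute[of "stereo q"])
    then show "p = q" by simp
  qed (simp add: dist_ext_complex_def ii)
  show "dist p q \<le> dist p r + dist q r"
    unfolding dist_ext_complex_def by (rule arccos_inner_triangle) simp_all
qed (simp_all only: uniformity_ext_complex_def open_ext_complex_def)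

end

text \<open>Local coordinate at \<open>p\<close>: the identity for finite \<open>p\<close>, and \<open>w \<mapsto> 1 / w\<close> for \<open>p = \<infinity>\<close>. The value
  at the one point outside the coordinate patch (\<open>\<infinity>\<close> resp. \<open>0\<close>) is a dummy.\<close>

fun chart :: "ext_complex \<Rightarrow> ext_complex \<Rightarrow> complex" where
  "chart (Fin _) (Fin w) = w"
| "chart (Fin _) Infty = 0"
| "chart Infty (Fin w) = inverse w"
| "chart Infty Infty = 0"

fun chart_inv :: "ext_complex \<Rightarrow> complex \<Rightarrow> ext_complex" where
  "chart_inv (Fin _) w = Fin w"
| "chart_inv Infty w = (if w = 0 then Infty else Fin (inverse w))"

text \<open>Only meaningful for \<open>f\<close> continuous at \<open>p\<close>: then \<open>f\<close> avoids the dummy value of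
  \<open>chart (f p)\<close> near \<open>p\<close>.\<close>

definition conformal_at :: "(ext_complex \<Rightarrow> ext_complex) \<Rightarrow> ext_complex \<Rightarrow> bool" where
  "conformal_at f p \<longleftrightarrow>
     (let F = chart (f p) \<circ> f \<circ> chart_inv p
      in F analytic_on {chart p p} \<and> deriv F (chart p p) \<noteq> 0)"

definition conformal_homeomorphism ::
    "ext_complex set \<Rightarrow> ext_complex set \<Rightarrow> (ext_complex \<Rightarrow> ext_complex) \<Rightarrow> bool" where
  "conformal_homeomorphism U V f \<longleftrightarrow>
     (\<exists>g. homeomorphism U V f g) \<and> (\<forall>p\<in>U. conformal_at f p)"

definition sphere_domain :: "ext_complex set \<Rightarrow> bool" where
  "sphere_domain U \<longleftrightarrow> open U \<and> connected U"

definition jordan_curve :: "'a::topological_space set \<Rightarrow> bool" where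
  "jordan_curve J \<longleftrightarrow>
     (\<exists>g. simple_path g \<and> pathfinish g = pathstart g \<and> path_image g = J)"

definition point_components :: "'a::topological_space set \<Rightarrow> 'a set" where
  "point_components X = {x. {x} \<in> components X}"

definition nondegenerate_components :: "'a::topological_space set \<Rightarrow> 'a set set" where
  "nondegenerate_components X = {K \<in> components X. \<exists>x\<in>K. \<exists>y\<in>K. x \<noteq> y}"

definition null_family :: "'a::metric_space set set \<Rightarrow> bool" where
  "null_family \<C> \<longleftrightarrow>
     finite \<C> \<or> (\<exists>K :: nat \<Rightarrow> 'a set. bij_betw K UNIV \<C> \<and> (\<lambda>n. diameter (K n)) \<longlonglongrightarrow> 0)"

definition generalized_jordan_domain :: "ext_complex set \<Rightarrow> bool" where
  "generalized_jordan_domain U \<longleftrightarrow>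
     sphere_domain U \<and>
     (\<forall>K\<in>components (frontier U). (\<exists>x. K = {x}) \<or> jordan_curve K) \<and>
     countable (nondegenerate_components (frontier U)) \<and>
     null_family (nondegenerate_components (frontier U))"

definition peano_continuum :: "'a::topological_space set \<Rightarrow> bool" where
  "peano_continuum X \<longleftrightarrow> (\<exists>g :: real \<Rightarrow> 'a. continuous_on {0..1} g \<and> g ` {0..1} = X)"

definition peano_compactum :: "'a::metric_space set \<Rightarrow> bool" where
  "peano_compactum X \<longleftrightarrow>
     compact X \<and>
     (\<forall>K\<in>components X. peano_continuum K) \<and>
     (\<forall>C>0. finite {K \<in> components X. diameter K > C})"

text \<open>One-dimensional Hausdorff outer measure. The boundedness condition is needed because
  \<open>diameter\<close> is real-valued and unspecified on unbounded sets.\<close>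

definition linear_premeasure :: "real \<Rightarrow> 'a::metric_space set \<Rightarrow> ennreal" where
  "linear_premeasure \<delta> A =
     (INF U\<in>{U :: nat \<Rightarrow> 'a set. A \<subseteq> (\<Union>n. U n) \<and> (\<forall>n. bounded (U n) \<and> diameter (U n) \<le> \<delta>)}.
        \<Sum>n. ennreal (diameter (U n)))"

definition linear_measure :: "'a::metric_space set \<Rightarrow> ennreal" where
  "linear_measure A = (SUP \<delta>\<in>{0<..}. linear_premeasure \<delta> A)"

text \<open>The pieces need not be measurable: Hausdorff outer measure is Borel regular, so for Borel
  \<open>A\<close> (such as the point components of a compact set) they can be enlarged to Borel subsets of \<open>A\<close>
  of the same measure.\<close>

definition sigma_finite_linear_measure :: "'a::metric_space set \<Rightarrow> bool" where
  "sigma_finite_linear_measure A \<longleftrightarrow>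
     (\<exists>B :: nat \<Rightarrow> 'a set. A = (\<Union>n. B n) \<and> (\<forall>n. linear_measure (B n) < \<infinity>))"

definition extends_continuously ::
    "ext_complex set \<Rightarrow> ext_complex set \<Rightarrow> (ext_complex \<Rightarrow> ext_complex) \<Rightarrow> bool" where
  "extends_continuously U V f \<longleftrightarrow>
     (\<exists>g. continuous_on (closure U) g \<and> g ` closure U \<subseteq> closure V \<and> (\<forall>p\<in>U. g p = f p))"

end

theory Submission
  imports Defs "HOL-Complex_Analysis.Complex_Analysis"
begin

text \<open>After a change of coordinates both domains contain \<open>\<infinity>\<close> and \<open>\<phi>\<close> fixes it, so that the complements
  are compact subsets of the plane. By Janiszewski's theorem \<open>\<phi>\<close> matches the components of the two
  complements; together with \<open>\<phi>\<close> this gives a closed relation on the plane, symmetric in the two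
  sides, under which images and preimages of connected sets are connected.

  If \<open>\<phi>\<close> extends, every component of the second boundary is therefore the image of a single component
  of the first, hence a Peano continuum, and summability leaves finitely many large ones.

  Conversely, consider small circles about a boundary point. The length--area method makes the image
  of the part of the circle in the domain short along suitable radii, Eilenberg's inequality lets
  almost every circle meet only countably many point components, and the complementary components
  that it crosses have small total diameter by summability. At a point component the whole circle
  has a small image, which encloses the corresponding component and so shrinks it to a point. At a
  point of a Jordan curve some arc of the circle, together with the curve, separates the nearby part
  of the domain from \<open>\<infinity>\<close>; the ends of its image on the Peano continuum are joined by a small
  subcontinuum, and by Janiszewski's theorem again the nearby part of the domain has a small image.\<close>

section \<open>Separation in the plane\<close>

text \<open>The obstacle is that the image of a circle about a boundary point is not a curve. It
  consists of countably many open arcs together with points and continua that correspond to the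
  complementary components crossed by the circle, in an order that is out of control. A global
  length is therefore replaced by the measure of the projections to the two axes. This is countably
  subadditive over all the pieces, ignores countable sets of points, and bounds the diameter of
  every connected part. The hypothesis on point components makes the relevant sets of points
  countable. Summability pays for the continua: all but finitely many have small total diameter, and
  small circles avoid the remaining ones, except the component of the centre. The topology rests on
  Janiszewski's theorem: if two closed sets, one of them compact, have connected intersection and
  neither separates two given points, then their union does not separate them either. Complementary
  components in the plane suit it, being compact, and infinity serves as the common outside.\<close>

lemma separating_continuum:
  fixes E :: "'a::euclidean_space set"
  assumes "compact E" "y \<in> E" "y' \<in> E" "\<not> connected_component E y y'"
  obtains K where "compact K" "connected K" "K \<inter> E = {}" "\<not> connected_component (- K) y y'"
proof -
  define C where "C = connected_component_set E y"
  have "C \<in> components E"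
    using assms by (auto simp: C_def components_def)
  moreover have "y' \<notin> C"
    using assms by (simp add: C_def)
  \<comment> \<open>In a compact space a component is the intersection of the clopen sets that
    contain it.\<close>
  ultimately obtain A where A: "C \<subseteq> A" "openin (top_of_set E) A" "closedin (top_of_set E) A" "y' \<notin> A"
    using Sura_Bura_compact[OF \<open>compact E\<close>, of C] by blast
  have yA: "y \<in> A"
    using A assms by (auto simp: C_def)
  have cA: "compact A" and cB: "compact (E - A)"
    using A closedin_diff[of "top_of_set E" E A] assms by (auto intro: closedin_compact[of E])
  have "setdist A (E - A) > 0"
    using setdist_gt_0_compact_closed[OF cA compact_imp_closed[OF cB]] yA assms A by auto
  \<comment> \<open>Half the gap between \<open>A\<close> and the rest of \<open>E\<close>: the
    level set \<open>S\<close> of the distance to \<open>A\<close> misses \<open>E\<close>, and by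
    the intermediate value theorem it separates \<open>y\<close> from \<open>y'\<close>.\<close>
  define e where "e = setdist A (E - A) / 2"
  have e: "e > 0" "2 * e = setdist A (E - A)"
    using \<open>setdist A (E - A) > 0\<close> by (auto simp: e_def)
  define S where "S = {z. infdist z A = e}"
  have infA: "infdist z A = 0" if "z \<in> A" for z
    using that by simp
  have infB: "infdist z A \<ge> 2 * e" if "z \<in> E - A" for z
  proof -
    have "setdist (E - A) A \<le> setdist {z} A"
      using that by (intro setdist_subset_left) auto
    then show ?thesis
      using e by (simp add: infdist_eq_setdist setdist_sym)
  qed
  have contI: "continuous_on UNIV (\<lambda>z. infdist z A)"
    by (intro continuous_intros)
  have "closed S"
    unfolding S_def by (intro closed_Collect_eq continuous_intros)
  moreover have "bounded S"
  proof -
    obtain B where B: "\<And>a. a \<in> A \<Longrightarrow> norm a \<le> B"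
      using compact_imp_bounded[OF cA] bounded_iff by blast
    have "norm z \<le> B + e" if "z \<in> S" for z
    proof -
      obtain a where "a \<in> A" "infdist z A = dist z a"
        using infdist_attains_inf[of A z] cA yA compact_imp_closed by blast
      then show ?thesis
        using that B[of a] norm_triangle_ineq2[of z a] by (auto simp: S_def dist_norm)
    qed
    then show ?thesis
      by (auto simp: bounded_iff)
  qed
  ultimately have cS: "compact S"
    by (simp add: compact_eq_bounded_closed)
  have SE: "S \<inter> E = {}"
    using infA infB e by (force simp: S_def)
  have "\<not> connected_component (- S) y y'"
  proof
    assume "connected_component (- S) y y'"
    then obtain T where T: "connected T" "T \<subseteq> - S" "y \<in> T" "y' \<in> T"
      by (auto simp: connected_component_def)
    have "connected ((\<lambda>z. infdist z A) ` T)"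
      using T contI connected_continuous_image continuous_on_subset by blast
    moreover have "infdist y A \<le> e" "e \<le> infdist y' A"
      using infA[OF yA] infB[of y'] e assms A by auto
    ultimately have "e \<in> (\<lambda>z. infdist z A) ` T"
      using T unfolding connected_iff_interval by blast
    then show False
      using T by (auto simp: S_def)
  qed
  \<comment> \<open>A closed set that separates two points has a component that already does, so the
    separator can be taken connected.\<close>
  then obtain K where K: "K \<in> components S" "\<not> connected_component (- K) y y'"
    using separation_by_component_closed_pointwise[OF compact_imp_closed[OF cS]] by metis
  show thesis
  proof
    show "compact K" "connected K"
      using K cS compact_components in_components_connected by blast+
    show "K \<inter> E = {}"
      using K SE in_components_subset by blast
  qed (use K in auto)
qed

lemma closure_connected_component_compl:
  fixes K :: "'a::real_normed_vector set"
  assumes "closed K"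
  shows "closure (connected_component_set (- K) a) \<subseteq> connected_component_set (- K) a \<union> K"
proof
  fix x assume x: "x \<in> closure (connected_component_set (- K) a)"
  show "x \<in> connected_component_set (- K) a \<union> K"
  proof (rule ccontr)
    assume n: "x \<notin> connected_component_set (- K) a \<union> K"
    then have W': "open (connected_component_set (- K) x)" "x \<in> connected_component_set (- K) x"
      using assms by (auto intro!: open_connected_component simp: open_Compl)
    then obtain z where "z \<in> connected_component_set (- K) a" "z \<in> connected_component_set (- K) x"
      using x open_Int_closure_eq_empty[OF W'(1), of "connected_component_set (- K) a"] by blast
    then have "connected_component_set (- K) a = connected_component_set (- K) x"
      using connected_component_eq[of z "- K" a] connected_component_eq[of z "- K" x] by simp
    then show False
      using n W' by blast
  qed
qed

text \<open>Holes of \<open>U\<close> do not cut a side \<open>W\<close> of \<open>K\<close>: the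
  frontier of \<open>W\<close> lies in \<open>K\<close> and so in \<open>U\<close>, which makes the
  part of \<open>- U\<close> inside \<open>W\<close> compact. It is disjoint from
  \<open>- W\<close>, and Janiszewski's theorem applies with empty intersection.\<close>

lemma connected_component_Int_compl_compact:
  fixes U :: "complex set"
  assumes U: "open U" "connected U" "bounded (- U)" and K: "compact K" "K \<subseteq> U"
  shows "connected (connected_component_set (- K) a \<inter> U)"
proof -
  define W where "W = connected_component_set (- K) a"
  have oW: "open W"
    unfolding W_def using K by (intro open_connected_component) (simp add: compact_imp_closed open_Compl)
  have cW: "connected W"
    by (simp add: W_def)
  have frW: "closure W \<subseteq> W \<union> K"
    unfolding W_def using K by (intro closure_connected_component_compl compact_imp_closed)
  have "- U \<inter> closure W = - U \<inter> W"
    using frW K closure_subset by blast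
  moreover have "compact (- U \<inter> closure W)"
    using U by (metis compact_Int_closed compact_eq_bounded_closed closed_closure closed_Compl)
  ultimately have cS: "compact (- U \<inter> W)"
    by simp
  have "connected_component (W \<inter> U) p q" if pq: "p \<in> W \<inter> U" "q \<in> W \<inter> U" for p q
  proof -
    have "connected_component (- ((- U \<inter> W) \<union> - W)) p q"
    proof (rule Janiszewski[OF cS])
      show "closed (- W)"
        using oW by (simp add: closed_Compl)
      have "(- U \<inter> W) \<inter> - W = {}"
        by auto
      then show "connected ((- U \<inter> W) \<inter> - W)"
        by (metis connected_empty)
      show "connected_component (- (- U \<inter> W)) p q"
        using U pq by (auto simp: connected_component_def intro!: exI[of _ U])
      show "connected_component (- (- W)) p q"
        using cW pq by (auto simp: connected_component_def intro!: exI[of _ W])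
    qed
    moreover have "- ((- U \<inter> W) \<union> - W) = W \<inter> U"
      by auto
    ultimately show ?thesis
      by simp
  qed
  then show ?thesis
    unfolding W_def[symmetric] connected_iff_connected_component by blast
qed

section \<open>The correspondence of complementary components\<close>

text \<open>\<open>U\<close> and \<open>V\<close> are punctured neighbourhoods of infinity, and the
  two boundedness assumptions say that \<open>f\<close> and \<open>h\<close> fix infinity
  continuously. The locale is symmetric, so that each result is also available for
  \<open>h\<close>.\<close>

locale exterior_homeo =
  fixes U V :: "complex set" and f h :: "complex \<Rightarrow> complex"
  assumes open_U: "open U" and open_V: "open V" and connected_U: "connected U"
    and bounded_compl_U: "bounded (- U)" and bounded_compl_V: "bounded (- V)"
    and homeo: "homeomorphism U V f h"
    and bounded_image: "\<And>B. bounded B \<Longrightarrow> bounded (f ` (U \<inter> B))"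
    and bounded_preimage: "\<And>B. bounded B \<Longrightarrow> bounded (h ` (V \<inter> B))"
begin

lemma f_in [simp]: "x \<in> U \<Longrightarrow> f x \<in> V" and h_in [simp]: "y \<in> V \<Longrightarrow> h y \<in> U"
  and hf [simp]: "x \<in> U \<Longrightarrow> h (f x) = x" and fh [simp]: "y \<in> V \<Longrightarrow> f (h y) = y"
  using homeo by (auto simp: homeomorphism_def)

lemma cont_f: "continuous_on U f" and cont_h: "continuous_on V h" and image_U: "f ` U = V"
  using homeo by (auto simp: homeomorphism_def)

lemma connected_V: "connected V"
  using connected_continuous_image[OF cont_f connected_U] image_U by simp

lemma swap: "exterior_homeo V U h f"
  by (rule exterior_homeo.intro) (use open_U open_V connected_V bounded_compl_U bounded_compl_V
      homeomorphism_symD[OF homeo] bounded_image bounded_preimage in auto)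

lemma compact_compl_U: "compact (- U)"
  using open_U bounded_compl_U by (simp add: compact_eq_bounded_closed closed_Compl)

lemma compact_image: "compact K \<Longrightarrow> K \<subseteq> U \<Longrightarrow> compact (f ` K)"
  using compact_continuous_image continuous_on_subset cont_f by blast

text \<open>A connected set joining \<open>u\<close> to \<open>u'\<close> off \<open>K\<close> may
  leave \<open>U\<close>, where \<open>f\<close> says nothing. But the whole side of
  \<open>K\<close> meets \<open>U\<close> in a connected set, and the image of that can be used
  instead.\<close>

lemma connected_component_image:
  assumes K: "compact K" "K \<subseteq> U" and u: "u \<in> U" "u' \<in> U" and c: "connected_component (- K) u u'"
  shows "connected_component (- f ` K) (f u) (f u')"
proof -
  define W where "W = connected_component_set (- K) u"
  have "connected (W \<inter> U)"
    unfolding W_def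
    by (rule connected_component_Int_compl_compact[OF open_U connected_U bounded_compl_U K])
  then have "connected (f ` (W \<inter> U))"
    using cont_f connected_continuous_image continuous_on_subset by blast
  moreover have "f ` (W \<inter> U) \<subseteq> - f ` K"
  proof -
    have "W \<inter> K = {}"
      using connected_component_subset[of "- K" u] by (auto simp: W_def)
    show ?thesis
    proof (intro subsetI ComplI, elim imageE)
      fix y z z' assume z: "y = f z" "z \<in> W \<inter> U" "y = f z'" "z' \<in> K"
      then have "z = z'" using K(2) hf by (metis IntD2 subsetD)
      then show False using z \<open>W \<inter> K = {}\<close> by blast
    qed
  qed
  moreover have "u \<in> W" "u' \<in> W"
    using c connected_component_in[OF c] by (auto simp: W_def)
  ultimately show ?thesis
    using u unfolding connected_component_def by blast
qed

lemma image_h_f: "K \<subseteq> U \<Longrightarrow> h ` f ` K = K"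
  by (force simp: image_iff)

lemma connected_component_image_iff:
  assumes K: "compact K" "K \<subseteq> U" and u: "u \<in> U" "u' \<in> U"
  shows "connected_component (- K) u u' \<longleftrightarrow> connected_component (- f ` K) (f u) (f u')"
proof
  assume "connected_component (- f ` K) (f u) (f u')"
  then have "connected_component (- h ` f ` K) (h (f u)) (h (f u'))"
    using K u by (intro exterior_homeo.connected_component_image[OF swap] compact_image) auto
  then show "connected_component (- K) u u'"
    using K u by (simp add: image_h_f)
qed (use assms connected_component_image in auto)

text \<open>Outside \<open>U\<close> and \<open>V\<close>, two points correspond if they determine the same end, an end being
  identified by the side of each compact \<open>K \<subseteq> U\<close> on which it lies.\<close>

definition corr :: "(complex \<times> complex) set" where
  "corr = {(x, y). x \<in> U \<and> y = f x \<or> x \<notin> U \<and> y \<notin> V \<and>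
     (\<forall>K u. compact K \<and> K \<subseteq> U \<and> u \<in> U - K \<longrightarrow>
        (connected_component (- K) x u \<longleftrightarrow> connected_component (- f ` K) y (f u)))}"

lemma corr_in [simp]: "x \<in> U \<Longrightarrow> (x, y) \<in> corr \<longleftrightarrow> y = f x"
  by (auto simp: corr_def)

lemma corr_in_iff: "(x, y) \<in> corr \<Longrightarrow> x \<in> U \<longleftrightarrow> y \<in> V"
  by (auto simp: corr_def)

lemma corr_side:
  assumes "(x, y) \<in> corr" "compact K" "K \<subseteq> U" "u \<in> U" "u \<notin> K"
  shows "connected_component (- K) x u \<longleftrightarrow> connected_component (- f ` K) y (f u)"
  using assms connected_component_image_iff[of K x u] by (auto simp: corr_def)

lemma corr_swap_subset: "corr\<inverse> \<subseteq> exterior_homeo.corr V U h"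
proof (clarify)
  fix x y assume xy: "(x, y) \<in> corr"
  interpret sw: exterior_homeo V U h f by (rule swap)
  show "(y, x) \<in> sw.corr"
  proof (cases "x \<in> U")
    case False
    then have y: "y \<notin> V" using corr_in_iff xy by blast
    have "connected_component (- K) y u \<longleftrightarrow> connected_component (- h ` K) x (h u)"
      if K: "compact K" "K \<subseteq> V" "u \<in> V - K" for K u
    proof -
      have "connected_component (- h ` K) x (h u) \<longleftrightarrow>
          connected_component (- f ` h ` K) y (f (h u))"
        using K xy by (intro corr_side sw.compact_image) (auto simp: subset_iff dest: sw.hf)
      then show ?thesis
        using K by (simp add: sw.image_h_f)
    qed
    then show ?thesis
      using False y by (auto simp: sw.corr_def)
  qed (use xy in auto)
qed

lemma corr_swap: "exterior_homeo.corr V U h = corr\<inverse>"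
proof
  show "exterior_homeo.corr V U h \<subseteq> corr\<inverse>"
    using exterior_homeo.corr_swap_subset[OF swap] by (metis converse_converse converse_mono)
qed (rule corr_swap_subset)

text \<open>\<open>corr\<close> tests sides only by points of \<open>U\<close>, so every side must
  contain one. A side \<open>W\<close> missing \<open>U\<close> would be bounded and so have a
  frontier point; this lies in \<open>K\<close>, hence in the open set \<open>U\<close>, which then
  meets \<open>W\<close>.\<close>

lemma component_meets_U:
  assumes "compact K" "K \<subseteq> U" "x \<notin> K"
  obtains u where "u \<in> U" "u \<notin> K" "connected_component (- K) x u"
proof -
  define W where "W = connected_component_set (- K) x"
  have W: "open W" "x \<in> W" "W \<inter> K = {}"
    using assms connected_component_subset[of "- K" x]
    by (auto simp: W_def compact_imp_closed open_Compl intro!: open_connected_component)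
  have "W \<inter> U \<noteq> {}"
  proof
    assume WU: "W \<inter> U = {}"
    then have "bounded W"
      using bounded_compl_U by (metis bounded_subset disjoint_eq_subset_Compl)
    then have "frontier W \<noteq> {}"
      using W by (metis empty_iff frontier_not_empty not_bounded_UNIV)
    then obtain w where w: "w \<in> closure W" "w \<notin> W"
      using W by (auto simp: frontier_def interior_open)
    then have "w \<in> U"
      using closure_connected_component_compl[of K x] assms by (auto simp: W_def compact_imp_closed)
    then show False
      using w WU open_U open_Int_closure_eq_empty[of U W] by blast
  qed
  then show thesis
    using W that by (auto simp: W_def)
qed

text \<open>Ends are complementary components: a component of \<open>- V\<close> never crosses the
  image of a compact \<open>K\<close>, and points in different components of the compact set
  \<open>- V\<close> are told apart by some separator in \<open>V\<close>, whose preimage is an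
  admissible \<open>K\<close>.\<close>

lemma corr_fiber:
  assumes xy: "(x, y) \<in> corr" and x: "x \<notin> U"
  shows "corr `` {x} = connected_component_set (- V) y"
proof (intro subset_antisym subsetI)
  fix y' assume "y' \<in> connected_component_set (- V) y"
  then have y': "connected_component (- V) y y'" by simp
  then have "y' \<notin> V" "y \<notin> V"
    by (auto dest: connected_component_in)
  moreover have "connected_component (- K) x u \<longleftrightarrow> connected_component (- f ` K) y' (f u)"
    if K: "compact K" "K \<subseteq> U" "u \<in> U - K" for K u
  proof -
    have "connected_component (- f ` K) y y'"
      using y' K by (elim connected_component_of_subset) auto
    then show ?thesis
      using corr_side[OF xy K(1,2)] K connected_component_sym
        connected_component_trans by (metis DiffE)
  qed
  ultimately show "y' \<in> corr `` {x}"
    using x by (auto simp: corr_def)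
next
  interpret sw: exterior_homeo V U h f by (rule swap)
  fix y' assume "y' \<in> corr `` {x}"
  then have xy': "(x, y') \<in> corr" by simp
  have yV: "y \<notin> V" "y' \<notin> V"
    using x xy xy' corr_in_iff by blast+
  show "y' \<in> connected_component_set (- V) y"
  proof (rule ccontr)
    assume "y' \<notin> connected_component_set (- V) y"
    then have "\<not> connected_component (- V) y y'" by simp
    then obtain K where K: "compact K" "K \<inter> - V = {}" "\<not> connected_component (- K) y y'"
      using separating_continuum[OF sw.compact_compl_U, of y y'] yV by auto
    define K0 where "K0 = h ` K"
    have K0: "compact K0" "K0 \<subseteq> U" "f ` K0 = K"
      using K sw.compact_image[of K] sw.image_h_f[of K] by (auto simp: K0_def)
    then obtain u where u: "u \<in> U" "u \<notin> K0" "connected_component (- K0) x u"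
      using component_meets_U[of K0 x] x by blast
    then have "connected_component (- K) y (f u)" "connected_component (- K) y' (f u)"
      using corr_side[OF xy K0(1,2)] corr_side[OF xy' K0(1,2)] K0(3) by auto
    then show False
      using K(3) connected_component_sym connected_component_trans by metis
  qed
qed

text \<open>Inside the domains this is continuity of \<open>f\<close> and \<open>h\<close>, which
  also excludes limits with only one coordinate inside. If both limits lie outside, the sides of
  \<open>K\<close> containing them are open, so late terms of the sequence lie on the same sides and
  pass on the test.\<close>

lemma closed_corr: "closed corr"
  unfolding closed_sequential_limits
proof (intro allI impI, elim conjE)
  fix p l assume p: "\<forall>n. p n \<in> corr" and lim: "p \<longlonglongrightarrow> l"
  define s t x y where "s = fst \<circ> p" and "t = snd \<circ> p" and "x = fst l" and "y = snd l"
  have st: "(s n, t n) \<in> corr" for n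
    using p by (simp add: s_def t_def)
  have sx: "s \<longlonglongrightarrow> x" and ty: "t \<longlonglongrightarrow> y"
    using tendsto_fst[OF lim] tendsto_snd[OF lim] by (auto simp: s_def t_def x_def y_def o_def)
  have "(x, y) \<in> corr"
  proof -
    consider "x \<in> U" | "y \<in> V" | "x \<notin> U" "y \<notin> V" by blast
    then show ?thesis
    proof cases
      case 1
      then have ev: "\<forall>\<^sub>F n in sequentially. s n \<in> U"
        using topological_tendstoD[OF sx open_U] by blast
      have "(\<lambda>n. f (s n)) \<longlonglongrightarrow> f x"
        using continuous_on_tendsto_compose[OF cont_f sx 1 ev] .
      moreover have "\<forall>\<^sub>F n in sequentially. f (s n) = t n"
        using ev
      proof eventually_elim
        case (elim n)
        then show ?case using st[of n] by auto
      qed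
      ultimately have "t \<longlonglongrightarrow> f x"
        using Lim_transform_eventually by fastforce
      then show ?thesis
        using ty 1 LIMSEQ_unique by auto
    next
      case 2
      then have ev: "\<forall>\<^sub>F n in sequentially. t n \<in> V"
        using topological_tendstoD[OF ty open_V] by blast
      have "(\<lambda>n. h (t n)) \<longlonglongrightarrow> h y"
        using continuous_on_tendsto_compose[OF cont_h ty 2 ev] .
      moreover have "\<forall>\<^sub>F n in sequentially. h (t n) = s n"
        using ev
      proof eventually_elim
        case (elim n)
        then have "s n \<in> U" using corr_in_iff[OF st[of n]] by blast
        then show ?case using st[of n] by simp
      qed
      ultimately have "s \<longlonglongrightarrow> h y"
        using Lim_transform_eventually by fastforce
      then have "x = h y"
        using sx LIMSEQ_unique by auto
      then show ?thesis
        using 2 by simp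
    next
      case 3
      have "connected_component (- K) x u \<longleftrightarrow> connected_component (- f ` K) y (f u)"
        if K: "compact K" "K \<subseteq> U" "u \<in> U - K" for K u
      proof -
        have nK: "x \<notin> K" "y \<notin> f ` K" using K 3 by auto
        have cl: "closed K" "closed (f ` K)"
          using K compact_image compact_imp_closed by auto
        have "\<forall>\<^sub>F n in sequentially. s n \<in> connected_component_set (- K) x"
          using nK cl by (intro topological_tendstoD[OF sx] open_connected_component) auto
        moreover have "\<forall>\<^sub>F n in sequentially. t n \<in> connected_component_set (- f ` K) y"
          using nK cl by (intro topological_tendstoD[OF ty] open_connected_component) auto
        ultimately have "\<forall>\<^sub>F n in sequentially. connected_component (- K) x (s n) \<and>
            connected_component (- f ` K) y (t n)"
          by eventually_elim simp
        then obtain n where n: "connected_component (- K) x (s n)"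
            "connected_component (- f ` K) y (t n)"
          using eventually_happens'[OF sequentially_bot] by blast
        have "connected_component (- K) (s n) u \<longleftrightarrow> connected_component (- f ` K) (t n) (f u)"
          using K by (intro corr_side[OF st]) auto
        then show ?thesis
          using n connected_component_sym connected_component_trans by metis
      qed
      then show ?thesis
        using 3 by (auto simp: corr_def)
    qed
  qed
  then show "l \<in> corr"
    by (simp add: x_def y_def)
qed

lemma corr_limit:
  assumes "\<And>n. s n \<in> U" "s \<longlonglongrightarrow> x" "(\<lambda>n. f (s n)) \<longlonglongrightarrow> y"
  shows "(x, y) \<in> corr"
proof -
  have "(\<lambda>n. (s n, f (s n))) \<longlonglongrightarrow> (x, y)"
    using assms by (intro tendsto_Pair)
  then show ?thesis
    using assms(1) closed_sequentially[OF closed_corr, of "\<lambda>n. (s n, f (s n))" "(x, y)"] by simp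
qed

text \<open>Boundedness of images makes a subsequence of the values converge. The partner is thus a
  genuine limit of values of \<open>f\<close>, which is what a comparison with a continuous
  extension requires.\<close>

lemma frontier_limit:
  assumes "x \<in> closure U"
  obtains s y where "\<And>n. s n \<in> U" "s \<longlonglongrightarrow> x" "(\<lambda>n. f (s n)) \<longlonglongrightarrow> y" "(x, y) \<in> corr"
proof -
  obtain s where s: "\<And>n. s n \<in> U" "s \<longlonglongrightarrow> x"
    using assms by (auto simp: closure_sequential)
  have "bounded (range s)"
    using s(2) convergent_imp_bounded by blast
  then have "bounded (f ` (U \<inter> range s))"
    by (rule bounded_image)
  then have "bounded (range (\<lambda>n. f (s n)))"
    by (rule bounded_subset) (use s in auto)
  then obtain r y where r: "strict_mono r" "((\<lambda>n. f (s n)) \<circ> r) \<longlonglongrightarrow> y"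
    using bounded_imp_convergent_subsequence by blast
  show thesis
  proof (rule that[of "s \<circ> r" y])
    show "(s \<circ> r) \<longlonglongrightarrow> x"
      using s(2) r(1) LIMSEQ_subseq_LIMSEQ by blast
    then show "(x, y) \<in> corr"
      using r s by (intro corr_limit[of "s \<circ> r"]) (auto simp: o_def)
  qed (use s r in \<open>auto simp: o_def\<close>)
qed

lemma compact_component: "compact (connected_component_set (- U) x)"
  using compact_components[OF compact_compl_U] compact_empty
  by (metis componentsI connected_component_eq_empty)

text \<open>A frontier point interior to \<open>- U\<close> would have a ball around it in
  \<open>- U\<close>, and maximality puts this ball into the component.\<close>

lemma frontier_component: "frontier (connected_component_set (- U) x) \<subseteq> frontier U"
proof
  define C where "C = connected_component_set (- U) x"
  have "closed C"
    unfolding C_def using compact_component compact_imp_closed by blast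
  fix x' assume "x' \<in> frontier (connected_component_set (- U) x)"
  then have x': "x' \<in> C" "x' \<notin> interior C"
    using \<open>closed C\<close> frontier_subset_closed by (auto simp: C_def frontier_def)
  have xU: "x' \<notin> U"
    using x'(1) connected_component_subset by (auto simp: C_def)
  have C: "C = connected_component_set (- U) x'"
    using x'(1) connected_component_eq[of x' "- U" x] by (simp add: C_def)
  have "x' \<notin> interior (- U)"
  proof
    assume "x' \<in> interior (- U)"
    then obtain e where e: "e > 0" "ball x' e \<subseteq> - U"
      by (auto simp: mem_interior)
    then have "ball x' e \<subseteq> C"
      unfolding C by (intro connected_component_maximal) auto
    then show False
      using e x'(2) by (meson centre_in_ball interior_maximal open_ball subsetD)
  qed
  then show "x' \<in> frontier U"
    using xU open_U by (auto simp: frontier_def interior_complement interior_open)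
qed

lemma component_meets_frontier:
  assumes "x \<notin> U"
  obtains x' where "connected_component (- U) x x'" "x' \<in> frontier U"
proof -
  define C where "C = connected_component_set (- U) x"
  have C: "x \<in> C" "compact C"
    using assms compact_component by (auto simp: C_def)
  then have "frontier C \<noteq> {}"
    using frontier_not_empty[of C] by (metis compact_imp_bounded empty_iff not_bounded_UNIV)
  then obtain x' where x': "x' \<in> frontier C" by blast
  then have "x' \<in> C"
    using \<open>compact C\<close> compact_imp_closed frontier_subset_closed by blast
  then show thesis
    using that x' frontier_component by (auto simp: C_def)
qed

text \<open>Sequences in \<open>U\<close> reach only boundary points. A point deeper inside a
  complementary component borrows the partner of a frontier point of that component, since the fibre
  over that partner is the whole component.\<close>

lemma corr_total: obtains y where "(x, y) \<in> corr"
proof (cases "x \<in> U")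
  case False
  interpret sw: exterior_homeo V U h f by (rule swap)
  obtain x' where x': "connected_component (- U) x x'" "x' \<in> frontier U"
    using component_meets_frontier[OF False] .
  obtain y where y: "(x', y) \<in> corr"
    using frontier_limit[of x'] x'(2) by (auto simp: frontier_def)
  then have yx': "(y, x') \<in> sw.corr"
    by (simp add: corr_swap)
  have "x' \<notin> U" "y \<notin> V"
    using x' corr_in_iff[OF y] by (auto dest: connected_component_in)
  then have "x \<in> sw.corr `` {y}"
    unfolding sw.corr_fiber[OF yx' \<open>y \<notin> V\<close>] using x' connected_component_sym by auto
  then show thesis
    using that by (auto simp: corr_swap)
qed auto

lemma corr_fiber_connected: "connected (corr `` {x})"
proof (cases "x \<in> U")
  case True
  then have "corr `` {x} = {f x}" by auto
  then show ?thesis by simp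
next
  case False
  obtain y where "(x, y) \<in> corr" by (rule corr_total)
  then show ?thesis
    using corr_fiber False by simp
qed

section \<open>Images of closed and connected sets under the correspondence\<close>

lemma bounded_corr_image: "bounded B \<Longrightarrow> bounded (corr `` B)"
proof (rule bounded_subset[of "f ` (U \<inter> B) \<union> - V"])
  show "corr `` B \<subseteq> f ` (U \<inter> B) \<union> - V"
    by (auto simp: corr_def)
qed (use bounded_image bounded_compl_V in auto)

lemma closed_corr_image:
  assumes "closed C" shows "closed (corr `` C)"
  unfolding closed_sequential_limits
proof (intro allI impI, elim conjE)
  interpret sw: exterior_homeo V U h f by (rule swap)
  fix t y assume t: "\<forall>n. t n \<in> corr `` C" and ty: "t \<longlonglongrightarrow> y"
  then have "\<forall>n. \<exists>x. x \<in> C \<and> (x, t n) \<in> corr"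
    by blast
  then obtain s where s: "\<And>n. s n \<in> C" "\<And>n. (s n, t n) \<in> corr"
    using choice[of "\<lambda>n x. x \<in> C \<and> (x, t n) \<in> corr"] by blast
  have "bounded (sw.corr `` range t)"
    using ty convergent_imp_bounded by (intro sw.bounded_corr_image) blast
  then have "bounded (range s)"
    by (rule bounded_subset) (use s in \<open>auto simp: corr_swap\<close>)
  then obtain r x where r: "strict_mono r" "(s \<circ> r) \<longlonglongrightarrow> x"
    using bounded_imp_convergent_subsequence by blast
  have "(\<lambda>n. (s (r n), t (r n))) \<longlonglongrightarrow> (x, y)"
    using r LIMSEQ_subseq_LIMSEQ[OF ty r(1)] by (intro tendsto_Pair) (auto simp: o_def)
  then have "(x, y) \<in> corr"
    using s closed_sequentially[OF closed_corr, of "\<lambda>n. (s (r n), t (r n))" "(x, y)"] by simp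
  moreover have "x \<in> C"
    using closed_sequentially[OF assms _ r(2)] s(1) by simp
  ultimately show "y \<in> corr `` C" by blast
qed

text \<open>The argument for monotone maps: a connected fibre cannot be split between
  \<open>P\<close> and \<open>Q\<close>, and the points whose fibre lies in one of them form an open
  set, because the inverse relation carries closed sets to closed sets. A separation of the image
  thus descends to \<open>A\<close>.\<close>

lemma connected_corr_image:
  assumes "connected A" shows "connected (corr `` A)"
  unfolding connected_def
proof clarify
  interpret sw: exterior_homeo V U h f by (rule swap)
  fix P Q assume PQ: "open P" "open Q" "corr `` A \<subseteq> P \<union> Q" "P \<inter> Q \<inter> corr `` A = {}"
    and ne: "P \<inter> corr `` A \<noteq> {}" "Q \<inter> corr `` A \<noteq> {}"
  define P' Q' where "P' = - (sw.corr `` (- P))" and "Q' = - (sw.corr `` (- Q))"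
  have o: "open P'" "open Q'"
    unfolding P'_def Q'_def using PQ by (auto intro!: sw.closed_corr_image)
  have one: "corr `` {x} \<subseteq> P \<or> corr `` {x} \<subseteq> Q" if "x \<in> A" for x
    using connectedD[OF corr_fiber_connected[of x] PQ(1,2)] PQ(3,4) that by blast
  have mem: "x \<in> P' \<longleftrightarrow> corr `` {x} \<subseteq> P" "x \<in> Q' \<longleftrightarrow> corr `` {x} \<subseteq> Q" for x
    by (auto simp: P'_def Q'_def corr_swap)
  have "A \<subseteq> P' \<union> Q'"
    using one mem by blast
  moreover have "P' \<inter> Q' \<inter> A = {}"
  proof (rule ccontr)
    assume "P' \<inter> Q' \<inter> A \<noteq> {}"
    then obtain x where "x \<in> P'" "x \<in> Q'" "x \<in> A" by auto
    moreover obtain y where "(x, y) \<in> corr" by (rule corr_total)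
    ultimately show False
      using mem PQ(4) by blast
  qed
  moreover have "P' \<inter> A \<noteq> {}" "Q' \<inter> A \<noteq> {}"
  proof -
    obtain x y where x: "x \<in> A" "(x, y) \<in> corr" "y \<in> P" using ne by auto
    then have "x \<in> P'" using one[of x] mem PQ(4) by blast
    then show "P' \<inter> A \<noteq> {}" using x by auto
    obtain x y where x: "x \<in> A" "(x, y) \<in> corr" "y \<in> Q" using ne by auto
    then have "x \<in> Q'" using one[of x] mem PQ(4) by blast
    then show "Q' \<inter> A \<noteq> {}" using x by auto
  qed
  ultimately show False
    using assms o unfolding connected_def by blast
qed

text \<open>The theorem speaks of components of the frontier, the correspondence of components of
  the complement. Frontier points of \<open>D\<close> in different components of the frontier would
  be separated by a continuum \<open>K\<close> off the frontier. Being connected, \<open>K\<close>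
  lies in \<open>U\<close> and misses the connected set \<open>D\<close>, or it misses the connected
  set \<open>closure U\<close>; either way it does not separate them.\<close>

lemma component_Int_frontier:
  assumes D: "D \<in> components (- U)"
  shows "D \<inter> frontier U \<in> components (frontier U)"
proof -
  have frU: "compact (frontier U)" "frontier U = closure U \<inter> - U"
    using compact_frontier_bounded[OF bounded_compl_U] open_U
    by (auto simp: frontier_complement) (auto simp: frontier_def interior_open)
  obtain x where x: "x \<in> D" "D = connected_component_set (- U) x" "x \<notin> U"
    using D by (auto simp: components_def)
  obtain w where w: "w \<in> D" "w \<in> frontier U"
    using component_meets_frontier[OF x(3)] x by auto
  have "connected_component (frontier U) w y" if y: "y \<in> D" "y \<in> frontier U" for y
  proof (rule ccontr)
    assume "\<not> connected_component (frontier U) w y"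
    then obtain K where K: "connected K" "K \<inter> frontier U = {}" "\<not> connected_component (- K) w y"
      using separating_continuum[OF frU(1) w(2) y(2)] by metis
    have "K \<subseteq> U \<or> K \<inter> U = {}"
      using connected_Int_frontier[OF K(1), of U] K(2) by auto
    then show False
    proof
      assume "K \<subseteq> U"
      then have "D \<subseteq> - K" using D in_components_subset by blast
      then show False
        using K(3) w(1) y(1) D in_components_connected connected_component_def by metis
    next
      assume "K \<inter> U = {}"
      then have "closure U \<subseteq> - K"
        using K(2) frU by auto
      then show False
        using K(3) w(2) y(2) frU(2) connected_imp_connected_closure[OF connected_U]
        unfolding connected_component_def by blast
    qed
  qed
  moreover have "y \<in> D" if "connected_component (frontier U) w y" for y
  proof -
    have "connected_component (- U) w y"
      using that frU(2) by (elim connected_component_of_subset) auto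
    moreover have "connected_component (- U) x w"
      using w(1) x(2) by simp
    ultimately show ?thesis
      using x(2) connected_component_trans by fastforce
  qed
  ultimately have "D \<inter> frontier U = connected_component_set (frontier U) w"
    by (auto dest: connected_component_in)
  then show ?thesis
    using w by (auto simp: components_def)
qed

end

section \<open>Boundary limits from short circles\<close>

text \<open>Uniform local connectedness, for small sets \<open>A\<close> of any cardinality, since
  the image of an arc may accumulate at many points. Cut the parameter interval into pieces with
  images smaller than \<open>e\<close> and take all pieces meeting \<open>A\<close>. If
  \<open>d\<close> is at most the distance of any two disjoint pieces, those meeting
  \<open>A\<close> intersect pairwise, so their union is connected.\<close>

lemma peano_continuum_small_connected:
  fixes P :: "complex set"
  assumes "peano_continuum P" "e > 0"
  obtains d where "d > 0"
    "\<And>A. \<lbrakk>A \<subseteq> P; \<And>a b. a \<in> A \<Longrightarrow> b \<in> A \<Longrightarrow> dist a b < d\<rbrakk> \<Longrightarrow>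
       \<exists>W. A \<subseteq> W \<and> W \<subseteq> P \<and> compact W \<and> connected W \<and> (\<forall>w\<in>W. \<exists>a\<in>A. dist w a < e)"
proof -
  obtain g where g: "continuous_on {0..1::real} g" "g ` {0..1} = P"
    using assms by (auto simp: peano_continuum_def)
  have "uniformly_continuous_on {0..1::real} g"
    using g compact_uniformly_continuous by blast
  then obtain k where k: "k > 0"
    "\<And>s t. s \<in> {0..1} \<Longrightarrow> t \<in> {0..1} \<Longrightarrow> dist s t < k \<Longrightarrow> dist (g s) (g t) < e"
    using \<open>e > 0\<close> by (metis dist_commute uniformly_continuous_onE)
  obtain n where n: "n > 0" "1 / real n < k"
    using k(1) by (metis nat_approx_posE zero_less_Suc)
  define G where "G j = g ` {real j / n .. real (Suc j) / n}" for j
  have sub: "{real j / n .. real (Suc j) / n} \<subseteq> {0..1}" if "j < n" for j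
    using that n by (auto simp: field_simps dest: order_trans)
  have G: "compact (G j)" "connected (G j)" "G j \<subseteq> P" if "j < n" for j
  proof -
    have c: "continuous_on {real j / n .. real (Suc j) / n} g"
      using g(1) sub[OF that] continuous_on_subset by blast
    show "compact (G j)" "connected (G j)"
      unfolding G_def using c by (auto intro!: compact_continuous_image connected_continuous_image)
    show "G j \<subseteq> P"
      using image_mono[OF sub[OF that], of g] g(2) by (simp add: G_def)
  qed
  have diamG: "dist u v < e" if "j < n" "u \<in> G j" "v \<in> G j" for j u v
  proof -
    obtain s t where st: "u = g s" "v = g t" "s \<in> {real j / n .. real (Suc j) / n}"
      "t \<in> {real j / n .. real (Suc j) / n}"
      using \<open>u \<in> G j\<close> \<open>v \<in> G j\<close> by (auto simp: G_def)
    have "dist s t \<le> 1 / n"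
      using st(3,4) n by (auto simp: dist_real_def abs_le_iff field_simps)
    then show ?thesis
      using st(1,2) n(2) k(2)[of s t] subsetD[OF sub[OF \<open>j < n\<close>] st(3)]
        subsetD[OF sub[OF \<open>j < n\<close>] st(4)] by simp
  qed
  have cover: "\<exists>j<n. u \<in> G j" if u: "u \<in> P" for u
  proof -
    obtain t where t: "u = g t" "0 \<le> t" "t \<le> 1"
      using g(2) u by auto
    show ?thesis
    \<comment> \<open>At the right end point the floor would give the index \<open>n\<close>, one
      past the last piece.\<close>
    proof (cases "t = 1")
      case True
      then have "u \<in> G (n - 1)"
        using n t(1) by (auto simp: G_def intro!: imageI)
      then show ?thesis using n by (intro exI[of _ "n - 1"]) auto
    next
      case False
      define j where "j = nat \<lfloor>t * n\<rfloor>"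
      have j: "real j \<le> t * n" "t * n < real j + 1"
        using t by (auto simp: j_def)
      have "t * n < n"
        using False t n by auto
      then have "j < n" using j by linarith
      moreover have "t \<in> {real j / n .. real (Suc j) / n}"
        using j n by (auto simp: field_simps)
      ultimately show ?thesis
        using t(1) by (auto simp: G_def)
    qed
  qed
  \<comment> \<open>The default 1 keeps the minimum defined when all pieces meet.\<close>
  define X where "X = insert 1 ((\<lambda>(i, j). setdist (G i) (G j)) `
      {(i, j). i < n \<and> j < n \<and> G i \<inter> G j = {}})"
  have "finite {(i, j). i < n \<and> j < n \<and> G i \<inter> G j = {}}"
    by (rule finite_subset[of _ "{..<n} \<times> {..<n}"]) auto
  then have finX: "finite X" by (simp add: X_def)
  have ne: "G i \<noteq> {}" for i
    using n by (auto simp: G_def divide_right_mono)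
  have posX: "x > 0" if "x \<in> X" for x
  proof -
    have "setdist (G i) (G j) > 0" if "i < n" "j < n" "G i \<inter> G j = {}" for i j
      using setdist_gt_0_compact_closed[of "G i" "G j"] G that ne compact_imp_closed by blast
    then show ?thesis
      using \<open>x \<in> X\<close> by (auto simp: X_def)
  qed
  define d where "d = Min X"
  have d: "d > 0"
    using posX finX by (simp add: d_def X_def)
  have meet: "G i \<inter> G j \<noteq> {}" if "i < n" "j < n" "a \<in> G i" "b \<in> G j" "dist a b < d" for i j a b
  proof
    assume "G i \<inter> G j = {}"
    then have "d \<le> setdist (G i) (G j)"
      using that finX by (auto simp: d_def X_def intro!: Min_le)
    then show False
      using setdist_le_dist[OF that(3,4)] that(5) by simp
  qed
  show thesis
  proof (rule that[OF d])
    fix A assume A: "A \<subseteq> P" "\<And>a b. a \<in> A \<Longrightarrow> b \<in> A \<Longrightarrow> dist a b < d"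
    define J where "J = {j. j < n \<and> G j \<inter> A \<noteq> {}}"
    define W where "W = (\<Union>j\<in>J. G j)"
    have "A \<subseteq> W"
      using A(1) cover by (fastforce simp: W_def J_def)
    moreover have "W \<subseteq> P"
      using G by (auto simp: W_def J_def)
    moreover have "compact W"
      using G by (auto simp: W_def J_def intro!: compact_UN)
    moreover have "connected W"
    proof (cases "J = {}")
      case False
      then obtain i where i: "i \<in> J" by blast
      have pair: "connected (G i \<union> G j)" if j: "j \<in> J" for j
      proof -
        obtain a b where "a \<in> G i" "a \<in> A" "b \<in> G j" "b \<in> A"
          using i j by (auto simp: J_def)
        then have "G i \<inter> G j \<noteq> {}"
          using meet[of i j a b] A(2) i j by (auto simp: J_def)
        then show ?thesis
          using G i j by (intro connected_Un) (auto simp: J_def)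
      qed
      have "connected (\<Union>j\<in>J. G i \<union> G j)"
        using pair ne[of i] by (intro connected_Union) auto
      moreover have "(\<Union>j\<in>J. G i \<union> G j) = W"
        using i by (auto simp: W_def)
      ultimately show ?thesis by simp
    qed (simp add: W_def)
    moreover have "\<exists>a\<in>A. dist w a < e" if w: "w \<in> W" for w
    proof -
      obtain j a where "j < n" "w \<in> G j" "a \<in> G j" "a \<in> A"
        using w by (auto simp: W_def J_def)
      then show ?thesis
        using diamG by blast
    qed
    ultimately show "\<exists>W. A \<subseteq> W \<and> W \<subseteq> P \<and> compact W \<and> connected W \<and> (\<forall>w\<in>W. \<exists>a\<in>A. dist w a < e)"
      by blast
  qed
qed

text \<open>The projection of a connected set to an axis is an interval, so the measure of any
  superset bounds its length.\<close>

lemma connected_spread_le: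
  fixes M :: "complex set"
  assumes "connected M" "N \<in> sets lborel" "emeasure lborel N \<le> ennreal e" "e \<ge> 0"
    "(\<lambda>w. w \<bullet> v) ` M \<subseteq> N" "a \<in> M" "b \<in> M"
  shows "\<bar>a \<bullet> v - b \<bullet> v\<bar> \<le> e"
proof -
  have *: "t - s \<le> e" if st: "s \<in> (\<lambda>w. w \<bullet> v) ` M" "t \<in> (\<lambda>w. w \<bullet> v) ` M" for s t
  proof (cases "s \<le> t")
    case True
    have "connected ((\<lambda>w. w \<bullet> v) ` M)"
      by (intro connected_continuous_image continuous_intros assms)
    then have "{s..t} \<subseteq> (\<lambda>w. w \<bullet> v) ` M"
      using st connected_contains_Icc by blast
    then have "emeasure lborel {s..t} \<le> emeasure lborel N"
      using assms by (intro emeasure_mono) auto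
    then have "ennreal (t - s) \<le> ennreal e"
      using assms(3) True by simp
    then show ?thesis
      using \<open>e \<ge> 0\<close> by (simp add: ennreal_le_iff)
  qed (use \<open>e \<ge> 0\<close> in auto)
  show ?thesis
    using *[of "a \<bullet> v" "b \<bullet> v"] *[of "b \<bullet> v" "a \<bullet> v"] assms by (auto simp: abs_le_iff)
qed

text \<open>In the application \<open>Q\<close> is a Jordan curve and \<open>S\<close> is what
  remains after removal of a short arc about \<open>z0\<close>. All of \<open>Q\<close> outside the
  ball lies in \<open>S\<close>, so \<open>Q\<close> and \<open>S \<union> - ball z0 r\<close> meet
  exactly in the connected set \<open>S\<close>, and Janiszewski's theorem applies.\<close>

lemma Jordan_uniformly_locally_connected:
  fixes U Q S :: "complex set"
  assumes U: "connected U" "U \<inter> Q = {}" and Q: "compact Q" "S \<subseteq> Q" "Q - S \<subseteq> ball z0 r"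
    and S: "compact S" "connected S" "z0 \<notin> S" and r: "r > 0"
  obtains d where "d > 0" "d \<le> r"
    "\<And>z z'. z \<in> U \<inter> ball z0 d \<Longrightarrow> z' \<in> U \<inter> ball z0 d \<Longrightarrow> connected_component (ball z0 r - Q) z z'"
proof -
  obtain d0 where d0: "d0 > 0" "ball z0 d0 \<inter> S = {}"
    using S compact_imp_closed[OF S(1)] by (metis ComplI disjoint_eq_subset_Compl openE open_Compl)
  define d where "d = min d0 r"
  show thesis
  proof
    fix z z' assume z: "z \<in> U \<inter> ball z0 d" "z' \<in> U \<inter> ball z0 d"
    have "connected_component (- (Q \<union> (S \<union> - ball z0 r))) z z'"
    proof (rule Janiszewski[OF Q(1)])
      show "closed (S \<union> - ball z0 r)"
        using S compact_imp_closed by (auto intro!: closed_Un)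
      have "Q \<inter> (S \<union> - ball z0 r) = S"
        using Q by auto
      then show "connected (Q \<inter> (S \<union> - ball z0 r))"
        using S by simp
      show "connected_component (- Q) z z'"
        using U z by (auto simp: connected_component_def intro!: exI[of _ U])
      have "ball z0 d \<subseteq> - (S \<union> - ball z0 r)"
        using d0 by (auto simp: d_def)
      then show "connected_component (- (S \<union> - ball z0 r)) z z'"
        using z unfolding connected_component_def by (intro exI[of _ "ball z0 d"]) auto
    qed
    then show "connected_component (ball z0 r - Q) z z'"
      by (rule connected_component_of_subset) auto
  qed (use d0 r in \<open>auto simp: d_def\<close>)
qed

lemma locally_connected_sphere_Diff:
  fixes C :: "'a::euclidean_space set"
  assumes "closed C" shows "locally connected (sphere z0 r - C)"
  using assms locally_open_subset[OF locally_connected_sphere]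
  by (metis Diff_eq closed_def openin_open_Int)

lemma closed_Un_component_sphere:
  fixes C :: "complex set"
  assumes "closed C" "\<I> \<subseteq> components (sphere z0 r - C)"
  shows "closed (C \<union> (sphere z0 r - \<Union>\<I>))"
proof -
  have "openin (top_of_set (sphere z0 r - C)) (\<Union>\<I>)"
    using assms(2) openin_components_locally_connected[OF locally_connected_sphere_Diff[OF assms(1)]]
    by blast
  then obtain T where T: "open T" "\<Union>\<I> = (sphere z0 r - C) \<inter> T"
    by (auto simp: openin_open)
  have "C \<union> (sphere z0 r - \<Union>\<I>) = C \<union> (sphere z0 r - T)"
    using T by auto
  then show ?thesis
    using T assms by (auto intro!: closed_Un closed_Diff)
qed

text \<open>The circle separates \<open>z\<close> from \<open>p\<close>; the point is to manage with
  a single arc. If no arc separated together with \<open>C\<close>, Janiszewski's theorem could add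
  the arcs one after the other, each new one meeting the previous stage in \<open>C\<close> only.
  This handles finitely many. A path in \<open>U\<close> from \<open>z\<close> to \<open>p\<close>
  meets only finitely many arcs, by compactness, and it avoids all the others together with
  \<open>C\<close>, so that these are added in a single step.\<close>

lemma separating_arc:
  fixes U C :: "complex set"
  assumes U: "open U" "connected U" "U \<inter> C = {}" and C: "compact C" "connected C"
    and z: "z \<in> U" "p \<in> U" "z \<in> ball z0 r" "p \<notin> cball z0 r"
  obtains I where "I \<in> components (sphere z0 r - C)"
    "\<not> connected_component (- (C \<union> I)) z p"
proof (rule ccontr)
  assume n: "\<not> thesis"
  note arc = that
  have clI: "closed (C \<union> I)" if I: "I \<in> components (sphere z0 r - C)" for I
  proof -
    have "I = sphere z0 r - C - \<Union>(components (sphere z0 r - C) - {I})"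
    proof (intro subset_antisym subsetI)
      fix x assume x: "x \<in> I"
      then have "x \<notin> J" if "J \<in> components (sphere z0 r - C) - {I}" for J
        using components_nonoverlap[OF I, of J] that by auto
      then show "x \<in> sphere z0 r - C - \<Union>(components (sphere z0 r - C) - {I})"
        using x in_components_subset[OF I] by blast
    next
      fix x assume x: "x \<in> sphere z0 r - C - \<Union>(components (sphere z0 r - C) - {I})"
      then have "x \<in> \<Union>(components (sphere z0 r - C))"
        using Union_components by blast
      then show "x \<in> I" using x by blast
    qed
    then have "C \<union> I = C \<union> (sphere z0 r - \<Union>(components (sphere z0 r - C) - {I}))"
      by auto
    then show ?thesis
      using closed_Un_component_sphere[of C "components (sphere z0 r - C) - {I}" z0 r] C
      by (simp add: compact_imp_closed)
  qed
  have conn: "connected_component (- (C \<union> I)) z p" if "I \<in> components (sphere z0 r - C)" for I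
    using n arc[OF that] by blast
  have "path_connected U"
    using U connected_open_path_connected by blast
  then obtain g where g: "path g" "path_image g \<subseteq> U" "pathstart g = z" "pathfinish g = p"
    using z unfolding path_connected_def by blast
  define \<I> where "\<I> = {I \<in> components (sphere z0 r - C). I \<inter> path_image g \<noteq> {}}"
  have "finite \<I>"
  proof -
    have lc: "locally connected (sphere z0 r - C)"
      using C by (intro locally_connected_sphere_Diff compact_imp_closed)
    define T where "T I = (SOME T. open T \<and> I = (sphere z0 r - C) \<inter> T)" for I
    have T: "open (T I)" "I = (sphere z0 r - C) \<inter> T I" if "I \<in> components (sphere z0 r - C)" for I
    proof -
      have "\<exists>T. open T \<and> I = (sphere z0 r - C) \<inter> T"
        using openin_components_locally_connected[OF lc that] by (auto simp: openin_open)
      from someI_ex[OF this] show "open (T I)" "I = (sphere z0 r - C) \<inter> T I"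
        by (auto simp: T_def)
    qed
    define L where "L = path_image g \<inter> sphere z0 r"
    have "compact L"
      unfolding L_def using g by (intro compact_Int_closed compact_path_image) auto
    have LC: "L \<inter> C = {}"
      using g U by (auto simp: L_def)
    have "L \<subseteq> \<Union>(T ` components (sphere z0 r - C))"
    proof
      fix x assume x: "x \<in> L"
      then have "x \<in> \<Union>(components (sphere z0 r - C))"
        unfolding Union_components using LC by (auto simp: L_def)
      then show "x \<in> \<Union>(T ` components (sphere z0 r - C))"
        using T by blast
    qed
    then obtain \<J> where J: "\<J> \<subseteq> components (sphere z0 r - C)" "finite \<J>" "L \<subseteq> \<Union>(T ` \<J>)"
      using compactE_image[OF \<open>compact L\<close>, of "components (sphere z0 r - C)" T] T by auto
    have "\<I> \<subseteq> \<J>"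
    proof
      fix I assume "I \<in> \<I>"
      then obtain x where x: "x \<in> I" "x \<in> path_image g" "I \<in> components (sphere z0 r - C)"
        by (auto simp: \<I>_def)
      then have xs: "x \<in> sphere z0 r - C" using in_components_subset by blast
      then have "x \<in> L" using x by (auto simp: L_def)
      then obtain I' where "I' \<in> \<J>" "x \<in> T I'" using J by auto
      then have "x \<in> I'" using T J xs by blast
      then have "I' = I"
        using x \<open>I' \<in> \<J>\<close> J(1) components_eq by (metis IntI empty_iff subsetD)
      then show "I \<in> \<J>" using \<open>I' \<in> \<J>\<close> by simp
    qed
    then show ?thesis using J(2) finite_subset by blast
  qed
  have Cz: "connected_component (- C) z p"
    using U z by (auto simp: connected_component_def intro!: exI[of _ U])
  have bnd: "bounded I" if "I \<in> components (sphere z0 r - C)" for I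
    using in_components_subset[OF that] by (intro bounded_subset[OF bounded_sphere[of z0 r]]) auto
  have fin: "\<J> \<subseteq> components (sphere z0 r - C) \<Longrightarrow> closed (C \<union> \<Union>\<J>) \<and>
      connected_component (- (C \<union> \<Union>\<J>)) z p" if "finite \<J>" for \<J>
    using that
  proof (induction \<J>)
    case empty
    then show ?case using Cz C compact_imp_closed by auto
  next
    case (insert I \<J>)
    then have IH: "closed (C \<union> \<Union>\<J>)" "connected_component (- (C \<union> \<Union>\<J>)) z p"
      and I: "I \<in> components (sphere z0 r - C)" and J: "\<J> \<subseteq> components (sphere z0 r - C)"
      by auto
    have eq: "C \<union> \<Union>(insert I \<J>) = (C \<union> I) \<union> (C \<union> \<Union>\<J>)" by auto
    have "I \<inter> \<Union>\<J> = {}"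
    proof -
      have "I \<inter> I' = {}" if "I' \<in> \<J>" for I'
        using components_nonoverlap[OF I, of I'] that J insert.hyps by auto
      then show ?thesis by blast
    qed
    then have CC: "(C \<union> I) \<inter> (C \<union> \<Union>\<J>) = C" by auto
    have "compact (C \<union> I)"
      using clI[OF I] C(1) bnd[OF I] by (simp add: compact_eq_bounded_closed)
    then have "connected_component (- ((C \<union> I) \<union> (C \<union> \<Union>\<J>))) z p"
      by (rule Janiszewski[OF _ IH(1) _ conn[OF I] IH(2)]) (simp_all add: CC C(2))
    moreover have "closed ((C \<union> I) \<union> (C \<union> \<Union>\<J>))"
      by (rule closed_Un[OF clI[OF I] IH(1)])
    ultimately show ?case
      unfolding eq by blast
  qed
  have IJ: "\<I> \<subseteq> components (sphere z0 r - C)" by (auto simp: \<I>_def)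
  have rest: "closed (C \<union> (sphere z0 r - \<Union>\<I>))"
    using closed_Un_component_sphere[of C \<I> z0 r] C IJ by (simp add: compact_imp_closed)
  have arcs: "connected_component (- (C \<union> (sphere z0 r - \<Union>\<I>))) z p"
  proof -
    have "x \<in> \<Union>\<I>" if x: "x \<in> path_image g" "x \<in> sphere z0 r" for x
    proof -
      have "x \<in> sphere z0 r - C" using x g U by auto
      then obtain I where "I \<in> components (sphere z0 r - C)" "x \<in> I"
        using Union_components[of "sphere z0 r - C"] by blast
      then show ?thesis using x by (auto simp: \<I>_def)
    qed
    then have "path_image g \<subseteq> - (C \<union> (sphere z0 r - \<Union>\<I>))"
      using g U by blast
    then show ?thesis
      using g connected_path_image[OF g(1)] pathstart_in_path_image[of g] pathfinish_in_path_image[of g]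
      unfolding connected_component_def by blast
  qed
  have int: "(C \<union> \<Union>\<I>) \<inter> (C \<union> (sphere z0 r - \<Union>\<I>)) = C"
    by auto
  have clI': "closed (C \<union> \<Union>\<I>)" "connected_component (- (C \<union> \<Union>\<I>)) z p"
    using fin[OF \<open>finite \<I>\<close> IJ] by blast+
  have "bounded (\<Union>\<I>)"
    using bnd IJ \<open>finite \<I>\<close> by (intro bounded_Union) auto
  then have "compact (C \<union> \<Union>\<I>)"
    using clI'(1) C(1) by (simp add: compact_eq_bounded_closed)
  then have "connected_component (- ((C \<union> \<Union>\<I>) \<union> (C \<union> (sphere z0 r - \<Union>\<I>)))) z p"
    by (rule Janiszewski[OF _ rest _ clI'(2) arcs]) (simp only: int C(2))
  then obtain T where T: "connected T" "T \<subseteq> - ((C \<union> \<Union>\<I>) \<union> (C \<union> (sphere z0 r - \<Union>\<I>)))"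
      "z \<in> T" "p \<in> T"
    by (auto simp: connected_component_def)
  \<comment> \<open>Now \<open>C\<close> and all arcs are avoided at once, hence the whole circle,
    which is impossible for a connected set from inside to outside.\<close>
  have "T \<inter> frontier (ball z0 r) \<noteq> {}"
    using z T by (intro connected_Int_frontier[OF T(1)]) auto
  moreover have "r > 0" using z(3) by (auto intro: le_less_trans[OF zero_le_dist])
  ultimately show False
    using T(2) by auto
qed


section \<open>Boundary limits at point components and at points of Jordan curves\<close>

context exterior_homeo
begin

lemma limit_if_fiber_singleton:
  assumes "corr `` {z0} = {y0}"
  shows "(f \<longlongrightarrow> y0) (at z0 within U)"
proof (rule tendstoI)
  interpret sw: exterior_homeo V U h f by (rule swap)
  fix e :: real assume "e > 0"
  define O' where "O' = - (sw.corr `` (- ball y0 e))"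
  have "open O'"
    unfolding O'_def by (intro open_Compl sw.closed_corr_image) auto
  moreover have "y = y0" if "(z0, y) \<in> corr" for y
    using that assms by blast
  then have "z0 \<in> O'"
    using \<open>e > 0\<close> by (auto simp: O'_def corr_swap)
  ultimately have O': "open O'" "z0 \<in> O'" by auto
  have "dist (f x) y0 < e" if x: "x \<in> O'" "x \<in> U" for x
  proof -
    have "(x, f x) \<in> corr" using x by simp
    then have "f x \<in> ball y0 e"
      using x by (force simp: O'_def corr_swap)
    then show ?thesis by (simp add: dist_commute)
  qed
  then show "\<forall>\<^sub>F x in at z0 within U. dist (f x) y0 < e"
    unfolding eventually_at_topological using O' by blast
qed

lemma limit_if_small_oscillation:
  assumes "z0 \<in> closure U"
    and "\<And>e. e > 0 \<Longrightarrow> \<exists>d b. d > 0 \<and> f ` (U \<inter> ball z0 d) \<subseteq> cball b e"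
  shows "\<exists>y0. (f \<longlongrightarrow> y0) (at z0 within U)"
proof -
  obtain s y where s: "\<And>n. s n \<in> U" "s \<longlonglongrightarrow> z0" "(\<lambda>n. f (s n)) \<longlonglongrightarrow> y"
    using frontier_limit[OF assms(1)] by metis
  have "(f \<longlongrightarrow> y) (at z0 within U)"
  proof (rule tendstoI)
    fix e :: real assume "e > 0"
    \<comment> \<open>A third is enough: both \<open>f x\<close> and the limit \<open>y\<close> lie
      within \<open>e / 3\<close> of \<open>b\<close>, so the final inequality is strict.\<close>
    then obtain d b where d: "d > 0" "f ` (U \<inter> ball z0 d) \<subseteq> cball b (e / 3)"
      using assms(2)[of "e / 3"] by auto
    have "\<forall>\<^sub>F n in sequentially. s n \<in> ball z0 d"
      using d by (intro topological_tendstoD[OF s(2)]) auto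
    then have "\<forall>\<^sub>F n in sequentially. f (s n) \<in> cball b (e / 3)"
      by eventually_elim (use d s in blast)
    then have y: "y \<in> cball b (e / 3)"
      using Lim_in_closed_set[OF closed_cball _ sequentially_bot s(3)] by blast
    have "dist (f x) y < e" if x: "x \<in> ball z0 d" "x \<in> U" for x
    proof -
      have "f x \<in> cball b (e / 3)" using d x by blast
      then show ?thesis
        using y \<open>e > 0\<close> dist_triangle3[of "f x" y b] by (simp add: dist_commute)
    qed
    then show "\<forall>\<^sub>F x in at z0 within U. dist (f x) y < e"
      unfolding eventually_at_topological using d by (intro exI[of _ "ball z0 d"]) auto
  qed
  then show ?thesis by blast
qed

lemma corr_component:
  assumes "(z0, y) \<in> corr" "z0 \<notin> U"
  shows "corr `` (connected_component_set (- U) z0) = corr `` {z0}"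
proof -
  interpret sw: exterior_homeo V U h f by (rule swap)
  have y: "y \<notin> V" using assms corr_in_iff by blast
  have C: "connected_component_set (- U) z0 = sw.corr `` {y}"
    using sw.corr_fiber[of y z0] assms y by (simp add: corr_swap)
  have "corr `` {x} = corr `` {z0}" if "x \<in> connected_component_set (- U) z0" for x
  proof -
    have "(x, y) \<in> corr" using that C by (auto simp: corr_swap)
    moreover have "x \<notin> U" using that connected_component_subset by blast
    ultimately show ?thesis
      using corr_fiber assms by metis
  qed
  moreover have "z0 \<in> connected_component_set (- U) z0"
    using assms by simp
  ultimately show ?thesis by blast
qed

lemma corr_separated:
  assumes "z0 \<notin> U" "connected_component_set (- U) z0 \<inter> I = {}"
  shows "corr `` I \<inter> corr `` {z0} = {}"
proof (rule ccontr)
  interpret sw: exterior_homeo V U h f by (rule swap)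
  assume "corr `` I \<inter> corr `` {z0} \<noteq> {}"
  then obtain x y where x: "x \<in> I" "(x, y) \<in> corr" "(z0, y) \<in> corr" by auto
  then have "y \<notin> V" using assms corr_in_iff by blast
  then have "sw.corr `` {y} = connected_component_set (- U) z0"
    using x sw.corr_fiber[of y z0] by (simp add: corr_swap)
  then have "x \<in> connected_component_set (- U) z0"
    using x by (auto simp: corr_swap)
  then show False using x assms by blast
qed

text \<open>Let \<open>t\<close> lie between the two coordinates. The fibre over \<open>z0\<close>
  is connected and so meets the line with coordinate \<open>t\<close>. The preimage of this line is
  connected and contains \<open>z0\<close>, but is not inside the disc, as bounded sets have bounded
  images and the line is unbounded. It crosses the circle, and so \<open>t\<close> belongs to
  \<open>N\<close>: the shadow of the fibre is no longer than that of the circle.\<close>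

lemma point_fiber_spread:
  assumes C: "connected_component_set (- U) z0 = {z0}" and y: "(z0, y) \<in> corr" "(z0, y') \<in> corr"
    and v: "v \<in> Basis" and r: "r > 0"
    and N: "N \<in> sets lborel" "emeasure lborel N < ennreal d" "d > 0"
      "(\<lambda>w. w \<bullet> v) ` (corr `` (sphere z0 r - {z0})) \<subseteq> N"
  shows "y' \<bullet> v - y \<bullet> v < d"
proof (rule ccontr)
  interpret sw: exterior_homeo V U h f by (rule swap)
  assume "\<not> y' \<bullet> v - y \<bullet> v < d"
  then have le: "y' \<bullet> v - y \<bullet> v \<ge> d" by simp
  have vv: "v \<bullet> v = 1" "v \<noteq> 0"
    using v nonzero_Basis by (auto simp: inner_Basis)
  have "{y \<bullet> v..y' \<bullet> v} \<subseteq> N"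
  proof
    fix t assume t: "t \<in> {y \<bullet> v..y' \<bullet> v}"
    define L where "L = {w. v \<bullet> w = t}"
    have "connected L"
      unfolding L_def by (intro convex_connected convex_hyperplane)
    have "t \<in> (\<lambda>w. w \<bullet> v) ` (corr `` {z0})"
    proof -
      have "connected ((\<lambda>w. w \<bullet> v) ` (corr `` {z0}))"
        by (intro connected_continuous_image continuous_intros corr_fiber_connected)
      then have "{y \<bullet> v..y' \<bullet> v} \<subseteq> (\<lambda>w. w \<bullet> v) ` (corr `` {z0})"
        using y by (intro connected_contains_Icc) auto
      then show ?thesis using t by blast
    qed
    then have z0: "z0 \<in> sw.corr `` L"
      by (auto simp: corr_swap L_def inner_commute)
    have conn: "connected (sw.corr `` L)"
      by (intro sw.connected_corr_image \<open>connected L\<close>)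
    have unb: "\<not> bounded L"
    proof
      assume "bounded L"
      then obtain B where B: "\<And>w. w \<in> L \<Longrightarrow> norm w \<le> B"
        by (auto simp: bounded_iff)
      \<comment> \<open>Multiplication by \<open>\<i>\<close> turns a basis vector into a unit
        vector along the line, which gives points of the line of large norm.\<close>
      have iv: "v \<bullet> (\<i> * v) = 0" "norm (\<i> * v) = 1"
        using v by (auto simp: inner_complex_def Basis_complex_def norm_mult)
      define w where "w = t *\<^sub>R v + (\<bar>B\<bar> + 1) *\<^sub>R (\<i> * v)"
      have "w \<in> L"
        using vv iv by (simp add: L_def w_def inner_add_right)
      moreover have "(\<i> * v) \<bullet> w = \<bar>B\<bar> + 1"
        using iv by (simp add: w_def inner_add_right inner_commute[of _ v] dot_square_norm)
      then have "\<bar>B\<bar> + 1 \<le> norm w"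
        using norm_cauchy_schwarz[of "\<i> * v" w] iv by simp
      ultimately show False using B[of w] by linarith
    qed
    have "\<not> sw.corr `` L \<subseteq> ball z0 r"
    proof
      assume "sw.corr `` L \<subseteq> ball z0 r"
      then have "bounded (corr `` (sw.corr `` L))"
        by (meson bounded_ball bounded_corr_image bounded_subset)
      moreover have "L \<subseteq> corr `` (sw.corr `` L)"
      proof
        fix w assume w: "w \<in> L"
        obtain x where "(w, x) \<in> sw.corr" by (rule sw.corr_total)
        then show "w \<in> corr `` (sw.corr `` L)" using w by (auto simp: corr_swap)
      qed
      ultimately show False using unb bounded_subset by blast
    qed
    then have "sw.corr `` L \<inter> frontier (ball z0 r) \<noteq> {}"
      using z0 r by (intro connected_Int_frontier[OF conn]) auto
    then obtain x w where "x \<in> frontier (ball z0 r)" "w \<in> L" "(w, x) \<in> sw.corr"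
      by blast
    then have x: "x \<in> sphere z0 r" "w \<in> L" "(x, w) \<in> corr"
      using r by (simp_all add: corr_swap)
    moreover have "x \<noteq> z0" using x(1) r by auto
    ultimately have "w \<bullet> v \<in> N"
      using N(4) by blast
    then show "t \<in> N" using x by (simp add: L_def inner_commute)
  qed
  then have "emeasure lborel {y \<bullet> v..y' \<bullet> v} \<le> emeasure lborel N"
    using N by (intro emeasure_mono) auto
  then have "ennreal (y' \<bullet> v - y \<bullet> v) < ennreal d"
    using N le by (simp add: le_less_trans)
  then show False
    using le N(3) by (simp add: ennreal_less_iff)
qed

text \<open>The image of a circle is measured only by its shadows on the coordinate axes. That is enough:
  a connected set with short shadows is small, and no line can cross it unnoticed.\<close>

definition short_circles :: "complex \<Rightarrow> bool" where
  "short_circles z0 \<longleftrightarrow> (\<forall>e>0. \<forall>r0>0. \<exists>r. 0 < r \<and> r < r0 \<and> (\<forall>v\<in>Basis. \<exists>N\<in>sets lborel.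
     emeasure lborel N < ennreal e \<and>
     (\<lambda>w. w \<bullet> v) ` (corr `` (sphere z0 r - connected_component_set (- U) z0)) \<subseteq> N))"

lemma limit_at_point_component:
  assumes C: "connected_component_set (- U) z0 = {z0}" and sc: "short_circles z0"
  shows "\<exists>y0. (f \<longlongrightarrow> y0) (at z0 within U)"
proof -
  have "y \<bullet> v \<le> y' \<bullet> v" if y: "(z0, y) \<in> corr" "(z0, y') \<in> corr" and v: "v \<in> Basis" for y y' v
  proof (rule field_le_epsilon)
    fix d :: real assume d: "d > 0"
    obtain r N where "0 < r" "N\<in>sets lborel" "emeasure lborel N < ennreal d"
        "(\<lambda>w. w \<bullet> v) ` (corr `` (sphere z0 r - {z0})) \<subseteq> N"
      using sc[unfolded short_circles_def C] d v zero_less_one by meson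
    then show "y \<bullet> v \<le> y' \<bullet> v + d"
      using point_fiber_spread[OF C y(2,1) v, of r N d] d by auto
  qed
  then have "y = y'" if "(z0, y) \<in> corr" "(z0, y') \<in> corr" for y y'
    using that by (meson antisym euclidean_eqI)
  moreover obtain y where "(z0, y) \<in> corr" by (rule corr_total)
  ultimately have "corr `` {z0} = {y}" by blast
  then show ?thesis
    using limit_if_fiber_singleton by blast
qed

text \<open>The hypothesis \<open>arcs\<close> is what a Jordan curve contributes: at every scale it
  can be cut near \<open>z0\<close> so that the rest stays connected.\<close>

lemma limit_at_curve_point:
  assumes z0: "z0 \<in> frontier U" and sc: "short_circles z0"
    and peano: "\<And>P. P \<in> components (frontier V) \<Longrightarrow> peano_continuum P"
    and Q: "Q = connected_component_set (- U) z0 \<inter> frontier U"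
    and arcs: "\<And>r. r > 0 \<Longrightarrow> \<exists>S. compact S \<and> connected S \<and> S \<subseteq> Q \<and> z0 \<notin> S \<and> Q - S \<subseteq> ball z0 r"
  shows "\<exists>y0. (f \<longlongrightarrow> y0) (at z0 within U)"
proof (rule limit_if_small_oscillation)
  interpret sw: exterior_homeo V U h f by (rule swap)
  show "z0 \<in> closure U" using z0 by (simp add: frontier_def)
  have z0U: "z0 \<notin> U" using z0 open_U by (simp add: frontier_def interior_open)
  define C where "C = connected_component_set (- U) z0"
  have C: "compact C" "connected C" "z0 \<in> C" "C \<inter> U = {}"
    using compact_component z0U connected_component_subset[of "- U"] by (auto simp: C_def)
  have cQ: "compact Q"
    unfolding Q using compact_component by (intro compact_Int_closed) auto
  have UQ: "U \<inter> Q = {}" using C by (auto simp: Q C_def)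
  have frC: "frontier C \<subseteq> Q"
    using frontier_component frontier_subset_closed[OF compact_imp_closed[OF C(1)]]
    by (auto simp: C_def Q)
  obtain y1 where y1: "(z0, y1) \<in> corr" by (rule corr_total)
  have y1V: "y1 \<notin> V" using y1 z0U corr_in_iff by blast
  define D where "D = corr `` {z0}"
  have D_eq: "D = connected_component_set (- V) y1"
    using corr_fiber[OF y1 z0U] by (simp add: D_def)
  have D: "compact D" "connected D" "D \<inter> V = {}"
    using sw.compact_component connected_component_subset[of "- V"] by (auto simp: D_eq)
  have DC: "corr `` C = D"
    using corr_component[OF y1 z0U] by (simp add: C_def D_def)
  define P where "P = D \<inter> frontier V"
  have "D \<in> components (- V)"
    using y1V by (auto simp: D_eq components_def)
  then have "peano_continuum P"
    unfolding P_def by (intro peano sw.component_Int_frontier)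
  fix e :: real assume e: "e > 0"
  \<comment> \<open>The cap 1 keeps the disc of radius \<open>\<eta>\<close> about \<open>b\<close>
    away from the base point \<open>q\<close> chosen below, whose norm exceeds that of
    \<open>b\<close> by more than 2.\<close>
  define \<eta> where "\<eta> = min 1 e"
  have eta: "\<eta> > 0" "\<eta> \<le> 1" "\<eta> \<le> e" using e by (auto simp: \<eta>_def)
  obtain d where d: "d > 0" and small:
    "\<And>A. \<lbrakk>A \<subseteq> P; \<And>a b. a \<in> A \<Longrightarrow> b \<in> A \<Longrightarrow> dist a b < d\<rbrakk> \<Longrightarrow>
       \<exists>W. A \<subseteq> W \<and> W \<subseteq> P \<and> compact W \<and> connected W \<and> (\<forall>w\<in>W. \<exists>a\<in>A. dist w a < \<eta> / 2)"
    using peano_continuum_small_connected[OF \<open>peano_continuum P\<close> half_gt_zero[OF eta(1)]] by blast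
  \<comment> \<open>Shadows of measure at most \<open>t\<close> on both axes bound the diameter by
    \<open>2 * t\<close>. This must stay below \<open>d\<close>, to obtain a small subcontinuum, and
    within \<open>\<eta> / 2\<close>, to fit the final disc.\<close>
  define t where "t = min (\<eta> / 4) (d / 4)"
  have t: "t > 0" "2 * t \<le> \<eta> / 2" "2 * t < d" using eta d by (auto simp: t_def)
  obtain r where r: "0 < r" "r < 1" and N: "\<And>v. v \<in> Basis \<Longrightarrow> \<exists>N\<in>sets lborel.
     emeasure lborel N < ennreal t \<and> (\<lambda>w. w \<bullet> v) ` (corr `` (sphere z0 r - C)) \<subseteq> N"
    using sc[unfolded short_circles_def] t(1) zero_less_one unfolding C_def by meson
  obtain B where B: "\<And>y. y \<in> corr `` cball z0 1 \<Longrightarrow> norm y \<le> B"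
    using bounded_corr_image[OF bounded_cball, of z0 1] unfolding bounded_iff by blast
  obtain B' where B': "\<And>y. y \<notin> V \<Longrightarrow> norm y \<le> B'"
    using bounded_compl_V by (auto simp: bounded_iff)
  \<comment> \<open>The points \<open>p\<close> and \<open>q\<close> stand in for infinity:
    \<open>q\<close> is beyond the complement of \<open>V\<close>, hence in \<open>V\<close>, and
    beyond everything that corresponds to the unit disc about \<open>z0\<close>, so that
    \<open>p\<close> is outside that disc.\<close>
  define q where "q = complex_of_real (\<bar>B\<bar> + \<bar>B'\<bar> + 3)"
  have nq: "norm q = \<bar>B\<bar> + \<bar>B'\<bar> + 3"
    unfolding q_def norm_of_real by simp
  then have "\<not> norm q \<le> B'" "norm q > B + 2" by linarith+
  then have q: "norm q > B + 2" "q \<in> V"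
    using B'[of q] by blast+
  define p where "p = h q"
  have p: "p \<in> U" "f p = q" using q by (auto simp: p_def)
  have "p \<notin> cball z0 1"
  proof
    assume "p \<in> cball z0 1"
    moreover have "(p, q) \<in> corr" using p by simp
    ultimately have "q \<in> corr `` cball z0 1" by (rule ImageI[rotated])
    then show False using B q by fastforce
  qed
  then have pr: "p \<notin> cball z0 r" using r by auto
  obtain S where S: "compact S" "connected S" "S \<subseteq> Q" "z0 \<notin> S" "Q - S \<subseteq> ball z0 r"
    using arcs[OF r(1)] by auto
  obtain \<delta> where \<delta>: "\<delta> > 0" "\<delta> \<le> r" and ulc:
    "\<And>z z'. z \<in> U \<inter> ball z0 \<delta> \<Longrightarrow> z' \<in> U \<inter> ball z0 \<delta> \<Longrightarrow> connected_component (ball z0 r - Q) z z'"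
    using Jordan_uniformly_locally_connected[OF connected_U UQ cQ S(3,5,1,2,4) r(1)] by metis
  obtain z where z: "z \<in> U" "z \<in> ball z0 \<delta>"
    using \<delta> \<open>z0 \<in> closure U\<close> by (meson centre_in_ball closure_iff_nhds_not_empty open_ball subset_refl disjoint_iff)
  have zr: "z \<in> ball z0 r" using z \<delta> by auto
  obtain I where I: "I \<in> components (sphere z0 r - C)"
    "\<not> connected_component (- (C \<union> I)) z p"
    using separating_arc[OF open_U connected_U _ C(1,2) z(1) p(1) zr pr] C(4) by blast
  have Isub: "I \<subseteq> sphere z0 r - C" and "connected I" "I \<noteq> {}"
    using I in_components_subset in_components_connected in_components_nonempty by blast+
  \<comment> \<open>One arc serves all nearby points: \<open>z'\<close> is joined to
    \<open>z\<close> inside the open disc, hence off the circle, and off \<open>Q\<close>. A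
    connected set enters \<open>C\<close> only through its frontier, which is part of
    \<open>Q\<close>.\<close>
  have sep: "\<not> connected_component (- (C \<union> I)) z' p" if z': "z' \<in> U" "z' \<in> ball z0 \<delta>" for z'
  proof -
    obtain T where T: "connected T" "T \<subseteq> ball z0 r - Q" "z \<in> T" "z' \<in> T"
      using ulc[of z z'] z z' by (auto simp: connected_component_def)
    have "T \<inter> C = {}"
    proof (rule ccontr)
      assume "T \<inter> C \<noteq> {}"
      then have "T \<inter> frontier C \<noteq> {}"
        using connected_Int_frontier[OF T(1), of C] T(3) z C by blast
      then show False using frC T by blast
    qed
    moreover have "T \<inter> I = {}"
      using T(2) Isub by fastforce
    ultimately have "connected_component (- (C \<union> I)) z z'"
      using T unfolding connected_component_def by blast
    then show ?thesis
      using I(2) connected_component_trans by metis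
  qed
  define M where "M = corr `` I"
  have "connected M"
    unfolding M_def by (intro connected_corr_image \<open>connected I\<close>)
  have MD: "M \<inter> D = {}"
    unfolding M_def D_def using z0U Isub by (intro corr_separated) (auto simp: C_def)
  have Mdist: "dist a b \<le> 2 * t" if "a \<in> M" "b \<in> M" for a b
  proof -
    have *: "\<bar>a \<bullet> v - b \<bullet> v\<bar> \<le> t" if v: "v \<in> Basis" for v
    proof -
      obtain N' where "N' \<in> sets lborel" "emeasure lborel N' < ennreal t"
          "(\<lambda>w. w \<bullet> v) ` (corr `` (sphere z0 r - C)) \<subseteq> N'"
        using N[OF v] by blast
      moreover have "M \<subseteq> corr `` (sphere z0 r - C)"
        using Isub by (auto simp: M_def)
      ultimately have "(\<lambda>w. w \<bullet> v) ` M \<subseteq> N'" "emeasure lborel N' \<le> ennreal t" "N' \<in> sets lborel"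
        by (blast, simp_all)
      then show ?thesis
        using connected_spread_le[OF \<open>connected M\<close>, of N' t v a b] \<open>a \<in> M\<close> \<open>b \<in> M\<close> t by simp
    qed
    have "norm (a - b) \<le> (\<Sum>v\<in>Basis. \<bar>(a - b) \<bullet> v\<bar>)"
      by (rule norm_le_l1)
    also have "\<dots> \<le> (\<Sum>v\<in>(Basis :: complex set). t)"
      using * by (intro sum_mono) (simp add: inner_diff_left)
    finally show ?thesis by (simp add: dist_norm)
  qed
  obtain b where b: "b \<in> M"
    using \<open>I \<noteq> {}\<close> corr_total unfolding M_def by (metis ImageI all_not_in_conv)
  have cl_sub: "closure M \<subseteq> cball b (2 * t)"
    using Mdist b by (intro closure_minimal) (auto)
  have cl_dist: "dist a a' \<le> 2 * t" if a: "a \<in> closure M" "a' \<in> closure M" for a a'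
  proof -
    have "closure M \<subseteq> cball c (2 * t)" if "c \<in> M" for c
      using Mdist that by (intro closure_minimal) auto
    then have "a \<in> cball c (2 * t)" if "c \<in> M" for c
      using a(1) that by blast
    then have "M \<subseteq> cball a (2 * t)"
      by (auto simp: dist_commute)
    then have "closure M \<subseteq> cball a (2 * t)"
      by (intro closure_minimal) auto
    then show ?thesis using a(2) by auto
  qed
  \<comment> \<open>Here the image of the arc lands on \<open>D\<close>. Since \<open>M\<close>
    misses \<open>D\<close>, these points belong to the frontier of \<open>D\<close> and so to the
    Peano continuum \<open>P\<close>.\<close>
  define A where "A = closure M \<inter> D"
  have "A \<subseteq> frontier D"
  proof
    fix a assume a: "a \<in> A"
    have "a \<notin> interior D"
    proof
      assume "a \<in> interior D"
      then have "interior D \<inter> M \<noteq> {}"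
        using a open_Int_closure_eq_empty[OF open_interior, of D M] by (auto simp: A_def)
      then show False using MD interior_subset by blast
    qed
    then show "a \<in> frontier D"
      using a closure_subset by (auto simp: A_def frontier_def)
  qed
  moreover have "frontier D \<subseteq> P"
    using sw.frontier_component frontier_subset_closed[OF compact_imp_closed[OF D(1)]]
    by (auto simp: D_eq P_def)
  ultimately have "A \<subseteq> P" by blast
  obtain W where W: "A \<subseteq> W" "W \<subseteq> P" "compact W" "connected W"
      "\<And>w. w \<in> W \<Longrightarrow> \<exists>a\<in>A. dist w a < \<eta> / 2"
  proof -
    have "dist a a' < d" if "a \<in> A" "a' \<in> A" for a a'
      using cl_dist[of a a'] that t(3) by (auto simp: A_def)
    then show thesis using small[OF \<open>A \<subseteq> P\<close>] that by blast
  qed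
  \<comment> \<open>Adding \<open>W\<close> makes the intersection with \<open>D\<close> exactly the
    continuum \<open>W\<close>; with \<open>closure M\<close> alone it would be \<open>A\<close>,
    possibly disconnected.\<close>
  define E where "E = closure M \<union> W"
  have E_ball: "E \<subseteq> cball b \<eta>"
  proof -
    have "closure M \<subseteq> cball b \<eta>"
      using cl_sub t eta by (auto intro: order_trans)
    moreover have "W \<subseteq> cball b \<eta>"
    proof
      fix w assume "w \<in> W"
      then obtain a where "a \<in> A" "dist w a < \<eta> / 2" using W by blast
      then have "dist b a \<le> 2 * t" using cl_sub by (auto simp: A_def)
      then show "w \<in> cball b \<eta>"
        using \<open>dist w a < \<eta> / 2\<close> t dist_triangle2[of b w a] by simp
    qed
    ultimately show ?thesis by (simp add: E_def)
  qed
  have "f z' \<in> cball b \<eta>" if z': "z' \<in> U" "z' \<in> ball z0 \<delta>" for z'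
  proof (rule ccontr)
    assume out: "f z' \<notin> cball b \<eta>"
    have "b \<in> corr `` cball z0 1"
      using b Isub r by (force simp: M_def)
    then have "norm b \<le> B" by (rule B)
    then have q_out: "f p \<notin> cball b \<eta>"
      using q(1) p(2) eta norm_triangle_ineq2[of q b] by (auto simp: dist_norm norm_minus_commute)
    \<comment> \<open>\<open>V\<close> joins the two points off \<open>D\<close>, and the outside of
      a disc joins them off \<open>E\<close>. A connection off the union pulls back to one from
      \<open>z'\<close> to \<open>p\<close> off \<open>C \<union> I\<close>, against the choice of
      \<open>I\<close>.\<close>
    have "connected_component (- (D \<union> E)) (f z') (f p)"
    proof (rule Janiszewski[OF D(1)])
      show "closed E"
        unfolding E_def using W compact_imp_closed by blast
      have "D \<inter> E = W"
        using W P_def by (auto simp: E_def A_def)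
      then show "connected (D \<inter> E)" using W by simp
      show "connected_component (- D) (f z') (f p)"
        using D(3) connected_V z' p unfolding connected_component_def
        by (intro exI[of _ V]) auto
      have "connected (- cball b \<eta>)"
        by (intro connected_complement_bounded_convex) auto
      then show "connected_component (- E) (f z') (f p)"
        using out q_out E_ball unfolding connected_component_def
        by (intro exI[of _ "- cball b \<eta>"]) auto
    qed
    then obtain L where L: "connected L" "L \<subseteq> - (D \<union> E)" "f z' \<in> L" "f p \<in> L"
      by (auto simp: connected_component_def)
    have "connected (sw.corr `` L)"
      by (intro sw.connected_corr_image L)
    moreover have "sw.corr `` L \<subseteq> - (C \<union> I)"
    proof (rule subsetI, rule ComplI)
      fix x assume "x \<in> sw.corr `` L" "x \<in> C \<union> I"
      then obtain w where w: "w \<in> L" "(x, w) \<in> corr" by (auto simp: corr_swap)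
      then have "w \<in> D \<union> M"
        using \<open>x \<in> C \<union> I\<close> DC by (auto simp: M_def)
      then show False
        using w L closure_subset[of M] by (auto simp: E_def)
    qed
    moreover have "z' \<in> sw.corr `` L" "p \<in> sw.corr `` L"
      using L z' p by (auto simp: corr_swap)
    ultimately have "connected_component (- (C \<union> I)) z' p"
      unfolding connected_component_def by blast
    then show False using sep z' by blast
  qed
  then have "f ` (U \<inter> ball z0 \<delta>) \<subseteq> cball b e"
    using eta by fastforce
  then show "\<exists>d b. d > 0 \<and> f ` (U \<inter> ball z0 d) \<subseteq> cball b e"
    using \<delta> by blast
qed

end

section \<open>Area and length\<close>

lemma borel_measurable_vec2 [measurable]:
  "(\<lambda>p. vector [fst p, snd p] :: real^2) \<in> borel_measurable borel"
proof (intro borel_measurable_continuous_onI)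
  have "(\<lambda>p :: real \<times> real. vector [fst p, snd p] :: real^2) =
      (\<lambda>p. \<chi> i. if i = 1 then fst p else snd p)"
    by (auto simp: vec_eq_iff forall_2)
  moreover have "continuous_on UNIV (\<lambda>p :: real \<times> real. (\<chi> i. if i = 1 then fst p else snd p) :: real^2)"
  proof (intro continuous_on_vec_lambda)
    fix i :: 2 show "continuous_on UNIV (\<lambda>p :: real \<times> real. if i = 1 then fst p else snd p)"
      by (cases "i = 1") (auto intro!: continuous_intros)
  qed
  ultimately show "continuous_on UNIV (\<lambda>p :: real \<times> real. vector [fst p, snd p] :: real^2)"
    by (simp only:)
qed

text \<open>The determinant form of the change of variables lives on \<open>real^2\<close>, iterated
  integrals on pairs; this identifies the two Lebesgue measures.\<close>

lemma lborel_vec2: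
  "distr (lborel :: (real \<times> real) measure) borel (\<lambda>p. vector [fst p, snd p] :: real^2) = lborel"
proof (rule lborel_eqI[symmetric])
  fix l u :: "real^2" assume "\<And>b. b \<in> Basis \<Longrightarrow> l \<bullet> b \<le> u \<bullet> b"
  then have lu: "l $ i \<le> u $ i" for i
    by (metis inner_axis axis_in_Basis_iff real_inner_1_right Basis_real_def singletonI)
  have vim: "(\<lambda>p. vector [fst p, snd p] :: real^2) -` box l u = box (l $ 1, l $ 2) (u $ 1, u $ 2)"
  proof -
    have "box (l $ 1, l $ 2) (u $ 1, u $ 2) = {l $ 1<..<u $ 1} \<times> {l $ 2<..<u $ 2}"
      by (auto simp: box_def Basis_prod_def ball_Un)
    then show ?thesis by (auto simp: mem_box_cart forall_2)
  qed
  have B2: "prod h (Basis :: (real^2) set) = h (axis 1 1) * h (axis 2 1)" for h :: "real^2 \<Rightarrow> real"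
  proof -
    have eq: "(Basis :: (real^2) set) = {axis 1 1, axis 2 1}"
      by (auto simp: Basis_vec_def UNIV_2)
    have "(axis 1 1 :: real^2) \<noteq> axis 2 1"
      by (simp add: axis_eq_axis)
    then show ?thesis unfolding eq by simp
  qed
  have Bp: "prod h (Basis :: (real \<times> real) set) = h (1, 0) * h (0, 1)" for h :: "real \<times> real \<Rightarrow> real"
    by (simp add: Basis_prod_def prod.union_disjoint)
  show "emeasure (distr lborel borel (\<lambda>p. vector [fst p, snd p] :: real^2)) (box l u) =
      ennreal (prod ((\<bullet>) (u - l)) Basis)"
    using lu by (simp add: emeasure_distr vim emeasure_lborel_box_eq Basis_prod_def B2 Bp inner_axis)
qed simp

text \<open>The integral is the area of the bounded open image, as the Jacobian of a holomorphic map
  is the squared modulus of its derivative. It is iterated because single vertical lines are to be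
  selected.\<close>

lemma finite_area_integral:
  fixes g :: "complex \<Rightarrow> complex"
  assumes G: "open G" and holo: "g holomorphic_on G" and inj: "inj_on g G" and bnd: "bounded (g ` G)"
  shows "(\<integral>\<^sup>+s. (\<integral>\<^sup>+t. ennreal ((norm (deriv g (Complex s t)))\<^sup>2) * indicator G (Complex s t) \<partial>lborel)
           \<partial>lborel) < \<infinity>"
    and "(\<lambda>s. \<integral>\<^sup>+t. ennreal ((norm (deriv g (Complex s t)))\<^sup>2) * indicator G (Complex s t) \<partial>lborel)
           \<in> borel_measurable lborel"
proof -
  define \<phi> :: "real^2 \<Rightarrow> complex" where "\<phi> v = Complex (v $ 1) (v $ 2)" for v
  define \<psi> :: "complex \<Rightarrow> real^2" where "\<psi> w = vector [Re w, Im w]" for w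
  have psi_phi: "\<psi> (\<phi> v) = v" for v by (simp add: \<phi>_def \<psi>_def vec_eq_iff forall_2)
  have phi_psi: "\<phi> (\<psi> w) = w" for w by (simp add: \<phi>_def \<psi>_def)
  have "linear \<phi>"
    by (rule linearI) (auto simp: \<phi>_def complex_eq_iff)
  then have blp: "bounded_linear \<phi>" by (rule linear_conv_bounded_linear[THEN iffD1])
  have "linear \<psi>"
    by (rule linearI) (auto simp: \<psi>_def vec_eq_iff forall_2)
  then have bls: "bounded_linear \<psi>" by (rule linear_conv_bounded_linear[THEN iffD1])
  define S where "S = \<phi> -` G"
  define F where "F v = \<psi> (g (\<phi> v))" for v
  define F' where "F' v w = \<psi> (deriv g (\<phi> v) * \<phi> w)" for v w
  have contphi: "continuous_on X \<phi>" for X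
    using blp by (rule bounded_linear.continuous_on) (rule continuous_on_id)
  have oS: "open S"
    unfolding S_def using G contphi by (intro open_vimage) auto
  have der: "(F has_derivative F' v) (at v within S)" if "v \<in> S" for v
  proof -
    have "(g has_derivative (\<lambda>w. deriv g (\<phi> v) * w)) (at (\<phi> v))"
      using holomorphic_derivI[OF holo G, of "\<phi> v"] that
      by (auto simp: S_def has_field_derivative_def)
    moreover have "(\<phi> has_derivative \<phi>) (at v within S)"
      using blp by (rule bounded_linear.has_derivative) (rule has_derivative_ident)
    ultimately have "((\<lambda>v. g (\<phi> v)) has_derivative (\<lambda>w. deriv g (\<phi> v) * \<phi> w)) (at v within S)"
      by (rule has_derivative_compose[rotated])
    then show ?thesis
      unfolding F_def F'_def by (rule bounded_linear.has_derivative[OF bls])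
  qed
  have injF: "inj_on F S"
    using inj unfolding inj_on_def F_def S_def by (metis phi_psi psi_phi vimage_eq)
  have "open (F ` S)"
  proof (rule invariance_of_domain[OF _ oS injF])
    show "continuous_on S F"
      using der has_derivative_continuous_on by blast
  qed
  moreover have "bounded (F ` S)"
  proof -
    have "F ` S \<subseteq> \<psi> ` (g ` G)" by (auto simp: F_def S_def)
    then show ?thesis
      using bounded_linear_image[OF bnd bls] bounded_subset by blast
  qed
  ultimately have "F ` S \<in> lmeasurable"
    by (intro bounded_set_imp_lmeasurable) auto
  moreover have detF: "\<bar>det (matrix (F' v))\<bar> = (norm (deriv g (\<phi> v)))\<^sup>2" for v
    by (simp add: det_2 matrix_def F'_def \<psi>_def \<phi>_def axis_def cmod_power2)
      (simp add: power2_eq_square)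
  ultimately have "(\<lambda>v. (norm (deriv g (\<phi> v)))\<^sup>2) integrable_on S"
    using measurable_differentiable_image_eq[OF _ der injF] oS by simp
  then have "integral\<^sup>N lborel (\<lambda>v. ennreal ((norm (deriv g (\<phi> v)))\<^sup>2) * indicator S v) < \<infinity>"
    using nn_integral_has_integral_lebesgue'[of S "\<lambda>v. (norm (deriv g (\<phi> v)))\<^sup>2"]
    by (auto simp: integrable_on_def)
  moreover have ind_eq: "indicator S v = (indicator G (\<phi> v) :: ennreal)" for v
    by (simp add: S_def indicator_def)
  define k where "k w = ennreal ((norm (deriv g w))\<^sup>2) * indicator G w" for w
  have [measurable]: "k \<in> borel_measurable borel"
  proof -
    have "continuous_on G (\<lambda>w. (norm (deriv g w))\<^sup>2)"
      using holomorphic_deriv[OF holo G] holomorphic_on_imp_continuous_on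
      by (intro continuous_intros) blast
    then have "(\<lambda>w. indicator G w *\<^sub>R (norm (deriv g w))\<^sup>2) \<in> borel_measurable borel"
      using G by (intro borel_measurable_continuous_on_indicator) auto
    then have "(\<lambda>w. ennreal (indicator G w *\<^sub>R (norm (deriv g w))\<^sup>2)) \<in> borel_measurable borel"
      by measurable
    moreover have "k = (\<lambda>w. ennreal (indicator G w *\<^sub>R (norm (deriv g w))\<^sup>2))"
      by (auto simp: k_def indicator_def)
    ultimately show ?thesis by (simp only:)
  qed
  have [measurable]: "\<phi> \<in> borel_measurable borel" using contphi borel_measurable_continuous_onI by blast
  have [measurable]: "(\<lambda>p. Complex (fst p) (snd p)) \<in> borel_measurable borel"
    by (intro borel_measurable_continuous_onI) (auto intro!: continuous_intros)
  ultimately have fin: "(\<integral>\<^sup>+v. k (\<phi> v) \<partial>lborel) < \<infinity>"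
    by (simp add: k_def ind_eq)
  have "(\<integral>\<^sup>+v. k (\<phi> v) \<partial>lborel) =
      (\<integral>\<^sup>+v. k (\<phi> v) \<partial>distr (lborel :: (real \<times> real) measure) borel (\<lambda>p. vector [fst p, snd p]))"
    by (simp only: lborel_vec2)
  also have "\<dots> = (\<integral>\<^sup>+p. k (Complex (fst p) (snd p)) \<partial>(lborel :: (real \<times> real) measure))"
  proof -
    have "\<phi> (vector [fst p, snd p]) = Complex (fst p) (snd p)" for p
      by (simp add: \<phi>_def)
    moreover have "(\<lambda>v. k (\<phi> v)) \<in> borel_measurable borel"
      by measurable
    ultimately show ?thesis
      by (subst nn_integral_distr) simp_all
  qed
  also have "\<dots> = (\<integral>\<^sup>+p. k (Complex (fst p) (snd p)) \<partial>(lborel \<Otimes>\<^sub>M lborel))"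
    by (simp add: lborel_prod)
  also have "\<dots> = (\<integral>\<^sup>+s. \<integral>\<^sup>+t. k (Complex s t) \<partial>lborel \<partial>lborel)"
    by (subst lborel.nn_integral_fst[symmetric]) (auto simp: lborel_prod)
  finally show "(\<integral>\<^sup>+s. (\<integral>\<^sup>+t. ennreal ((norm (deriv g (Complex s t)))\<^sup>2) * indicator G (Complex s t) \<partial>lborel)
           \<partial>lborel) < \<infinity>"
    using fin by (simp add: k_def)
  have "(\<lambda>p. k (Complex (fst p) (snd p))) \<in> borel_measurable (lborel \<Otimes>\<^sub>M lborel)"
    by (simp add: lborel_prod)
  then have "(\<lambda>s. \<integral>\<^sup>+t. k (Complex (fst (s, t)) (snd (s, t))) \<partial>lborel) \<in> borel_measurable lborel"
    by (rule lborel.borel_measurable_nn_integral_fst)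
  then show "(\<lambda>s. \<integral>\<^sup>+t. ennreal ((norm (deriv g (Complex s t)))\<^sup>2) * indicator G (Complex s t) \<partial>lborel)
           \<in> borel_measurable lborel"
    by (simp add: k_def)
qed

lemma interval_hull:
  fixes X :: "real set"
  assumes "\<And>x y. x \<in> X \<Longrightarrow> y \<in> X \<Longrightarrow> x - y \<le> c" "c \<ge> 0"
  obtains N where "N \<in> sets lborel" "X \<subseteq> N" "emeasure lborel N \<le> ennreal c"
proof (cases "X = {}")
  case False
  then obtain x0 where x0: "x0 \<in> X" by blast
  have bd: "bdd_below X" "bdd_above X"
    using assms(1)[OF x0] assms(1)[OF _ x0]
    by (auto intro!: bdd_belowI[of _ "x0 - c"] bdd_aboveI[of _ "x0 + c"] simp: algebra_simps)
  have "Sup X - c \<le> x" if "x \<in> X" for x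
  proof -
    have "Sup X \<le> x + c"
      using assms(1)[OF _ that] False by (intro cSup_least) (auto simp: algebra_simps)
    then show ?thesis by simp
  qed
  then have "X \<subseteq> {Sup X - c..Sup X}"
    using bd cSup_upper by fastforce
  then show thesis
    using assms(2) by (intro that[of "{Sup X - c..Sup X}"]) auto
qed (use that[of "{}"] in auto)

text \<open>\<open>A\<close> may have infinitely many components whose images lie far apart, so the
  image need not have small diameter. But each component has its shadow in an interval no longer
  than its image, and the union of these intervals is charged to the total length.\<close>

lemma path_length_bound:
  fixes \<gamma> :: "real \<Rightarrow> complex"
  assumes A: "open A" and der: "\<And>t. t \<in> A \<Longrightarrow> (\<gamma> has_vector_derivative \<gamma>' t) (at t)"
    and cont: "continuous_on A \<gamma>'" and v: "norm v = 1" and c: "c \<ge> 0"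
    and len: "(\<integral>\<^sup>+t. ennreal (norm (\<gamma>' t)) * indicator A t \<partial>lborel) \<le> ennreal c"
  obtains N where "N \<in> sets lborel" "emeasure lborel N \<le> ennreal c" "(\<lambda>t. \<gamma> t \<bullet> v) ` A \<subseteq> N"
proof -
  define k where "k t = ennreal (norm (\<gamma>' t)) * indicator A t" for t
  have k [measurable]: "k \<in> borel_measurable borel"
  proof -
    have "(\<lambda>w. indicator A w *\<^sub>R norm (\<gamma>' w)) \<in> borel_measurable borel"
      using A cont by (intro borel_measurable_continuous_on_indicator continuous_intros) auto
    then have "(\<lambda>w. ennreal (indicator A w *\<^sub>R norm (\<gamma>' w))) \<in> borel_measurable borel"
      by measurable
    moreover have "k = (\<lambda>w. ennreal (indicator A w *\<^sub>R norm (\<gamma>' w)))"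
      by (auto simp: k_def indicator_def)
    ultimately show ?thesis by (simp only:)
  qed
  \<comment> \<open>Length as a measure on the parameter line, so that countable additivity sums
    over the components.\<close>
  define \<mu> where "\<mu> = density lborel k"
  have mu: "emeasure \<mu> X = (\<integral>\<^sup>+t. k t * indicator X t \<partial>lborel)" if "X \<in> sets lborel" for X
    unfolding \<mu>_def using that by (intro emeasure_density) auto
  have "countable (components A)"
  proof -
    have "X \<noteq> {} \<and> open X" if "X \<in> components A" for X
      using that A open_components in_components_nonempty by blast
    moreover have "disjoint (components A)"
      using pairwise_disjoint_components by (simp add: pairwise_def disjnt_def disjoint_def)
    ultimately show ?thesis
      by (intro countable_disjoint_open_subsets) auto
  qed
  then obtain e :: "real set \<Rightarrow> nat" where e: "inj_on e (components A)"
    by (auto simp: countable_def)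
  \<comment> \<open>An enumeration of the components by all natural numbers, padded with empty
    sets.\<close>
  define J where "J n = (if n \<in> e ` components A then inv_into (components A) e n else {})" for n
  have J: "J n \<in> components A \<or> J n = {}" for n
    by (auto simp: J_def inv_into_into)
  have disjJ: "disjoint_family J"
    unfolding disjoint_family_on_def
  proof (intro ballI impI)
    fix m n :: nat assume "m \<noteq> n"
    show "J m \<inter> J n = {}"
    proof (cases "m \<in> e ` components A \<and> n \<in> e ` components A")
      case True
      then have "J m \<in> components A" "J n \<in> components A" "J m \<noteq> J n"
        using \<open>m \<noteq> n\<close> inv_into_injective[of "components A" e m n] by (auto simp: J_def inv_into_into)
      then show ?thesis using components_nonoverlap by blast
    qed (auto simp: J_def)
  qed
  have UJ: "(\<Union>n. J n) = A"
  proof -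
    have "X \<in> range J" if "X \<in> components A" for X
      using that e by (auto simp: J_def intro!: image_eqI[of _ _ "e X"])
    then have "\<Union>(components A) \<subseteq> (\<Union>n. J n)" by blast
    moreover have "(\<Union>n. J n) \<subseteq> A" using J in_components_subset by blast
    ultimately show ?thesis using Union_components[of A] by simp
  qed
  have oJ: "open (J n)" for n
    using J[of n] A open_components by auto
  have tot: "(\<Sum>n. emeasure \<mu> (J n)) \<le> ennreal c"
  proof -
    have "(\<Sum>n. emeasure \<mu> (J n)) = emeasure \<mu> (\<Union>n. J n)"
      using oJ disjJ by (intro suminf_emeasure) (auto simp: \<mu>_def)
    also have "\<dots> = (\<integral>\<^sup>+t. k t * indicator A t \<partial>lborel)"
      using A by (simp add: UJ mu)
    also have "\<dots> = (\<integral>\<^sup>+t. k t \<partial>lborel)"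
      by (intro nn_integral_cong) (auto simp: k_def indicator_def)
    finally show ?thesis using len by (simp add: k_def)
  qed
  have fin: "emeasure \<mu> (J n) < \<infinity>" for n
  proof -
    have "emeasure \<mu> (J n) \<le> (\<Sum>n. emeasure \<mu> (J n))"
      using sum_le_suminf[of "\<lambda>n. emeasure \<mu> (J n)" "{n}"] by simp
    also have "\<dots> \<le> ennreal c" by (rule tot)
    also have "\<dots> < \<infinity>" by simp
    finally show ?thesis .
  qed
  have inc: "\<bar>\<gamma> b \<bullet> v - \<gamma> a \<bullet> v\<bar> \<le> enn2real (emeasure \<mu> (J n))" if ab: "a \<in> J n" "b \<in> J n" "a \<le> b" for a b n
  proof -
    have sub: "{a..b} \<subseteq> J n"
      using ab J[of n] in_components_connected connected_contains_Icc by (metis empty_iff)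
    then have subA: "{a..b} \<subseteq> A" using UJ by blast
    have ft: "(\<gamma>' has_integral \<gamma> b - \<gamma> a) {a..b}"
    proof (rule fundamental_theorem_of_calculus[OF ab(3)])
      fix x assume "x \<in> {a..b}"
      then show "(\<gamma> has_vector_derivative \<gamma>' x) (at x within {a..b})"
        using subA by (intro has_vector_derivative_at_within[OF der]) auto
    qed
    have ci: "continuous_on {a..b} \<gamma>'" using subA cont continuous_on_subset by blast
    then have ni: "(\<lambda>t. norm (\<gamma>' t)) integrable_on {a..b}"
      by (intro integrable_continuous_interval continuous_intros)
    have "norm (\<gamma> b - \<gamma> a) \<le> integral {a..b} (\<lambda>t. norm (\<gamma>' t))"
      using integral_norm_bound_integral[OF has_integral_integrable[OF ft] ni] integral_unique[OF ft]
      by simp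
    moreover have "ennreal (integral {a..b} (\<lambda>t. norm (\<gamma>' t))) \<le> emeasure \<mu> (J n)"
    proof -
      have "ennreal (integral {a..b} (\<lambda>t. norm (\<gamma>' t))) =
          (\<integral>\<^sup>+t. ennreal (norm (\<gamma>' t)) * indicator {a..b} t \<partial>lborel)"
        using nn_integral_has_integral_lebesgue'[OF _ integrable_integral[OF ni]] by simp
      also have "\<dots> \<le> (\<integral>\<^sup>+t. k t * indicator (J n) t \<partial>lborel)"
        using sub subA by (intro nn_integral_mono) (auto simp: k_def indicator_def)
      finally show ?thesis using oJ by (simp add: mu)
    qed
    ultimately have "ennreal (norm (\<gamma> b - \<gamma> a)) \<le> emeasure \<mu> (J n)"
      by (meson ennreal_leI order_trans)
    then have "norm (\<gamma> b - \<gamma> a) \<le> enn2real (emeasure \<mu> (J n))"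
      using fin[of n] by (cases "emeasure \<mu> (J n)") auto
    moreover have "\<bar>(\<gamma> b - \<gamma> a) \<bullet> v\<bar> \<le> norm (\<gamma> b - \<gamma> a)"
      using Cauchy_Schwarz_ineq2[of "\<gamma> b - \<gamma> a" v] v by simp
    ultimately show ?thesis by (simp add: inner_diff_left)
  qed
  have "\<exists>N. N \<in> sets lborel \<and> (\<lambda>t. \<gamma> t \<bullet> v) ` J n \<subseteq> N \<and> emeasure lborel N \<le> emeasure \<mu> (J n)" for n
  proof -
    have "x - y \<le> enn2real (emeasure \<mu> (J n))"
      if "x \<in> (\<lambda>t. \<gamma> t \<bullet> v) ` J n" "y \<in> (\<lambda>t. \<gamma> t \<bullet> v) ` J n" for x y
    proof -
      obtain a b where ab: "a \<in> J n" "b \<in> J n" "x = \<gamma> a \<bullet> v" "y = \<gamma> b \<bullet> v"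
        using \<open>x \<in> _\<close> \<open>y \<in> _\<close> by auto
      then show ?thesis
        using inc[of a n b] inc[of b n a] by (cases "a \<le> b") auto
    qed
    then obtain N where "N \<in> sets lborel" "(\<lambda>t. \<gamma> t \<bullet> v) ` J n \<subseteq> N"
        "emeasure lborel N \<le> ennreal (enn2real (emeasure \<mu> (J n)))"
      using interval_hull[of "(\<lambda>t. \<gamma> t \<bullet> v) ` J n"] by (metis enn2real_nonneg)
    then show ?thesis
      using fin[of n] by auto
  qed
  then obtain N where N: "\<And>n. N n \<in> sets lborel" "\<And>n. (\<lambda>t. \<gamma> t \<bullet> v) ` J n \<subseteq> N n"
      "\<And>n. emeasure lborel (N n) \<le> emeasure \<mu> (J n)"
    by metis
  show thesis
  proof
    show "(\<Union>n. N n) \<in> sets lborel" using N(1) by auto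
    have "emeasure lborel (\<Union>n. N n) \<le> (\<Sum>n. emeasure lborel (N n))"
      using N(1) by (intro emeasure_subadditive_countably) auto
    also have "\<dots> \<le> (\<Sum>n. emeasure \<mu> (J n))"
      using N(3) by (intro suminf_le) auto
    finally show "emeasure lborel (\<Union>n. N n) \<le> ennreal c" using tot by simp
    show "(\<lambda>t. \<gamma> t \<bullet> v) ` A \<subseteq> (\<Union>n. N n)"
      using N(2) UJ by blast
  qed
qed

section \<open>Short circles\<close>

lemma AE_not_in_negligible:
  fixes Z :: "'a::euclidean_space set"
  assumes "negligible Z" shows "AE x in lborel. x \<notin> Z"
proof -
  have "Z \<in> null_sets lebesgue"
    using assms negligible_iff_null_sets by blast
  then have "AE x in lebesgue. x \<notin> Z"
    by (rule AE_not_in)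
  then show ?thesis
    by (simp only: AE_completion_iff)
qed

text \<open>A half line has infinite measure: if \<open>J\<close> were at least
  \<open>\<tau>\<close> almost everywhere below \<open>m\<close>, an interval of length
  \<open>k\<close> would contribute \<open>k * \<tau>\<close>, more than the integral for large
  \<open>k\<close>.\<close>

lemma nonnull_sublevel:
  fixes J :: "real \<Rightarrow> ennreal"
  assumes J: "(\<integral>\<^sup>+s. J s \<partial>lborel) < \<infinity>" and \<tau>: "\<tau> > 0" and Z: "negligible Z"
  obtains s where "s < m" "s \<notin> Z" "J s < ennreal \<tau>"
proof (rule ccontr)
  assume n: "\<not> thesis"
  note ob = that
  have big: "ennreal \<tau> \<le> J s" if "s < m" "s \<notin> Z" for s
    using n ob[OF that] not_less by blast
  obtain C where C: "(\<integral>\<^sup>+s. J s \<partial>lborel) = ennreal C" "C \<ge> 0"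
    using J by (cases "\<integral>\<^sup>+s. J s \<partial>lborel") auto
  obtain k :: nat where k: "C < real k * \<tau>"
    using reals_Archimedean3[OF \<tau>] by blast
  have "ennreal (\<tau> * k) = (\<integral>\<^sup>+s. ennreal \<tau> * indicator {m - k..<m} s \<partial>lborel)"
    using \<tau> by (simp add: nn_integral_cmult_indicator ennreal_mult)
  also have "\<dots> \<le> (\<integral>\<^sup>+s. J s \<partial>lborel)"
  proof (rule nn_integral_mono_AE)
    show "AE s in lborel. ennreal \<tau> * indicator {m - k..<m} s \<le> J s"
      using AE_not_in_negligible[OF Z] by eventually_elim (auto simp: indicator_def big)
  qed
  finally have "\<tau> * k \<le> C"
    using C \<tau> by (simp add: ennreal_le_iff)
  then show False using k by (simp add: mult.commute)
qed

text \<open>Length--area: in logarithmic coordinates about \<open>z0\<close> the circles are vertical segments of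
  length \<open>2 pi\<close>, and there is room for infinitely many of them, so a finite image area forces some
  of them to have short images.\<close>

lemma short_circle_arcs:
  fixes f :: "complex \<Rightarrow> complex"
  assumes U: "open U" and holo: "f holomorphic_on U" and inj: "inj_on f U"
    and bnd: "bounded (f ` (U \<inter> ball z0 1))" and Z: "negligible Z" and e: "e > 0"
  obtains s where "s < s1" "s \<notin> Z"
    "\<And>v. v \<in> Basis \<Longrightarrow> \<exists>N\<in>sets lborel. emeasure lborel N \<le> ennreal e \<and>
       (\<lambda>w. w \<bullet> v) ` (f ` (U \<inter> sphere z0 (exp s))) \<subseteq> N"
proof -
  define E where "E w = z0 + exp w" for w
  \<comment> \<open>The open strip makes the exponential injective, at the price of the point at
    angle 0 on each circle. Negative real part keeps the image in the unit disc about
    \<open>z0\<close>, where \<open>f\<close> is bounded.\<close>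
  define G where "G = {w. Re w < 0} \<inter> {w. 0 < Im w} \<inter> {w. Im w < 2 * pi} \<inter> E -` U"
  define g where "g = f \<circ> E"
  have G: "open G"
    unfolding G_def E_def
    by (intro open_Int open_vimage U continuous_intros open_halfspace_Re_lt open_halfspace_Im_gt
        open_halfspace_Im_lt)
  have EG: "E ` G \<subseteq> U" by (auto simp: G_def)
  have holg: "g holomorphic_on G"
  proof -
    have "E holomorphic_on G" unfolding E_def by (intro holomorphic_intros)
    then show ?thesis unfolding g_def using holo EG by (rule holomorphic_on_compose_gen)
  qed
  have injg: "inj_on g G"
  proof (rule inj_onI)
    fix w w' assume w: "w \<in> G" "w' \<in> G" "g w = g w'"
    then have "E w = E w'"
      using inj EG unfolding inj_on_def g_def comp_def by blast
    then have "exp w = exp w'" by (simp add: E_def)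
    then obtain n :: int where n: "w = w' + (of_int (2 * n) * pi) * \<i>"
      using exp_eq by blast
    then have im: "Im w = Im w' + 2 * n * pi" by simp
    have "Im w > 0" "Im w < 2 * pi" "Im w' > 0" "Im w' < 2 * pi"
      using w by (auto simp: G_def)
    then have "of_int n * pi < 1 * pi" "(- 1) * pi < of_int n * pi" using im by linarith+
    then have "of_int n < (1 :: real)" "- 1 < (of_int n :: real)"
      using mult_less_cancel_right_pos[OF pi_gt_zero] by blast+
    then have "n = 0" by linarith
    then show "w = w'" using n by simp
  qed
  have "g ` G \<subseteq> f ` (U \<inter> ball z0 1)"
    by (auto simp: g_def G_def E_def dist_norm)
  then have bg: "bounded (g ` G)"
    using bnd bounded_subset by blast
  define J where "J s = (\<integral>\<^sup>+t. ennreal ((norm (deriv g (Complex s t)))\<^sup>2) * indicator G (Complex s t) \<partial>lborel)" for s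
  \<comment> \<open>\<open>\<eta>\<close> and the bound \<open>e * \<eta>\<close> on the area slice
    are tuned to the estimate below: as \<open>pi < 4\<close>, the term
    \<open>2 * pi * \<eta>\<close> is at most \<open>e / 2\<close>, and the other one is
    \<open>e / 4\<close>.\<close>
  define \<eta> where "\<eta> = e / 16"
  have eta: "\<eta> > 0" using e by (simp add: \<eta>_def)
  have "(\<integral>\<^sup>+s. J s \<partial>lborel) < \<infinity>"
    unfolding J_def by (rule finite_area_integral[OF G holg injg bg])
  then obtain s where s: "s < min s1 0" "s \<notin> Z" "J s < ennreal (e * \<eta>)"
    using nonnull_sublevel[of J "e * \<eta>" Z "min s1 0"] Z e eta by auto
  define A where "A = {t. Complex s t \<in> G}"
  have cC: "continuous_on X (Complex s)" for X
    unfolding Complex_eq[abs_def] by (intro continuous_intros)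
  have A: "open A"
    unfolding A_def using open_vimage[OF G cC] by (simp add: vimage_def)
  define \<gamma> where "\<gamma> t = g (Complex s t)" for t
  define \<gamma>' where "\<gamma>' t = \<i> * deriv g (Complex s t)" for t
  have der: "(\<gamma> has_vector_derivative \<gamma>' t) (at t)" if "t \<in> A" for t
  proof -
    have "(Complex s has_vector_derivative \<i>) (at t)"
      unfolding Complex_eq[abs_def] by (auto intro!: derivative_eq_intros)
    moreover have "(g has_field_derivative deriv g (Complex s t)) (at (Complex s t))"
      using holomorphic_derivI[OF holg G] that by (auto simp: A_def)
    ultimately have "(g \<circ> Complex s has_vector_derivative \<i> * deriv g (Complex s t)) (at t)"
      by (rule field_vector_diff_chain_at)
    then show ?thesis by (simp add: \<gamma>_def[abs_def] \<gamma>'_def comp_def)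
  qed
  have contd: "continuous_on A (\<lambda>t. deriv g (Complex s t))"
    by (rule continuous_on_compose2[OF holomorphic_on_imp_continuous_on[OF holomorphic_deriv[OF holg G]] cC])
      (auto simp: A_def)
  have meas: "(\<lambda>t. ennreal ((norm (deriv g (Complex s t)))\<^sup>2) * indicator G (Complex s t)) \<in> borel_measurable lborel"
  proof -
    have "(\<lambda>w. indicator A w *\<^sub>R (norm (deriv g (Complex s w)))\<^sup>2) \<in> borel_measurable borel"
      using A contd by (intro borel_measurable_continuous_on_indicator continuous_intros) auto
    then have "(\<lambda>w. ennreal (indicator A w *\<^sub>R (norm (deriv g (Complex s w)))\<^sup>2)) \<in> borel_measurable lborel"
      by measurable
    moreover have "(\<lambda>t. ennreal ((norm (deriv g (Complex s t)))\<^sup>2) * indicator G (Complex s t)) =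
        (\<lambda>w. ennreal (indicator A w *\<^sub>R (norm (deriv g (Complex s w)))\<^sup>2))"
      by (auto simp: A_def indicator_def)
    ultimately show ?thesis by (simp only:)
  qed
  have len: "(\<integral>\<^sup>+t. ennreal (norm (\<gamma>' t)) * indicator A t \<partial>lborel) \<le> ennreal e"
  proof -
    \<comment> \<open>The inequality of arithmetic and geometric means, used pointwise, takes the
      place of the Cauchy-Schwarz inequality for integrals.\<close>
    have pw: "ennreal (norm (\<gamma>' t)) * indicator A t \<le> ennreal \<eta> * indicator {0..2 * pi} t +
        ennreal (1 / (4 * \<eta>)) * (ennreal ((norm (deriv g (Complex s t)))\<^sup>2) * indicator G (Complex s t))" for t
    proof (cases "t \<in> A")
      case True
      define x where "x = norm (deriv g (Complex s t))"
      have "0 \<le> (x - 2 * \<eta>)\<^sup>2" by simp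
      then have "4 * \<eta> * x \<le> x\<^sup>2 + 4 * \<eta>\<^sup>2"
        by (simp add: power2_eq_square algebra_simps)
      then have "x \<le> \<eta> + 1 / (4 * \<eta>) * x\<^sup>2"
        using eta by (simp add: field_simps power2_eq_square)
      then have "ennreal x \<le> ennreal (\<eta> + 1 / (4 * \<eta>) * x\<^sup>2)"
        by (rule ennreal_leI)
      also have "\<dots> = ennreal \<eta> + ennreal (1 / (4 * \<eta>)) * ennreal (x\<^sup>2)"
        using eta by (simp add: ennreal_plus ennreal_mult[symmetric] del: ennreal_plus[symmetric])
      finally show ?thesis
        using True by (auto simp: A_def G_def \<gamma>'_def norm_mult x_def)
    qed simp
    have "(\<integral>\<^sup>+t. ennreal (norm (\<gamma>' t)) * indicator A t \<partial>lborel) \<le>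
        (\<integral>\<^sup>+t. ennreal \<eta> * indicator {0..2 * pi} t +
        ennreal (1 / (4 * \<eta>)) * (ennreal ((norm (deriv g (Complex s t)))\<^sup>2) * indicator G (Complex s t)) \<partial>lborel)"
      by (intro nn_integral_mono pw)
    also have "\<dots> = ennreal \<eta> * ennreal (2 * pi) + ennreal (1 / (4 * \<eta>)) * J s"
      using meas by (subst nn_integral_add) (auto simp: nn_integral_cmult J_def)
    also have "\<dots> \<le> ennreal \<eta> * ennreal (2 * pi) + ennreal (1 / (4 * \<eta>)) * ennreal (e * \<eta>)"
      using s(3) by (intro add_left_mono mult_left_mono) auto
    also have "\<dots> = ennreal (\<eta> * (2 * pi) + 1 / (4 * \<eta>) * (e * \<eta>))"
      using eta e by (simp add: ennreal_mult[symmetric] del: ennreal_plus add: ennreal_plus[symmetric])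
    also have "\<dots> \<le> ennreal e"
    proof (rule ennreal_leI)
      have "\<eta> * (2 * pi) \<le> e / 2"
        using e pi_less_4 by (simp add: \<eta>_def field_simps)
      moreover have "1 / (4 * \<eta>) * (e * \<eta>) = e / 4" using eta by simp
      ultimately show "\<eta> * (2 * pi) + 1 / (4 * \<eta>) * (e * \<eta>) \<le> e" using e by simp
    qed
    finally show ?thesis .
  qed
  show thesis
  proof (rule that[of s])
    show "s < s1" "s \<notin> Z" using s by auto
    fix v :: complex assume v: "v \<in> Basis"
    have "continuous_on A \<gamma>'"
      unfolding \<gamma>'_def[abs_def] using contd by (intro continuous_intros)
    moreover have "norm v = 1" using v by simp
    ultimately obtain N where N: "N \<in> sets lborel" "emeasure lborel N \<le> ennreal e"
        "(\<lambda>t. \<gamma> t \<bullet> v) ` A \<subseteq> N"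
      using path_length_bound[OF A der _ _ less_imp_le[OF e] len] by blast
    \<comment> \<open>The value at angle 0, missing from the strip; one more point does not change
      the measure.\<close>
    define a where "a = f (z0 + exp s) \<bullet> v"
    have "(\<lambda>w. w \<bullet> v) ` (f ` (U \<inter> sphere z0 (exp s))) \<subseteq> N \<union> {a}"
    proof clarify
      fix x assume x: "x \<in> U" "x \<in> sphere z0 (exp s)" "f x \<bullet> v \<notin> N"
      define t where "t = Arg2pi (x - z0)"
      have nx: "norm (x - z0) = exp s" using x by (simp add: dist_norm norm_minus_commute)
      have t: "0 \<le> t" "t < 2 * pi" "x - z0 = exp s * exp (\<i> * t)"
        using Arg2pi[of "x - z0"] nx by (simp_all add: t_def is_Arg_def)
      have xE: "x = E (Complex s t)"
        using t(3) by (simp add: E_def Complex_eq exp_add algebra_simps exp_of_real)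
      have "t = 0"
      proof (rule ccontr)
        assume "t \<noteq> 0"
        then have "t \<in> A"
          using t s x xE by (auto simp: A_def G_def)
        then have "\<gamma> t \<bullet> v \<in> N" using N by auto
        then show False using x xE by (simp add: \<gamma>_def g_def)
      qed
      then show "f x \<bullet> v = a"
        using t(3) by (simp add: a_def algebra_simps exp_of_real)
    qed
    moreover have "emeasure lborel (N \<union> {a}) = emeasure lborel N"
      using N by (intro emeasure_Un_null_set) auto
    ultimately show "\<exists>N\<in>sets lborel. emeasure lborel N \<le> ennreal e \<and>
       (\<lambda>w. w \<bullet> v) ` (f ` (U \<inter> sphere z0 (exp s))) \<subseteq> N"
      using N by (intro bexI[of _ "N \<union> {a}"]) auto
  qed
qed

lemma (in exterior_homeo) corr_fiber_in_components:
  assumes "x \<notin> U" shows "corr `` {x} \<in> components (- V)"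
proof -
  obtain y where y: "(x, y) \<in> corr" by (rule corr_total)
  then have "y \<notin> V" using assms corr_in_iff by blast
  then show ?thesis using corr_fiber[OF y assms] by (auto simp: components_def)
qed

text \<open>Off the component of \<open>z0\<close> the circle has three kinds of image points:
  values of \<open>f\<close>, with short shadows by the length-area estimate (\<open>N1\<close>);
  points of nondegenerate components, of small total diameter once the first \<open>n0\<close> are
  avoided (\<open>N2\<close>); and one-point fibres, countably many (\<open>N3\<close>).\<close>

lemma (in exterior_homeo) short_circlesI:
  fixes D :: "nat \<Rightarrow> complex set" and d :: "nat \<Rightarrow> real"
  assumes holo: "f holomorphic_on U"
    and d: "summable d" "\<And>n. d n \<ge> 0" "\<And>n a b. a \<in> D n \<Longrightarrow> b \<in> D n \<Longrightarrow> dist a b \<le> d n"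
    and D: "\<And>C. C \<in> components (- V) \<Longrightarrow> (\<exists>y. C = {y}) \<or> C \<in> range D"
    and cnt: "countable {C \<in> components (- U). \<nexists>x. C = {x}}"
    and Z: "negligible Z" "\<And>s. s \<notin> Z \<Longrightarrow> countable {x \<in> sphere z0 (exp s). {x} \<in> components (- U)}"
    and z0: "z0 \<notin> U"
  shows "short_circles z0"
  unfolding short_circles_def
proof (intro allI impI)
  interpret sw: exterior_homeo V U h f by (rule swap)
  define C0 where "C0 = connected_component_set (- U) z0"
  fix e r0 :: real assume e: "e > 0" and r0: "r0 > 0"
  obtain n0 where n0: "norm (\<Sum>i. d (i + n0)) < e / 4"
    using suminf_exist_split[OF _ d(1), of "e / 4"] e by auto
  \<comment> \<open>The large components to be avoided. Small circles may fail to avoid the one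
    belonging to \<open>z0\<close>; its preimage is removed from the circle instead.\<close>
  define I where "I = {n. n < n0 \<and> D n \<in> components (- V) \<and> z0 \<notin> sw.corr `` D n}"
  define B where "B = (\<Union>n\<in>I. sw.corr `` D n)"
  have "closed B"
    unfolding B_def
  proof (intro closed_UN ballI)
    show "finite I" by (auto simp: I_def)
    fix n assume "n \<in> I"
    then have "compact (D n)"
      using compact_components[OF sw.compact_compl_U] by (auto simp: I_def)
    then show "closed (sw.corr `` D n)"
      by (intro sw.closed_corr_image compact_imp_closed)
  qed
  moreover have "z0 \<notin> B" by (auto simp: B_def I_def)
  ultimately obtain r1 where r1: "r1 > 0" "ball z0 r1 \<inter> B = {}"
    by (metis ComplI disjoint_eq_subset_Compl openE open_Compl)
  have injf: "inj_on f U" by (metis hf inj_onI)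
  obtain s where s: "s < ln (min r0 r1)" "s \<notin> Z" and arcs:
    "\<And>v. v \<in> Basis \<Longrightarrow> \<exists>N\<in>sets lborel. emeasure lborel N \<le> ennreal (e / 4) \<and>
       (\<lambda>w. w \<bullet> v) ` (f ` (U \<inter> sphere z0 (exp s))) \<subseteq> N"
    using short_circle_arcs[OF open_U holo injf bounded_image[OF bounded_ball] Z(1), of "e / 4"] e
    by (metis divide_pos_pos zero_less_numeral)
  define r where "r = exp s"
  have "r < exp (ln (min r0 r1))" unfolding r_def using s by simp
  then have r: "0 < r" "r < r0" "r < r1"
    using r0 r1 by (auto simp: r_def)
  define X where "X = {x \<in> sphere z0 r. {x} \<in> components (- U)}"
  define \<K> where "\<K> = {C \<in> components (- U). \<nexists>x. C = {x}}"
  \<comment> \<open>One-point fibres come from point components on the circle, countable by the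
    choice of \<open>s\<close> outside \<open>Z\<close>, or from nondegenerate components that
    collapse, countable altogether.\<close>
  define Y where "Y = (\<Union>x\<in>X. {y. corr `` {x} = {y}}) \<union> (\<Union>C\<in>\<K>. {y. corr `` C = {y}})"
  have one: "countable {y. S = {y}}" for S :: "complex set"
    by (rule countable_finite, rule finite_subset[of _ "{THE y. S = {y}}"]) auto
  have "countable Y"
    unfolding Y_def using Z(2)[OF s(2)] cnt one
    by (intro countable_Un countable_UN) (auto simp: X_def \<K>_def r_def)
  have main: "\<exists>N\<in>sets lborel. emeasure lborel N < ennreal e \<and>
      (\<lambda>w. w \<bullet> v) ` (corr `` (sphere z0 r - C0)) \<subseteq> N" if v: "v \<in> Basis" for v
  proof -
    obtain N1 where N1: "N1 \<in> sets lborel" "emeasure lborel N1 \<le> ennreal (e / 4)"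
       "(\<lambda>w. w \<bullet> v) ` (f ` (U \<inter> sphere z0 r)) \<subseteq> N1"
      using arcs[OF v] by (auto simp: r_def)
    have "\<exists>N. N \<in> sets lborel \<and> (\<lambda>w. w \<bullet> v) ` D n \<subseteq> N \<and> emeasure lborel N \<le> ennreal (d n)" for n
    proof -
      have "x - y \<le> d n" if xy: "x \<in> (\<lambda>w. w \<bullet> v) ` D n" "y \<in> (\<lambda>w. w \<bullet> v) ` D n" for x y
      proof -
        obtain a b where ab: "a \<in> D n" "b \<in> D n" "x = a \<bullet> v" "y = b \<bullet> v" using xy by auto
        have "(a - b) \<bullet> v \<le> norm (a - b)"
          using norm_cauchy_schwarz[of "a - b" v] v by simp
        also have "\<dots> \<le> d n" using d(3)[OF ab(1,2)] by (simp add: dist_norm)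
        finally show ?thesis using ab by (simp add: inner_diff_left)
      qed
      then show ?thesis using interval_hull[of "(\<lambda>w. w \<bullet> v) ` D n" "d n"] d(2) by metis
    qed
    then obtain H where H: "\<And>n. H n \<in> sets lborel" "\<And>n. (\<lambda>w. w \<bullet> v) ` D n \<subseteq> H n"
        "\<And>n. emeasure lborel (H n) \<le> ennreal (d n)"
      by metis
    define N2 where "N2 = (\<Union>n. H (n + n0))"
    have N2: "N2 \<in> sets lborel" using H(1) by (auto simp: N2_def)
    have "emeasure lborel N2 \<le> (\<Sum>n. emeasure lborel (H (n + n0)))"
      unfolding N2_def using H(1) by (intro emeasure_subadditive_countably) auto
    also have "\<dots> \<le> (\<Sum>n. ennreal (d (n + n0)))"
      using H(3) by (intro suminf_le) auto
    also have "\<dots> = ennreal (\<Sum>n. d (n + n0))"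
      using d by (intro suminf_ennreal2) (auto simp: summable_iff_shift)
    also have "\<dots> \<le> ennreal (e / 4)"
      using n0 by (intro ennreal_leI) auto
    finally have mN2: "emeasure lborel N2 \<le> ennreal (e / 4)" .
    define N3 where "N3 = (\<lambda>w. w \<bullet> v) ` Y"
    have N3: "N3 \<in> null_sets lborel"
      unfolding N3_def using \<open>countable Y\<close> by (intro countable_imp_null_set_lborel) auto
    have "emeasure lborel (N1 \<union> N2 \<union> N3) = emeasure lborel (N1 \<union> N2)"
      using N1 N2 N3 by (intro emeasure_Un_null_set) auto
    also have "\<dots> \<le> emeasure lborel N1 + emeasure lborel N2"
      using N1 N2 by (intro emeasure_subadditive) auto
    also have "\<dots> \<le> ennreal (e / 4) + ennreal (e / 4)"
      using N1 mN2 by (intro add_mono)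
    also have "\<dots> = ennreal (e / 2)"
      using e by (simp add: ennreal_plus[symmetric] del: ennreal_plus)
    also have "\<dots> < ennreal e" using e by (intro ennreal_lessI) auto
    finally have "emeasure lborel (N1 \<union> N2 \<union> N3) < ennreal e" .
    moreover have "w \<bullet> v \<in> N1 \<union> N2 \<union> N3" if xw: "x \<in> sphere z0 r" "x \<notin> C0" "(x, w) \<in> corr" for x w
    proof (cases "x \<in> U")
      case True
      then have "x \<in> U \<inter> sphere z0 r" "w = f x" using xw by auto
      then show ?thesis using N1(3) by blast
    next
      case False
      have comp: "corr `` {x} \<in> components (- V)"
        by (rule corr_fiber_in_components[OF False])
      have w: "w \<in> corr `` {x}" using xw by simp
      show ?thesis
      proof (cases "\<exists>y. corr `` {x} = {y}")
        case True
        then have fw: "corr `` {x} = {w}" using w by (metis singletonD)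
        define Cx where "Cx = connected_component_set (- U) x"
        have Cx: "Cx \<in> components (- U)" "x \<in> Cx"
          using False by (auto simp: Cx_def components_def)
        have "w \<in> Y"
        proof (cases "\<exists>u. Cx = {u}")
          case True
          then have "Cx = {x}" using Cx by auto
          then have "x \<in> X" using Cx xw by (simp add: X_def)
          then show ?thesis using fw by (auto simp: Y_def)
        next
          case nonsing: False
          then have "Cx \<in> \<K>" using Cx by (simp add: \<K>_def)
          moreover have "corr `` Cx = {w}"
            unfolding Cx_def using corr_component[OF xw(3) False] fw by simp
          ultimately show ?thesis by (auto simp: Y_def)
        qed
        then show ?thesis by (auto simp: N3_def)
      next
        case nonsing: False
        then obtain n where n: "corr `` {x} = D n"
          using D[OF comp] by auto
        have "n \<ge> n0"
        proof (rule ccontr)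
          assume "\<not> n \<ge> n0"
          show False
          proof (cases "z0 \<in> sw.corr `` D n")
            case True
            then obtain y where "y \<in> D n" "(z0, y) \<in> corr" by (auto simp: corr_swap)
            then have "y \<in> corr `` {x} \<inter> corr `` {z0}" using n by auto
            moreover have "corr `` {x} \<inter> corr `` {z0} = {}"
              using xw by (intro corr_separated z0) (auto simp: C0_def)
            ultimately show False by blast
          next
            case False
            then have "n \<in> I" using \<open>\<not> n \<ge> n0\<close> comp n by (auto simp: I_def)
            moreover have "x \<in> sw.corr `` D n" using w n xw by (auto simp: corr_swap)
            ultimately have "x \<in> B" by (auto simp: B_def)
            moreover have "x \<in> ball z0 r1" using xw r by auto
            ultimately show False using r1 by blast
          qed
        qed
        moreover have "w \<bullet> v \<in> H n" using H(2)[of n] w n by auto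
        ultimately have "w \<bullet> v \<in> N2"
          unfolding N2_def by (metis UN_iff UNIV_I le_add_diff_inverse2)
        then show ?thesis by blast
      qed
    qed
    then have "(\<lambda>w. w \<bullet> v) ` (corr `` (sphere z0 r - C0)) \<subseteq> N1 \<union> N2 \<union> N3"
      by blast
    moreover have "N1 \<union> N2 \<union> N3 \<in> sets lborel" using N1 N2 N3 by auto
    ultimately show ?thesis by blast
  qed
  show "\<exists>r. 0 < r \<and> r < r0 \<and> (\<forall>v\<in>Basis. \<exists>N\<in>sets lborel. emeasure lborel N < ennreal e \<and>
      (\<lambda>w. w \<bullet> v) ` (corr `` (sphere z0 r - connected_component_set (- U) z0)) \<subseteq> N)"
    using r main unfolding C0_def by blast
qed

text \<open>Eilenberg's inequality, in the qualitative form that is needed: Fatou's lemma applied to the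
  number of sets of a fine cover that meet the level set.\<close>

lemma finite_level_sets:
  fixes \<rho> :: "'a::metric_space \<Rightarrow> real"
  assumes fin: "linear_measure B < \<infinity>" and L: "L \<ge> 0"
    and lip: "\<And>p q. p \<in> B \<Longrightarrow> q \<in> B \<Longrightarrow> \<bar>\<rho> p - \<rho> q\<bar> \<le> L * dist p q"
  obtains Z where "Z \<in> null_sets lborel" "\<And>r. r \<notin> Z \<Longrightarrow> finite {p \<in> B. \<rho> p = r}"
proof -
  define M where "M = linear_measure B"
  have "\<exists>U. B \<subseteq> (\<Union>k. U k) \<and> (\<forall>k. bounded (U k) \<and> diameter (U k) \<le> 1 / real (Suc n)) \<and>
      (\<Sum>k. ennreal (diameter (U k))) < M + 1" for n
  proof -
    have "linear_premeasure (1 / real (Suc n)) B \<le> M"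
      unfolding M_def linear_measure_def by (intro SUP_upper) auto
    also have "M < M + 1" using fin
      by (cases M) (auto simp: M_def ennreal_plus[symmetric] simp del: ennreal_plus)
    finally show ?thesis
      unfolding linear_premeasure_def INF_less_iff by auto
  qed
  then obtain U where U: "\<And>n. B \<subseteq> (\<Union>k. U n k)" "\<And>n k. bounded (U n k)"
      "\<And>n k. diameter (U n k) \<le> 1 / real (Suc n)"
      "\<And>n. (\<Sum>k. ennreal (diameter (U n k))) < M + 1"
    by metis
  have "\<exists>N. N \<in> sets lborel \<and> \<rho> ` (U n k \<inter> B) \<subseteq> N \<and>
      emeasure lborel N \<le> ennreal (L * diameter (U n k))" for n k
  proof -
    have "x - y \<le> L * diameter (U n k)" if xy: "x \<in> \<rho> ` (U n k \<inter> B)" "y \<in> \<rho> ` (U n k \<inter> B)" for x y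
    proof -
      obtain p q where pq: "p \<in> U n k" "q \<in> U n k" "p \<in> B" "q \<in> B" "x = \<rho> p" "y = \<rho> q"
        using xy by blast
      have "x - y \<le> L * dist p q" using lip[OF pq(3,4)] pq by simp
      also have "\<dots> \<le> L * diameter (U n k)"
        using diameter_bounded_bound[OF U(2) pq(1,2)] L by (intro mult_left_mono)
      finally show ?thesis .
    qed
    then show ?thesis
      using interval_hull[of "\<rho> ` (U n k \<inter> B)" "L * diameter (U n k)"] L diameter_ge_0[OF U(2)]
      by (metis mult_nonneg_nonneg)
  qed
  then obtain I where I: "\<And>n k. I n k \<in> sets lborel" "\<And>n k. \<rho> ` (U n k \<inter> B) \<subseteq> I n k"
      "\<And>n k. emeasure lborel (I n k) \<le> ennreal (L * diameter (U n k))"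
    by metis
  \<comment> \<open>Counts the sets of the cover of mesh \<open>1 / (n + 1)\<close> whose shadow
    contains \<open>r\<close>. Its integral is at most \<open>L\<close> times the sum of the
    diameters, uniformly in \<open>n\<close>.\<close>
  define H where "H n r = (\<Sum>k. indicator (I n k) r :: ennreal)" for n r
  have Hm [measurable]: "H n \<in> borel_measurable lborel" for n
    unfolding H_def using I(1) by measurable
  have intH: "(\<integral>\<^sup>+r. H n r \<partial>lborel) \<le> ennreal L * (M + 1)" for n
  proof -
    have "(\<integral>\<^sup>+r. H n r \<partial>lborel) = (\<Sum>k. emeasure lborel (I n k))"
      unfolding H_def using I(1) by (subst nn_integral_suminf) auto
    also have "\<dots> \<le> (\<Sum>k. ennreal L * ennreal (diameter (U n k)))"
      using I(3) L diameter_ge_0[OF U(2)] by (intro suminf_le) (auto simp: ennreal_mult)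
    also have "\<dots> = ennreal L * (\<Sum>k. ennreal (diameter (U n k)))"
      by (rule ennreal_suminf_cmult)
    also have "\<dots> \<le> ennreal L * (M + 1)"
      using U(4)[of n] by (intro mult_left_mono) auto
    finally show ?thesis .
  qed
  have "(\<integral>\<^sup>+r. liminf (\<lambda>n. H n r) \<partial>lborel) \<le> liminf (\<lambda>n. \<integral>\<^sup>+r. H n r \<partial>lborel)"
    by (rule nn_integral_liminf) auto
  also have "\<dots> \<le> ennreal L * (M + 1)"
  proof -
    have "liminf (\<lambda>n. \<integral>\<^sup>+r. H n r \<partial>lborel) \<le> liminf (\<lambda>_ :: nat. ennreal L * (M + 1))"
      by (intro Liminf_mono always_eventually allI intH)
    then show ?thesis by (simp add: Liminf_const)
  qed
  also have "\<dots> < \<infinity>" using fin by (simp add: M_def ennreal_mult_less_top)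
  finally have "(\<integral>\<^sup>+r. liminf (\<lambda>n. H n r) \<partial>lborel) \<noteq> \<infinity>" by simp
  then have "AE r in lborel. liminf (\<lambda>n. H n r) \<noteq> \<infinity>"
    by (intro nn_integral_PInf_AE) auto
  then obtain Z where Z: "Z \<in> null_sets lborel" "{r. liminf (\<lambda>n. H n r) = \<infinity>} \<subseteq> Z"
    by (auto elim!: AE_E simp: null_sets_def)
  show thesis
  proof (rule that[OF Z(1)], rule ccontr)
    fix r assume r: "r \<notin> Z" and inf: "infinite {p \<in> B. \<rho> p = r}"
    have le: "of_nat m \<le> liminf (\<lambda>n. H n r)" for m :: nat
    proof -
      obtain F where F: "F \<subseteq> {p \<in> B. \<rho> p = r}" "finite F" "card F = m"
        using infinite_arbitrarily_large[OF inf] by blast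
      \<comment> \<open>The least distance among \<open>m\<close> points of the level set, with
        default 1 in the absence of pairs. A cover finer than this puts the points into distinct
        sets, so \<open>H n r\<close> is at least \<open>m\<close>.\<close>
      define \<delta> where "\<delta> = Min (insert 1 ((\<lambda>(p, q). dist p q) ` {(p, q). p \<in> F \<and> q \<in> F \<and> p \<noteq> q}))"
      have finP: "finite {(p, q). p \<in> F \<and> q \<in> F \<and> p \<noteq> q}"
        by (rule finite_subset[of _ "F \<times> F"]) (use F in auto)
      have \<delta>: "\<delta> > 0" unfolding \<delta>_def using finP by auto
      have \<delta>le: "\<delta> \<le> dist p q" if "p \<in> F" "q \<in> F" "p \<noteq> q" for p q
        unfolding \<delta>_def using finP that by (intro Min_le) auto
      obtain n0 where n0: "1 / real (Suc n0) < \<delta>" using \<delta> nat_approx_posE by blast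
      have "of_nat m \<le> H n r" if n: "n \<ge> n0" for n
      proof -
        have "\<forall>p\<in>F. \<exists>k. p \<in> U n k" using F U(1)[of n] by blast
        then obtain \<kappa> where \<kappa>: "\<And>p. p \<in> F \<Longrightarrow> p \<in> U n (\<kappa> p)" by metis
        have small: "diameter (U n k) < \<delta>" for k
        proof -
          have "1 / real (Suc n) \<le> 1 / real (Suc n0)" using n by (simp add: frac_le)
          then show ?thesis using U(3)[of n k] n0 by linarith
        qed
        have inj: "inj_on \<kappa> F"
        proof (rule inj_onI, rule ccontr)
          fix p q assume pq: "p \<in> F" "q \<in> F" "\<kappa> p = \<kappa> q" "p \<noteq> q"
          have "dist p q \<le> diameter (U n (\<kappa> p))"
            using diameter_bounded_bound[OF U(2), of p n "\<kappa> p" q] \<kappa>[OF pq(1)] \<kappa>[OF pq(2)] pq by simp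
          then show False using small[of "\<kappa> p"] \<delta>le[OF pq(1,2,4)] by linarith
        qed
        have "of_nat m = (\<Sum>k\<in>\<kappa> ` F. (1 :: ennreal))"
          using F inj by (simp add: card_image)
        also have "\<dots> \<le> (\<Sum>k\<in>\<kappa> ` F. indicator (I n k) r)"
        proof (rule sum_mono)
          fix k assume "k \<in> \<kappa> ` F"
          then obtain p where "p \<in> F" "k = \<kappa> p" by blast
          then have "p \<in> U n k \<inter> B" "\<rho> p = r" using \<kappa> F by auto
          then have "r \<in> I n k" using I(2)[of n k] by blast
          then show "(1 :: ennreal) \<le> indicator (I n k) r" by simp
        qed
        also have "\<dots> \<le> H n r"
          unfolding H_def using F by (intro sum_le_suminf) auto
        finally show ?thesis .
      qed
      then have "\<forall>\<^sub>F n in sequentially. of_nat m \<le> H n r"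
        using eventually_sequentially by blast
      then show ?thesis by (rule Liminf_bounded)
    qed
    have "liminf (\<lambda>n. H n r) = \<infinity>"
    proof (rule ccontr)
      assume "liminf (\<lambda>n. H n r) \<noteq> \<infinity>"
      then obtain m :: nat where "liminf (\<lambda>n. H n r) < of_nat m"
        using ennreal_Ex_less_of_nat[of "liminf (\<lambda>n. H n r)"] by (auto simp: less_top)
      then show False using le[of m] by simp
    qed
    then show False using Z r by blast
  qed
qed

text \<open>Circles are selected by logarithmic radius, hence the levels \<open>exp s\<close>. The
  function \<open>ln\<close> is differentiable on the positive axis and so carries the null set of
  exceptional radii to a null set.\<close>

lemma countable_level_sets:
  fixes \<rho> :: "'a::metric_space \<Rightarrow> real"
  assumes A: "sigma_finite_linear_measure A" and L: "L \<ge> 0"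
    and lip: "\<And>p q. p \<in> A \<Longrightarrow> q \<in> A \<Longrightarrow> \<bar>\<rho> p - \<rho> q\<bar> \<le> L * dist p q"
  obtains Z where "negligible Z" "\<And>s. s \<notin> Z \<Longrightarrow> countable {p \<in> A. \<rho> p = exp s}"
proof -
  obtain B :: "nat \<Rightarrow> 'a set" where B: "A = (\<Union>n. B n)" and "\<forall>n. linear_measure (B n) < \<infinity>"
    using A unfolding sigma_finite_linear_measure_def by (elim exE conjE)
  then have fin: "linear_measure (B n) < \<infinity>" for n
    by (rule_tac spec)
  have "\<exists>Z. Z \<in> null_sets lborel \<and> (\<forall>r. r \<notin> Z \<longrightarrow> finite {p \<in> B n. \<rho> p = r})" for n
  proof -
    have "\<bar>\<rho> p - \<rho> q\<bar> \<le> L * dist p q" if "p \<in> B n" "q \<in> B n" for p q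
      using that B by (intro lip) auto
    then obtain Z where "Z \<in> null_sets lborel" "\<And>r. r \<notin> Z \<Longrightarrow> finite {p \<in> B n. \<rho> p = r}"
      using finite_level_sets[OF fin L, of n \<rho>] by blast
    then show ?thesis by blast
  qed
  then obtain Z where Z: "\<And>n. Z n \<in> null_sets lborel" "\<And>n r. r \<notin> Z n \<Longrightarrow> finite {p \<in> B n. \<rho> p = r}"
    by metis
  define Y where "Y = (\<Union>n. Z n)"
  have "Y \<in> null_sets lborel" unfolding Y_def using Z(1) by auto
  then have "negligible Y"
    using negligible_iff_null_sets null_sets_completionI by blast
  then have "negligible (Y \<inter> {0<..})"
    by (rule negligible_subset) auto
  moreover have "ln differentiable_on Y \<inter> {0 :: real<..}"
    unfolding differentiable_on_def
  proof
    fix x :: real assume "x \<in> Y \<inter> {0<..}"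
    then have "(ln has_real_derivative inverse x) (at x)"
      by (intro DERIV_ln) simp
    then show "ln differentiable (at x within Y \<inter> {0<..})"
      using real_differentiable_def differentiable_at_withinI by blast
  qed
  ultimately have "negligible (ln ` (Y \<inter> {0<..}))"
    by (rule negligible_differentiable_image_negligible[OF order_refl])
  moreover have "countable {p \<in> A. \<rho> p = exp s}" if s: "s \<notin> ln ` (Y \<inter> {0<..})" for s
  proof -
    have "exp s \<notin> Y" using s by (force simp: image_iff)
    then have "finite {p \<in> B n. \<rho> p = exp s}" for n
      by (intro Z(2)) (auto simp: Y_def)
    then have "countable (\<Union>n. {p \<in> B n. \<rho> p = exp s})"
      by (intro countable_UN) (auto intro: countable_finite)
    moreover have "{p \<in> A. \<rho> p = exp s} = (\<Union>n. {p \<in> B n. \<rho> p = exp s})"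
      using B by auto
    ultimately show ?thesis by simp
  qed
  ultimately show thesis by (rule that)
qed

section \<open>Coordinates on the sphere\<close>

text \<open>The chordal metric: its square is rational in affine coordinates, and it agrees with the
  spherical distance up to a factor 3, which suffices for continuity and Lipschitz
  estimates.\<close>

definition chord :: "ext_complex \<Rightarrow> ext_complex \<Rightarrow> real" where
  "chord p q = norm (stereo p - stereo q)"

lemma chord_sq: "(chord p q)\<^sup>2 = 2 - 2 * (stereo p \<bullet> stereo q)"
proof -
  have "stereo p \<bullet> stereo p = 1" for p by (simp add: dot_square_norm)
  then show ?thesis
    unfolding chord_def power2_norm_eq_inner
    by (simp add: inner_diff_left inner_diff_right inner_commute[of "stereo q" "stereo p"])
qed

lemma chord_commute: "chord p q = chord q p"
  by (simp add: chord_def norm_minus_commute)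

lemma chord_le_2: "chord p q \<le> 2"
  using norm_triangle_ineq4[of "stereo p" "stereo q"] by (simp add: chord_def)

lemma chord_pos: "p \<noteq> q \<Longrightarrow> chord p q > 0"
  by (simp add: chord_def)

lemma dist_ext_bounds: "0 \<le> dist p q" "dist p q \<le> pi" for p q :: ext_complex
  using abs_inner_stereo_le_1[of p q]
  by (simp_all only: dist_ext_complex_def abs_le_iff, auto intro!: arccos_lbound arccos_ubound)

lemma chord_eq_sin: "chord p q = 2 * sin (dist p q / 2)"
proof -
  have "cos (dist p q) = stereo p \<bullet> stereo q"
    using abs_inner_stereo_le_1[of p q] by (simp add: dist_ext_complex_def cos_arccos_abs)
  moreover have "cos (2 * (dist p q / 2)) = 1 - 2 * (sin (dist p q / 2))\<^sup>2"
    by (rule cos_double_sin)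
  ultimately have sq: "(chord p q)\<^sup>2 = (2 * sin (dist p q / 2))\<^sup>2"
    by (simp add: chord_sq power_mult_distrib)
  have "sin (dist p q / 2) \<ge> 0"
    using dist_ext_bounds(2)[of p q] pi_ge_zero by (intro sin_ge_zero) (simp, linarith)
  then show ?thesis
    by (intro power2_eq_imp_eq[OF sq]) (simp_all add: chord_def)
qed

lemma chord_le_dist: "chord p q \<le> dist p q"
  using sin_x_le_x[of "dist p q / 2"] dist_ext_bounds[of p q] by (simp add: chord_eq_sin)

text \<open>Half the distance, \<open>x\<close>, is at most \<open>pi / 2 < 2\<close>, so the cubic
  Taylor bound gives \<open>sin x \<ge> x - 4 * x / 6 = x / 3\<close>; the chord is
  \<open>2 * sin x\<close>.\<close>

lemma dist_le_chord: "dist p q \<le> 3 * chord p q"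
proof -
  define x where "x = dist p q / 2"
  have x: "0 \<le> x" "x \<le> 2"
    using dist_ext_bounds[of p q] pi_less_4 by (auto simp: x_def)
  have "(\<Sum>m<3. sin_coeff m * x ^ m) = x"
    by (simp add: sin_coeff_def eval_nat_numeral)
  then have "\<bar>sin x - x\<bar> \<le> inverse (fact 3) * \<bar>x\<bar> ^ 3"
    using Maclaurin_sin_bound[of x 3] by metis
  then have "\<bar>sin x - x\<bar> \<le> x ^ 3 / 6"
    using x by (simp add: fact_numeral field_simps)
  then have "sin x \<ge> x - x ^ 3 / 6"
    by linarith
  moreover have "x ^ 3 \<le> 4 * x"
  proof -
    have "x * x \<le> 2 * 2" using x by (intro mult_mono) auto
    then have "(x * x) * x \<le> 4 * x" using x by (intro mult_right_mono) auto
    then show ?thesis by (simp add: eval_nat_numeral)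
  qed
  ultimately have "sin x \<ge> x / 3" by simp
  then show ?thesis by (simp add: chord_eq_sin x_def)
qed

lemma continuous_on_stereo: "continuous_on S stereo"
  unfolding continuous_on_iff
proof (intro ballI allI impI)
  fix p :: ext_complex and e :: real assume "e > 0"
  then show "\<exists>d>0. \<forall>q\<in>S. dist q p < d \<longrightarrow> dist (stereo q) (stereo p) < e"
    using chord_le_dist by (intro exI[of _ e]) (auto simp: dist_norm chord_def intro: le_less_trans)
qed

lemma bounded_ext_complex [simp]: "bounded (S :: ext_complex set)"
  using dist_ext_bounds(2) by (auto simp: bounded_def)

lemma chord_Fin:
  "chord (Fin z) (Fin w) = 2 * norm (z - w) / (sqrt (1 + (norm z)\<^sup>2) * sqrt (1 + (norm w)\<^sup>2))"
proof -
  define A B where "A = 1 + (norm z)\<^sup>2" and "B = 1 + (norm w)\<^sup>2"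
  have AB: "A > 0" "B > 0" by (simp_all add: A_def B_def add_pos_nonneg)
  have zw: "(norm (z - w))\<^sup>2 = (A - 1) + (B - 1) - 2 * (z \<bullet> w)"
    by (simp add: A_def B_def power2_norm_eq_inner inner_diff_left inner_diff_right inner_commute)
  have st: "stereo (Fin z) = ((2 / A) *\<^sub>R z, (A - 2) / A)" "stereo (Fin w) = ((2 / B) *\<^sub>R w, (B - 2) / B)"
    by (simp_all add: A_def B_def add.commute)
  have "(chord (Fin z) (Fin w))\<^sup>2 = 2 - 2 * (4 / (A * B) * (z \<bullet> w) + (A - 2) / A * ((B - 2) / B))"
    unfolding chord_sq st by simp
  also have "\<dots> = 4 * (norm (z - w))\<^sup>2 / (A * B)"
    unfolding zw using AB by (simp add: field_simps)
  also have "\<dots> = (2 * norm (z - w) / (sqrt A * sqrt B))\<^sup>2"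
    using AB by (simp add: power_divide power_mult_distrib)
  finally show ?thesis
    using AB by (simp add: power2_eq_iff_nonneg chord_def A_def B_def)
qed

lemma chord_Infty: "chord (Fin z) Infty = 2 / sqrt (1 + (norm z)\<^sup>2)"
proof -
  define A where "A = 1 + (norm z)\<^sup>2"
  have A: "A > 0" by (simp add: A_def add_pos_nonneg)
  have "(chord (Fin z) Infty)\<^sup>2 = 2 - 2 * ((A - 2) / A)"
    unfolding chord_sq by (simp add: A_def add.commute)
  also have "\<dots> = (2 / sqrt A)\<^sup>2"
    using A by (simp add: power_divide field_simps)
  finally show ?thesis
    using A by (simp add: power2_eq_iff_nonneg chord_def A_def)
qed

text \<open>The value of \<open>coord a\<close> at the pole \<open>Fin a\<close> is a dummy.\<close>

fun coord :: "complex \<Rightarrow> ext_complex \<Rightarrow> complex" where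
  "coord a (Fin z) = 1 / (z - a)"
| "coord a Infty = 0"

definition param :: "complex \<Rightarrow> complex \<Rightarrow> ext_complex" where
  "param a z = (if z = 0 then Infty else Fin (a + 1 / z))"

lemma coord_param [simp]: "coord a (param a z) = z"
  by (simp add: param_def)

lemma param_coord [simp]: "p \<noteq> Fin a \<Longrightarrow> param a (coord a p) = p"
  by (cases p) (auto simp: param_def)

lemma param_neq [simp]: "param a z \<noteq> Fin a"
  by (simp add: param_def)

lemma param_eq_iff [simp]: "param a z = param a w \<longleftrightarrow> z = w"
  by (metis coord_param)

lemma inj_param: "inj_on (param a) S"
  by (simp add: inj_on_def)

lemma range_param: "range (param a) = - {Fin a}"
proof (intro subset_antisym subsetI)
  fix p assume "p \<in> - {Fin a}"
  then have "p = param a (coord a p)" by simp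
  then show "p \<in> range (param a)" by blast
qed auto

text \<open>A Moebius map distorts chords by a factor at each end point, here governed by the chord
  to the pole. So \<open>coord a\<close> is Lipschitz away from the pole, and its inverse is
  Lipschitz everywhere, chords being at most 2.\<close>

lemma norm_coord_diff:
  assumes "p \<noteq> Fin a" "q \<noteq> Fin a"
  shows "norm (coord a p - coord a q) =
    2 / (1 + (norm a)\<^sup>2) * (chord p q / (chord p (Fin a) * chord q (Fin a)))"
proof -
  have pos: "sqrt (1 + (norm z)\<^sup>2) > 0" for z :: complex
    by (simp add: add_pos_nonneg)
  \<comment> \<open>The roots in the chord formula cancel: \<open>Z\<close>, \<open>W\<close>,
    \<open>A\<close> stand for those at \<open>z\<close>, \<open>w\<close>, \<open>a\<close>, while
    \<open>P\<close> and \<open>Q\<close> are the Euclidean distances to \<open>a\<close>.\<close>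
  have alg: "N / (P * Q) = 2 / (A * A) * ((2 * N / (Z * W)) / ((2 * P / (Z * A)) * (2 * Q / (W * A))))"
    if "P > 0" "Q > 0" "Z > 0" "W > 0" "A > 0" for P Q Z W A N :: real
    using that by (simp add: field_simps)
  have sq: "1 + (norm a)\<^sup>2 = sqrt (1 + (norm a)\<^sup>2) * sqrt (1 + (norm a)\<^sup>2)"
    by simp
  show ?thesis
  proof (cases p; cases q)
    fix z w assume pq: "p = Fin z" "q = Fin w"
    then have za: "z - a \<noteq> 0" "w - a \<noteq> 0" using assms by auto
    then have "1 / (z - a) - 1 / (w - a) = (w - z) / ((z - a) * (w - a))"
      by (simp add: field_simps)
    then have eq: "norm (coord a (Fin z) - coord a (Fin w)) = norm (z - w) / (norm (z - a) * norm (w - a))"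
      by (simp add: norm_divide norm_mult norm_minus_commute)
    have "norm (z - a) > 0" "norm (w - a) > 0" using za by simp_all
    then show ?thesis
      unfolding pq eq chord_Fin using alg pos by (subst sq) blast
  next
    fix z assume pq: "p = Fin z" "q = Infty"
    then have za: "norm (z - a) > 0" using assms by auto
    have eq: "norm (coord a (Fin z) - coord a Infty) = 1 / norm (z - a)"
      by (simp add: norm_divide)
    have "1 / P = 2 / (A * A) * ((2 / Z) / ((2 * P / (Z * A)) * (2 / A)))"
      if "P > 0" "Z > 0" "A > 0" for P Z A :: real
      using that by (simp add: field_simps)
    then show ?thesis
      unfolding pq eq chord_Fin chord_Infty chord_commute[of Infty] using za pos by (subst sq) blast
  next
    fix z assume pq: "p = Infty" "q = Fin z"
    then have za: "norm (z - a) > 0" using assms by auto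
    have eq: "norm (coord a Infty - coord a (Fin z)) = 1 / norm (z - a)"
      by (simp add: norm_divide)
    have "1 / P = 2 / (A * A) * ((2 / Z) / ((2 / A) * (2 * P / (Z * A))))"
      if "P > 0" "Z > 0" "A > 0" for P Z A :: real
      using that by (simp add: field_simps)
    then show ?thesis
      unfolding pq eq chord_Fin chord_Infty chord_commute[of Infty] using za pos by (subst sq) blast
  next
    assume pq: "p = Infty" "q = Infty"
    then show ?thesis by (simp add: chord_def)
  qed
qed

text \<open>The constant 6 is 3, from the comparison with chords, times \<open>2 * 2 / 2\<close>,
  from bounding both chords to the pole by 2.\<close>

lemma dist_param_le: "dist (param a z) (param a w) \<le> 6 * (1 + (norm a)\<^sup>2) * norm (z - w)"
proof -
  define c where "c = 1 + (norm a)\<^sup>2"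
  have c: "c > 0" by (simp add: c_def add_pos_nonneg)
  define x y where "x = chord (param a z) (Fin a)" and "y = chord (param a w) (Fin a)"
  have xy: "0 < x" "0 < y" "x \<le> 2" "y \<le> 2"
    by (auto simp: x_def y_def chord_pos chord_le_2)
  have "norm (z - w) = 2 / c * (chord (param a z) (param a w) / (x * y))"
    using norm_coord_diff[of "param a z" a "param a w"] by (simp add: c_def x_def y_def)
  then have "chord (param a z) (param a w) = c / 2 * norm (z - w) * (x * y)"
    using c xy by (simp add: field_simps)
  also have "\<dots> \<le> c / 2 * norm (z - w) * (2 * 2)"
    using c xy by (intro mult_left_mono mult_mono) auto
  finally show ?thesis
    using dist_le_chord[of "param a z" "param a w"] by (simp add: c_def[symmetric] mult_ac)
qed

lemma continuous_on_param: "continuous_on S (param a)"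
proof -
  define L where "L = 6 * (1 + (norm a)\<^sup>2)"
  have L: "L > 0" by (simp add: L_def add_pos_nonneg)
  show ?thesis
    unfolding continuous_on_iff
  proof (intro ballI allI impI)
    fix z :: complex and e :: real assume "e > 0"
    have "dist (param a w) (param a z) < e" if "dist w z < e / L" for w
      using dist_param_le[of a w z] that L by (simp add: L_def dist_norm field_simps)
    then show "\<exists>d>0. \<forall>w\<in>S. dist w z < d \<longrightarrow> dist (param a w) (param a z) < e"
      using \<open>e > 0\<close> L by (intro exI[of _ "e / L"]) auto
  qed
qed

lemma continuous_on_coord:
  assumes "Fin a \<notin> S" shows "continuous_on S (coord a)"
  unfolding continuous_on_def
proof
  fix p assume p: "p \<in> S"
  then have pa: "p \<noteq> Fin a" using assms by auto
  have "((\<lambda>q. 2 / (1 + (norm a)\<^sup>2) * (chord q p / (chord q (Fin a) * chord p (Fin a)))) \<longlongrightarrow>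
      2 / (1 + (norm a)\<^sup>2) * (chord p p / (chord p (Fin a) * chord p (Fin a)))) (at p within S)"
    using chord_pos[OF pa] continuous_on_stereo[of S, unfolded continuous_on_def] p
    unfolding chord_def by (intro tendsto_intros) auto
  then have "((\<lambda>q. 2 / (1 + (norm a)\<^sup>2) * (chord q p / (chord q (Fin a) * chord p (Fin a)))) \<longlongrightarrow> 0)
      (at p within S)"
    by (simp add: chord_def)
  then have "((\<lambda>q. norm (coord a q - coord a p)) \<longlongrightarrow> 0) (at p within S)"
  proof (rule Lim_transform_eventually)
    show "\<forall>\<^sub>F q in at p within S. 2 / (1 + (norm a)\<^sup>2) * (chord q p / (chord q (Fin a) * chord p (Fin a))) =
        norm (coord a q - coord a p)"
      unfolding eventually_at_filter
    proof (intro always_eventually allI impI)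
      fix q assume "q \<in> S"
      then have "q \<noteq> Fin a" using assms by auto
      then show "2 / (1 + (norm a)\<^sup>2) * (chord q p / (chord q (Fin a) * chord p (Fin a))) =
          norm (coord a q - coord a p)"
        using norm_coord_diff pa by simp
    qed
  qed
  then show "(coord a \<longlongrightarrow> coord a p) (at p within S)"
    by (rule LIM_zero_cancel[OF tendsto_norm_zero_cancel])
qed

lemma open_image_param:
  assumes "open S" shows "open (param a ` S)"
proof -
  have "open (- {Fin a} \<inter> coord a -` S)"
    using assms by (intro continuous_open_preimage continuous_on_coord) auto
  moreover have "- {Fin a} \<inter> coord a -` S = param a ` S"
    by (auto simp: image_iff) (metis param_coord)
  ultimately show ?thesis by simp
qed

lemma param_near_pole:
  assumes "open W" "Fin a \<in> W"
  obtains \<rho> where "\<rho> > 0" "\<And>w. norm w > \<rho> \<Longrightarrow> param a w \<in> W"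
proof -
  obtain e where e: "e > 0" "ball (Fin a) e \<subseteq> W"
    using assms open_contains_ball by blast
  \<comment> \<open>The chord from \<open>a + 1 / w\<close> to \<open>a\<close> is at most
    \<open>2 / norm w\<close>, and the distance at most three times that.\<close>
  have "param a w \<in> W" if w: "norm w > 6 / e" for w
  proof -
    have w0: "w \<noteq> 0" "norm w > 0" using w e by auto
    have s: "sqrt (1 + (norm z)\<^sup>2) \<ge> 1" for z :: complex
      by (simp add: real_le_rsqrt)
    have "chord (Fin (a + 1 / w)) (Fin a) =
        (2 / norm w) / (sqrt (1 + (norm (a + 1 / w))\<^sup>2) * sqrt (1 + (norm a)\<^sup>2))"
      unfolding chord_Fin by (simp add: norm_divide)
    also have "\<dots> \<le> 2 / norm w / 1"
      using s[of "a + 1 / w"] s[of a] mult_mono[OF s[of "a + 1 / w"] s[of a]]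
      by (intro divide_left_mono) auto
    finally have "dist (param a w) (Fin a) \<le> 3 * (2 / norm w)"
      using dist_le_chord[of "param a w" "Fin a"] w0 by (simp add: param_def)
    also have "\<dots> < e" using w w0 e by (simp add: field_simps)
    finally show ?thesis using e by (auto simp: dist_commute)
  qed
  then show thesis using e by (intro that[of "6 / e"]) auto
qed

lemma closure_vimage_param:
  "closure (param a -` S) = param a -` closure S"
proof (intro subset_antisym subsetI)
  fix z assume "z \<in> closure (param a -` S)"
  then have "param a z \<in> closure (param a ` (param a -` S))"
    using image_closure_subset[OF continuous_on_param closed_closure closure_subset] by blast
  then show "z \<in> param a -` closure S"
    using closure_mono[of "param a ` (param a -` S)" S] by auto
next
  fix z assume z: "z \<in> param a -` closure S"
  show "z \<in> closure (param a -` S)"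
    unfolding closure_iff_nhds_not_empty
  proof (intro allI impI)
    fix A N assume N: "N \<subseteq> A" "open N" "z \<in> N"
    have "param a ` N \<inter> S \<noteq> {}"
      using z open_image_param[OF N(2), of a] N open_Int_closure_eq_empty[of "param a ` N" S] by blast
    then show "(param a -` S) \<inter> A \<noteq> {}" using N by blast
  qed
qed

lemma open_vimage_param: "open S \<Longrightarrow> open (param a -` S)"
  using continuous_on_param by (intro open_vimage) auto

lemma frontier_vimage_param: "open S \<Longrightarrow> frontier (param a -` S) = param a -` frontier S"
  using open_vimage_param[of S a] by (auto simp: frontier_def interior_open closure_vimage_param)

lemma connected_component_param:
  "connected_component (param a ` S) (param a x) (param a y) \<longleftrightarrow> connected_component S x y"
proof
  assume "connected_component S x y"
  then obtain T where T: "connected T" "T \<subseteq> S" "x \<in> T" "y \<in> T"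
    by (auto simp: connected_component_def)
  then have "connected (param a ` T)"
    using connected_continuous_image continuous_on_param by blast
  then show "connected_component (param a ` S) (param a x) (param a y)"
    using T unfolding connected_component_def by blast
next
  assume "connected_component (param a ` S) (param a x) (param a y)"
  then obtain T where T: "connected T" "T \<subseteq> param a ` S" "param a x \<in> T" "param a y \<in> T"
    by (auto simp: connected_component_def)
  have "Fin a \<notin> T" using T(2) range_param[of a] by blast
  then have "connected (coord a ` T)"
    using connected_continuous_image continuous_on_coord T by blast
  moreover have "coord a ` T \<subseteq> S" using T by force
  moreover have "x \<in> coord a ` T" "y \<in> coord a ` T" using T by force+
  ultimately show "connected_component S x y"
    unfolding connected_component_def by blast
qed

lemma components_param: "components (param a ` S) = (`) (param a) ` components S"
proof -
  have "connected_component_set (param a ` S) (param a x) = param a ` connected_component_set S x" for x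
  proof (intro subset_antisym subsetI)
    fix p assume p: "p \<in> connected_component_set (param a ` S) (param a x)"
    then obtain y where "p = param a y"
      using connected_component_subset by blast
    then show "p \<in> param a ` connected_component_set S x"
      using p by (auto simp: connected_component_param)
  qed (auto simp: connected_component_param)
  then show ?thesis
    by (auto simp: components_def image_image)
qed

section \<open>Transfer to the sphere\<close>

text \<open>The complement of a bounded convex planar set is connected; if it met \<open>C\<close>
  it would also leave the bounded set \<open>C\<close>, hence meet its frontier. With discs as
  \<open>K\<close> this extends diameter bounds from the boundary of a component to all of
  it.\<close>

lemma bounded_subset_convex:
  fixes C :: "complex set"
  assumes C: "bounded C" "frontier C \<subseteq> K" and K: "convex K" "bounded K"
  shows "C \<subseteq> K"
proof (rule ccontr)
  assume "\<not> C \<subseteq> K"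
  then have "- K \<inter> C \<noteq> {}" by auto
  moreover have "- K - C \<noteq> {}"
  proof
    assume "- K - C = {}"
    then have "UNIV = C \<union> K" by auto
    moreover have "bounded (C \<union> K)" using C K by simp
    ultimately have "bounded (UNIV :: complex set)" by simp
    then show False using not_bounded_UNIV by blast
  qed
  ultimately have "- K \<inter> frontier C \<noteq> {}"
    using K by (intro connected_Int_frontier[OF connected_complement_bounded_convex]) auto
  then show False using C by blast
qed

context exterior_homeo
begin

lemma component_subset_convex:
  assumes C: "C \<in> components (- U)" and K: "convex K" "bounded K" "C \<inter> frontier U \<subseteq> K"
  shows "C \<subseteq> K"
proof -
  obtain x where x: "C = connected_component_set (- U) x"
    using C by (auto simp: components_def)
  have "compact C" unfolding x by (rule compact_component)
  moreover have "frontier C \<subseteq> frontier U" unfolding x by (rule frontier_component)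
  ultimately have "frontier C \<subseteq> C \<inter> frontier U"
    using frontier_subset_closed compact_imp_closed by blast
  then show ?thesis
    using bounded_subset_convex[OF compact_imp_bounded[OF \<open>compact C\<close>] _ K(1,2)] K(3) by blast
qed

lemma component_meets_frontier':
  assumes "C \<in> components (- U)" obtains x where "x \<in> C" "x \<in> frontier U"
  using in_components_nonempty[OF component_Int_frontier[OF assms]] by blast

lemma component_singleton:
  assumes "C \<in> components (- U)" "C \<inter> frontier U \<subseteq> {x}" shows "C = {x}"
  using component_subset_convex[OF assms(1) _ _ assms(2)] in_components_nonempty[OF assms(1)]
  by auto

lemma component_eq_if_frontier_eq:
  assumes C: "C \<in> components (- U)" "C' \<in> components (- U)"
    and eq: "C \<inter> frontier U = C' \<inter> frontier U"
  shows "C = C'"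
proof -
  obtain x where "x \<in> C" "x \<in> frontier U" by (rule component_meets_frontier'[OF C(1)])
  then show ?thesis using components_nonoverlap[OF C] eq by blast
qed

end

lemma peano_continuum_image:
  assumes "peano_continuum P" "continuous_on P m" shows "peano_continuum (m ` P)"
proof -
  obtain g where "continuous_on {0..1::real} g" "g ` {0..1} = P"
    using assms(1) by (auto simp: peano_continuum_def)
  then show ?thesis
    using assms(2) continuous_on_compose[of "{0..1}" g m] unfolding peano_continuum_def
    by (intro exI[of _ "m \<circ> g"]) (metis image_comp)
qed

lemma jordan_curve_imp_peano: "jordan_curve J \<Longrightarrow> peano_continuum J"
  unfolding jordan_curve_def peano_continuum_def path_image_def
  using path_def simple_path_imp_path by blast

lemma jordan_curve_image:
  assumes "jordan_curve Q" "continuous_on Q m" "inj_on m Q"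
  shows "jordan_curve (m ` Q)"
proof -
  obtain g where g: "simple_path g" "pathfinish g = pathstart g" "path_image g = Q"
    using assms by (auto simp: jordan_curve_def)
  have "path (m \<circ> g)"
    using g assms simple_path_imp_path path_continuous_image by blast
  moreover have "loop_free (m \<circ> g)"
    using g assms(3) unfolding simple_path_def loop_free_def path_image_def inj_on_def
    by (metis comp_apply imageI)
  ultimately show ?thesis
    unfolding jordan_curve_def simple_path_def using g
    by (intro exI[of _ "m \<circ> g"]) (auto simp: pathfinish_compose pathstart_compose path_image_compose)
qed

text \<open>With the curve rebased at \<open>z0\<close>, parameters near 0 and 1 go into the ball.
  Cutting them off leaves an arc, which misses \<open>z0\<close> by simplicity.\<close>

lemma jordan_curve_complementary_arc:
  fixes Q :: "'a::metric_space set"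
  assumes "jordan_curve Q" "z0 \<in> Q" "r > 0"
  shows "\<exists>S. compact S \<and> connected S \<and> S \<subseteq> Q \<and> z0 \<notin> S \<and> Q - S \<subseteq> ball z0 r"
proof -
  obtain g where g: "simple_path g" "pathfinish g = pathstart g" "path_image g = Q"
    using assms by (auto simp: jordan_curve_def)
  obtain t0 where t0: "0 \<le> t0" "t0 \<le> 1" "g t0 = z0"
    using g(3) assms(2) by (auto simp: path_image_def)
  define c where "c = shiftpath t0 g"
  have c: "simple_path c" "path_image c = Q" "c 0 = z0" "c 1 = z0"
    using g t0 simple_path_shiftpath[of g t0] path_image_shiftpath[of t0 g]
      pathstart_shiftpath[of t0 g] pathfinish_shiftpath[of t0 g]
    by (auto simp: c_def pathstart_def pathfinish_def)
  have cont: "continuous_on {0..1} c"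
    using c(1) simple_path_imp_path path_def by blast
  obtain d0 where d0: "d0 > 0" "\<And>t. t \<in> {0..1} \<Longrightarrow> dist t 0 < d0 \<Longrightarrow> dist (c t) (c 0) < r"
    using cont[unfolded continuous_on_iff] assms(3) by (metis atLeastAtMost_iff order_refl zero_le_one)
  obtain d1 where d1: "d1 > 0" "\<And>t. t \<in> {0..1} \<Longrightarrow> dist t 1 < d1 \<Longrightarrow> dist (c t) (c 1) < r"
    using cont[unfolded continuous_on_iff] assms(3) by (metis atLeastAtMost_iff order_refl zero_le_one)
  define k where "k = min (min d0 d1) (1 / 3)"
  have k: "0 < k" "k \<le> 1 / 3" "k \<le> d0" "k \<le> d1" using d0 d1 by (auto simp: k_def)
  define S where "S = c ` {k..1 - k}"
  have sub: "{k..1 - k} \<subseteq> {0..1}" using k by auto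
  then have "continuous_on {k..1 - k} c" using cont continuous_on_subset by blast
  then have "compact S" "connected S"
    unfolding S_def by (auto intro: compact_continuous_image connected_continuous_image)
  moreover have "S \<subseteq> Q"
    unfolding S_def c(2)[symmetric] path_image_def using sub by (rule image_mono)
  moreover have "z0 \<notin> S"
  proof
    assume "z0 \<in> S"
    then obtain t where t: "t \<in> {k..1 - k}" "c t = c 0" using c by (auto simp: S_def)
    then have "t = 0 \<or> t = 1"
      using c(1) sub unfolding simple_path_def loop_free_def
      by (metis atLeastAtMost_iff order_refl subsetD zero_le_one)
    then show False using t k by auto
  qed
  moreover have "Q - S \<subseteq> ball z0 r"
  proof
    fix x assume x: "x \<in> Q - S"
    then obtain t where t: "t \<in> {0..1}" "x = c t" using c(2) by (auto simp: path_image_def)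
    then have "t < k \<or> t > 1 - k" using x by (force simp: S_def)
    then show "x \<in> ball z0 r"
    proof
      assume "t < k"
      then show ?thesis using d0(2)[OF t(1)] t k c by (auto simp: dist_real_def dist_commute)
    next
      assume "t > 1 - k"
      then show ?thesis using d1(2)[OF t(1)] t k c by (auto simp: dist_real_def dist_commute)
    qed
  qed
  ultimately show ?thesis by blast
qed

lemma continuous_extension_if_limits:
  fixes f :: "'a::metric_space \<Rightarrow> 'b::metric_space"
  assumes cont: "continuous_on X f"
    and lim: "\<And>x. x \<in> closure X - X \<Longrightarrow> \<exists>l. (f \<longlongrightarrow> l) (at x within X)"
  obtains g where "continuous_on (closure X) g" "g ` closure X \<subseteq> closure (f ` X)"
    "\<And>x. x \<in> X \<Longrightarrow> g x = f x"
proof -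
  define g where "g x = (if x \<in> X then f x else (SOME l. (f \<longlongrightarrow> l) (at x within X)))" for x
  have gl: "(f \<longlongrightarrow> g x) (at x within X)" if "x \<in> closure X" for x
  proof (cases "x \<in> X")
    case True
    then show ?thesis using cont by (simp add: g_def continuous_on_def)
  next
    case False
    then show ?thesis
      using someI_ex[OF lim[of x]] that by (simp add: g_def)
  qed
  have near: "\<exists>d>0. \<forall>z\<in>X. dist z x < d \<longrightarrow> dist (f z) (g x) < e" if x: "x \<in> closure X" and "e > 0" for x e
  proof -
    obtain d where d: "d > 0" "\<And>z. z \<in> X \<Longrightarrow> z \<noteq> x \<Longrightarrow> dist z x < d \<Longrightarrow> dist (f z) (g x) < e"
      using tendstoD[OF gl[OF x] \<open>e > 0\<close>] unfolding eventually_at by metis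
    have "dist (f z) (g x) < e" if "z \<in> X" "dist z x < d" for z
      using d(2)[of z] that \<open>e > 0\<close> by (cases "z = x") (auto simp: g_def)
    then show ?thesis using d(1) by blast
  qed
  have approx: "\<exists>z\<in>X. dist z x < d \<and> dist (f z) (g x) < e" if x: "x \<in> closure X" "e > 0" "d > 0" for x e d
  proof -
    obtain d' where d': "d' > 0" "\<And>z. z \<in> X \<Longrightarrow> dist z x < d' \<Longrightarrow> dist (f z) (g x) < e"
      using near[OF x(1,2)] by blast
    obtain z where "z \<in> X" "dist z x < min d d'"
      using x d'(1) closure_approachable[of x X] by (metis min_less_iff_conj)
    then show ?thesis using d'(2) by auto
  qed
  show thesis
  proof
    show "continuous_on (closure X) g"
      unfolding continuous_on_iff
    proof (intro ballI allI impI)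
      fix x and e :: real assume x: "x \<in> closure X" "e > 0"
      obtain d where d: "d > 0" "\<And>z. z \<in> X \<Longrightarrow> dist z x < d \<Longrightarrow> dist (f z) (g x) < e / 2"
        using near[OF x(1), of "e / 2"] x(2) by auto
      have "dist (g x') (g x) < e" if x': "x' \<in> closure X" "dist x' x < d / 2" for x'
      proof -
        obtain z where z: "z \<in> X" "dist z x' < d / 2" "dist (f z) (g x') < e / 2"
          using approx[OF x'(1), of "e / 2" "d / 2"] x(2) d(1) by auto
        have "dist z x < d" using z(2) x'(2) dist_triangle[of z x x'] by simp
        then have "dist (f z) (g x) < e / 2" using d(2) z(1) by blast
        then show ?thesis using z(3) dist_triangle3[of "g x'" "g x" "f z"] by simp
      qed
      then show "\<exists>d>0. \<forall>x'\<in>closure X. dist x' x < d \<longrightarrow> dist (g x') (g x) < e"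
        using d(1) by (intro exI[of _ "d / 2"]) auto
    qed
    show "g ` closure X \<subseteq> closure (f ` X)"
    proof clarify
      fix x assume x: "x \<in> closure X"
      have "\<exists>y\<in>f ` X. dist y (g x) < e" if "e > 0" for e
        using approx[OF x that zero_less_one] by blast
      then show "g x \<in> closure (f ` X)"
        unfolding closure_approachable by blast
    qed
  qed (simp add: g_def)
qed

section \<open>Spherical domains in planar coordinates\<close>

lemma bounded_compl_vimage_param:
  assumes "open W" "Fin a \<in> W" shows "bounded (- (param a -` W))"
proof -
  obtain \<rho> where "\<And>w. norm w > \<rho> \<Longrightarrow> param a w \<in> W"
    using param_near_pole[OF assms] by blast
  then show ?thesis
    by (intro boundedI[of _ \<rho>]) (auto simp: not_less[symmetric])
qed

text \<open>Deleting the pole does not disconnect the domain: the outside of a large disc is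
  connected and lies in one piece of a separation, and adding the pole to that piece would separate
  the original domain.\<close>

lemma connected_vimage_param:
  assumes W: "open W" "connected W" "Fin a \<in> W"
  shows "connected (param a -` W)"
proof (rule connectedI)
  fix A B :: "complex set"
  assume AB: "open A" "open B" "A \<inter> param a -` W \<noteq> {}" "B \<inter> param a -` W \<noteq> {}"
    "A \<inter> B \<inter> param a -` W = {}" "param a -` W \<subseteq> A \<union> B"
  obtain \<rho> where \<rho>: "\<And>w. norm w > \<rho> \<Longrightarrow> param a w \<in> W" and "\<rho> > 0"
    using param_near_pole[OF W(1,3)] by blast
  define E where "E = - cball (0 :: complex) \<rho>"
  have E: "connected E" "E \<subseteq> param a -` W"
    using \<rho> by (auto simp: E_def intro!: connected_complement_bounded_convex)
  have False if A: "open A" "open B" "B \<inter> param a -` W \<noteq> {}" "A \<inter> B \<inter> param a -` W = {}"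
      "param a -` W \<subseteq> A \<union> B" "E \<subseteq> A" for A B
  proof -
    define A' where "A' = param a ` (A \<inter> param a -` W) \<union> - param a ` cball 0 \<rho>"
    define B' where "B' = param a ` (B \<inter> param a -` W)"
    have oW: "open (param a -` W)" by (rule open_vimage_param[OF W(1)])
    have "open B'" unfolding B'_def using A(2) oW by (intro open_image_param open_Int)
    moreover have "open A'"
      unfolding A'_def using A(1) oW compact_continuous_image[OF continuous_on_param compact_cball]
      by (intro open_Un open_image_param open_Int open_Compl compact_imp_closed)
    moreover have "W \<subseteq> A' \<union> B'"
    proof
      fix p assume p: "p \<in> W"
      show "p \<in> A' \<union> B'"
      proof (cases "p = Fin a")
        case True
        then show ?thesis using range_param[of a] by (auto simp: A'_def)
      next
        case False
        then obtain z where "p = param a z" using range_param[of a] by blast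
        then show ?thesis using p A(5) by (auto simp: A'_def B'_def)
      qed
    qed
    moreover have "A' \<inter> B' \<inter> W = {}"
    proof -
      have "B \<inter> param a -` W \<subseteq> cball 0 \<rho>"
        using A(4,6) E(2) by (auto simp: E_def)
      then have "B' \<subseteq> param a ` cball 0 \<rho>" by (auto simp: B'_def)
      moreover have "param a ` (A \<inter> param a -` W) \<inter> B' = {}"
        using A(4) by (auto simp: B'_def)
      ultimately show ?thesis by (auto simp: A'_def)
    qed
    moreover have "B' \<inter> W \<noteq> {}" using A(3) by (auto simp: B'_def)
    moreover have "A' \<inter> W \<noteq> {}"
    proof -
      have "Fin a \<in> A'" using range_param[of a] by (auto simp: A'_def)
      then show ?thesis using W(3) by blast
    qed
    ultimately show False using W(2) unfolding connected_def by blast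
  qed
  moreover have "E \<subseteq> A \<or> E \<subseteq> B"
    using connectedD[OF E(1) AB(1,2)] E(2) AB(5,6) by blast
  moreover have "B \<inter> A \<inter> param a -` W = {}" "param a -` W \<subseteq> B \<union> A" using AB by auto
  ultimately show False using AB by metis
qed

lemma frontier_eq_param_image:
  assumes "open W" "Fin a \<in> W" shows "frontier W = param a ` frontier (param a -` W)"
proof -
  have "Fin a \<notin> frontier W" using assms by (simp add: frontier_def interior_open)
  then have "frontier W \<subseteq> range (param a)" by (auto simp: range_param)
  then show ?thesis
    unfolding frontier_vimage_param[OF assms(1)] by auto
qed

text \<open>The poles correspond under \<open>\<phi>\<close>, so that the planar map fixes infinity.
  Conformality is left out, which keeps the locale symmetric in the two domains.\<close>

locale normalized_pair =
  fixes X Y :: "ext_complex set" and \<phi> \<psi> :: "ext_complex \<Rightarrow> ext_complex" and a b :: complex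
  assumes open_X: "open X" and open_Y: "open Y" and connected_X: "connected X"
    and homeo_XY: "homeomorphism X Y \<phi> \<psi>" and a_in: "Fin a \<in> X" and phi_a: "\<phi> (Fin a) = Fin b"
begin

lemma phi_in: "p \<in> X \<Longrightarrow> \<phi> p \<in> Y" and psi_phi: "p \<in> X \<Longrightarrow> \<psi> (\<phi> p) = p"
  and cont_phi: "continuous_on X \<phi>" and image_phi: "\<phi> ` X = Y"
  using homeo_XY by (auto simp: homeomorphism_def)

lemma b_in: "Fin b \<in> Y"
  using phi_in[OF a_in] phi_a by simp

lemma pair_swap: "normalized_pair Y X \<psi> \<phi> b a"
proof
  show "connected Y"
    using connected_continuous_image[OF cont_phi connected_X] image_phi by simp
  show "\<psi> (Fin b) = Fin a" using psi_phi[OF a_in] phi_a by simp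
qed (use open_X open_Y homeomorphism_symD[OF homeo_XY] b_in in auto)

lemma phi_neq: "param a z \<in> X \<Longrightarrow> \<phi> (param a z) \<noteq> Fin b"
  using psi_phi[of "param a z"] psi_phi[OF a_in] phi_a by (metis param_neq)

definition planar :: "complex \<Rightarrow> complex" where
  "planar z = coord b (\<phi> (param a z))"

lemma param_planar: "param a z \<in> X \<Longrightarrow> param b (planar z) = \<phi> (param a z)"
  using phi_neq by (simp add: planar_def)

lemma continuous_on_planar: "continuous_on (param a -` X) planar"
  unfolding planar_def
proof (rule continuous_on_compose2[of "Y - {Fin b}"])
  show "continuous_on (Y - {Fin b}) (coord b)" by (rule continuous_on_coord) simp
  show "continuous_on (param a -` X) (\<lambda>z. \<phi> (param a z))"
    by (rule continuous_on_compose2[OF cont_phi continuous_on_param]) auto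
qed (use phi_in phi_neq in auto)

text \<open>The image \<open>K\<close> of a large disc is compact and misses \<open>Fin a\<close>,
  so by continuity \<open>\<psi>\<close> maps a neighbourhood of \<open>Fin b\<close> off
  \<open>K\<close>. That neighbourhood contains \<open>param b w\<close> for all large
  \<open>w\<close>.\<close>

lemma bounded_planar_image:
  assumes "bounded B" shows "bounded (planar ` (param a -` X \<inter> B))"
proof -
  obtain R where R: "B \<subseteq> cball 0 R"
    using bounded_subset_ballD[OF assms, of 0] ball_subset_cball by blast
  define K where "K = param a ` cball 0 R"
  have "closed K"
    unfolding K_def by (intro compact_imp_closed compact_continuous_image continuous_on_param) auto
  interpret sw: normalized_pair Y X \<psi> \<phi> b a by (rule pair_swap)
  have "open (Y \<inter> \<psi> -` (- K))"
    using \<open>closed K\<close> by (intro continuous_open_preimage sw.cont_phi open_Y open_Compl)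
  moreover have "Fin a \<notin> K"
    unfolding K_def using range_param[of a] by blast
  then have "Fin b \<in> Y \<inter> \<psi> -` (- K)"
    using b_in sw.phi_a by simp
  ultimately obtain \<rho> where \<rho>: "\<And>w. norm w > \<rho> \<Longrightarrow> param b w \<in> Y \<inter> \<psi> -` (- K)"
    using param_near_pole by blast
  have "norm (planar z) \<le> \<rho>" if z: "param a z \<in> X" "z \<in> B" for z
  proof (rule ccontr)
    assume "\<not> norm (planar z) \<le> \<rho>"
    then have "param b (planar z) \<in> Y \<inter> \<psi> -` (- K)" by (intro \<rho>) simp
    then have "param a z \<notin> K" using z by (simp add: param_planar psi_phi)
    then show False using z R by (auto simp: K_def)
  qed
  then show ?thesis by (intro boundedI[of _ \<rho>]) auto
qed

end

sublocale normalized_pair \<subseteq>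
  ex: exterior_homeo "param a -` X" "param b -` Y" planar "normalized_pair.planar \<psi> b a"
proof -
  interpret sw: normalized_pair Y X \<psi> \<phi> b a by (rule pair_swap)
  show "exterior_homeo (param a -` X) (param b -` Y) planar sw.planar"
  proof
    show "homeomorphism (param a -` X) (param b -` Y) planar sw.planar"
    proof (rule homeomorphismI)
      show "planar ` (param a -` X) \<subseteq> param b -` Y"
        by (auto simp: param_planar phi_in)
      show "sw.planar ` (param b -` Y) \<subseteq> param a -` X"
        by (auto simp: sw.param_planar sw.phi_in)
      show "sw.planar (planar z) = z" if "z \<in> param a -` X" for z
        using that by (simp add: sw.planar_def param_planar psi_phi)
      show "planar (sw.planar w) = w" if "w \<in> param b -` Y" for w
        using that by (simp add: planar_def sw.param_planar sw.psi_phi)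
    qed (rule continuous_on_planar sw.continuous_on_planar)+
  qed (use open_X open_Y connected_X a_in b_in bounded_planar_image sw.bounded_planar_image
      in \<open>auto intro!: open_vimage_param connected_vimage_param bounded_compl_vimage_param\<close>)
qed

context normalized_pair
begin

lemma component_param:
  assumes "C \<in> components (- (param a -` X))"
  shows "param a ` (C \<inter> frontier (param a -` X)) \<in> components (frontier X)"
  using ex.component_Int_frontier[OF assms]
  by (simp add: frontier_eq_param_image[OF open_X a_in] components_param)

lemma component_obtain:
  assumes "P \<in> components (frontier X)"
  obtains C where "C \<in> components (- (param a -` X))" "P = param a ` (C \<inter> frontier (param a -` X))"
proof -
  obtain P' where P': "P' \<in> components (frontier (param a -` X))" "P = param a ` P'"
    using assms by (auto simp: frontier_eq_param_image[OF open_X a_in] components_param)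
  obtain x where x: "x \<in> P'" using in_components_nonempty[OF P'(1)] by blast
  have xf: "x \<in> frontier (param a -` X)" using x P'(1) in_components_subset by blast
  then have "x \<notin> param a -` X" using ex.open_U by (simp add: frontier_def interior_open)
  then have C: "connected_component_set (- (param a -` X)) x \<in> components (- (param a -` X))"
    and xC: "x \<in> connected_component_set (- (param a -` X)) x"
    by (auto simp: components_def)
  have "P' = connected_component_set (- (param a -` X)) x \<inter> frontier (param a -` X)"
    using components_nonoverlap[OF P'(1) ex.component_Int_frontier[OF C]] x xf xC by blast
  then show thesis using that C P' by blast
qed

lemma nondegenerate_param:
  assumes C: "C \<in> components (- (param a -` X))" "\<nexists>x. C = {x}"
  shows "param a ` (C \<inter> frontier (param a -` X)) \<in> nondegenerate_components (frontier X)"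
proof -
  obtain x where x: "x \<in> C" "x \<in> frontier (param a -` X)"
    by (rule ex.component_meets_frontier'[OF C(1)])
  have "\<not> C \<inter> frontier (param a -` X) \<subseteq> {x}"
    using C ex.component_singleton by blast
  then obtain y where "y \<in> C" "y \<in> frontier (param a -` X)" "y \<noteq> x" by blast
  then show ?thesis
    using component_param[OF C(1)] x by (auto simp: nondegenerate_components_def)
qed

lemma component_param_inj:
  assumes "C \<in> components (- (param a -` X))" "C' \<in> components (- (param a -` X))"
    "param a ` (C \<inter> frontier (param a -` X)) = param a ` (C' \<inter> frontier (param a -` X))"
  shows "C = C'"
  using assms ex.component_eq_if_frontier_eq inj_image_eq_iff[OF inj_param] by metis

text \<open>The pole lies in the open set \<open>X\<close>, so the frontier keeps a positive
  distance from it, and the chords in the denominator are bounded below.\<close>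

lemma coord_lipschitz:
  obtains L where "L > 0" "\<And>p q. p \<in> frontier X \<Longrightarrow> q \<in> frontier X \<Longrightarrow>
    norm (coord a p - coord a q) \<le> L * dist p q"
proof -
  obtain e where e: "e > 0" "ball (Fin a) e \<subseteq> X"
    using open_X a_in open_contains_ball by blast
  have far: "chord p (Fin a) \<ge> e / 3" "p \<noteq> Fin a" if "p \<in> frontier X" for p
  proof -
    have "p \<notin> X" using that open_X by (simp add: frontier_def interior_open)
    then show "p \<noteq> Fin a" using a_in by auto
    have "dist p (Fin a) \<ge> e" using \<open>p \<notin> X\<close> e by (force simp: dist_commute)
    then show "chord p (Fin a) \<ge> e / 3" using dist_le_chord[of p "Fin a"] by simp
  qed
  define c where "c = 1 + (norm a)\<^sup>2"
  have c: "c > 0" by (simp add: c_def add_pos_nonneg)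
  define L where "L = 2 / c * (1 / (e / 3 * (e / 3)))"
  show thesis
  proof
    show "L > 0" using e c by (simp add: L_def)
    fix p q assume pq: "p \<in> frontier X" "q \<in> frontier X"
    have "norm (coord a p - coord a q) = 2 / c * (chord p q / (chord p (Fin a) * chord q (Fin a)))"
      using norm_coord_diff[OF far(2)[OF pq(1)] far(2)[OF pq(2)]] by (simp add: c_def)
    also have "\<dots> \<le> 2 / c * (dist p q / (e / 3 * (e / 3)))"
      using far(1)[OF pq(1)] far(1)[OF pq(2)] e c chord_le_dist
      by (intro mult_left_mono frac_le mult_mono) auto
    also have "\<dots> = L * dist p q" by (simp add: L_def)
    finally show "norm (coord a p - coord a q) \<le> L * dist p q" .
  qed
qed

text \<open>The charts change at infinity. Away from 0, where \<open>param a\<close> is infinite,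
  and from the point that \<open>\<phi>\<close> sends to infinity, both charts are the identity on
  finite points. The two exceptional points are removable because \<open>planar\<close> is
  continuous.\<close>

lemma planar_holomorphic:
  assumes "\<And>p. p \<in> X \<Longrightarrow> conformal_at \<phi> p"
  shows "planar holomorphic_on (param a -` X)"
proof (rule no_isolated_singularity[OF continuous_on_planar _ ex.open_U])
  define K where "K = {0, coord a (\<psi> Infty)}"
  show "finite K" by (simp add: K_def)
  have oU: "open (param a -` X - K)"
    using ex.open_U by (simp add: K_def open_delete insert_Diff_if open_Diff)
  have fin: "\<exists>\<omega>. \<phi> (Fin (a + 1 / z)) = Fin \<omega> \<and> planar z = 1 / (\<omega> - b) \<and> \<omega> \<noteq> b"
    if z: "z \<in> param a -` X - K" for z
  proof -
    have p: "param a z = Fin (a + 1 / z)" using z by (simp add: K_def param_def)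
    have "\<phi> (param a z) \<noteq> Infty"
    proof
      assume "\<phi> (param a z) = Infty"
      then have "\<psi> Infty = param a z" using psi_phi[of "param a z"] z by auto
      then show False using z by (simp add: K_def)
    qed
    then obtain \<omega> where \<omega>: "\<phi> (param a z) = Fin \<omega>" by (cases "\<phi> (param a z)") auto
    moreover have "\<omega> \<noteq> b" using phi_neq[of z] \<omega> z by auto
    ultimately show ?thesis using p by (simp add: planar_def)
  qed
  show "planar holomorphic_on (param a -` X - K)"
    unfolding holomorphic_on_def
  proof
    fix z assume z: "z \<in> param a -` X - K"
    obtain \<omega> where \<omega>: "\<phi> (Fin (a + 1 / z)) = Fin \<omega>" "\<omega> \<noteq> b" using fin[OF z] by blast
    define F where "F w = chart (Fin \<omega>) (\<phi> (Fin w))" for w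
    have z0: "z \<noteq> 0" using z by (simp add: K_def)
    have "Fin (a + 1 / z) \<in> X" using z z0 by (simp add: param_def)
    then have "(chart (Fin \<omega>) \<circ> \<phi> \<circ> chart_inv (Fin (a + 1 / z))) analytic_on {a + 1 / z}"
      using assms[of "Fin (a + 1 / z)"] \<omega> by (auto simp: conformal_at_def Let_def)
    moreover have "chart (Fin \<omega>) \<circ> \<phi> \<circ> chart_inv (Fin (a + 1 / z)) = F"
      by (auto simp: F_def)
    ultimately have "F field_differentiable (at (a + 1 / z))"
      using analytic_on_imp_differentiable_at by fastforce
    moreover have "(\<lambda>z. a + 1 / z) field_differentiable (at z)"
      using z0 by (intro derivative_intros) auto
    ultimately have "(F \<circ> (\<lambda>z. a + 1 / z)) field_differentiable (at z)"
      by (intro field_differentiable_compose)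
    then have "(\<lambda>z. 1 / (F (a + 1 / z) - b)) field_differentiable (at z)"
      using \<omega> by (intro field_differentiable_divide field_differentiable_diff)
        (auto simp: comp_def F_def)
    then obtain F' where "((\<lambda>z. 1 / (F (a + 1 / z) - b)) has_field_derivative F') (at z)"
      by (auto simp: field_differentiable_def)
    then have "(planar has_field_derivative F') (at z)"
    proof (rule has_field_derivative_transform_within_open[OF _ oU z])
      fix z' assume "z' \<in> param a -` X - K"
      then show "1 / (F (a + 1 / z') - b) = planar z'"
        using fin[of z'] by (auto simp: F_def)
    qed
    then show "planar field_differentiable (at z within param a -` X - K)"
      unfolding field_differentiable_def using has_field_derivative_at_within by blast
  qed
qed

text \<open>The extension agrees with the correspondence wherever the partner is a limit of values.
  Every frontier point of \<open>V\<close> is such a limit, by way of the inverse map, and every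
  frontier point of \<open>U\<close> has one; so \<open>G\<close> maps the frontier part of
  \<open>C\<close> onto that of its partner \<open>D\<close>.\<close>

lemma extension_component:
  assumes G: "continuous_on (closure X) G" "\<And>p. p \<in> X \<Longrightarrow> G p = \<phi> p"
    and P: "P \<in> components (frontier Y)"
  obtains Q where "Q \<in> components (frontier X)" "P = G ` Q"
proof -
  interpret sw: normalized_pair Y X \<psi> \<phi> b a by (rule pair_swap)
  define U V where "U = param a -` X" and "V = param b -` Y"
  have clU: "closure U = param a -` closure X" by (simp add: U_def closure_vimage_param)
  have key: "G (param a x) = param b y"
    if s: "\<And>n. s n \<in> U" "s \<longlonglongrightarrow> x" "(\<lambda>n. planar (s n)) \<longlonglongrightarrow> y" for s x y
  proof -
    have x: "x \<in> closure U"
      unfolding closure_sequential using s(1,2) by blast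
    have "(\<lambda>n. param a (s n)) \<longlonglongrightarrow> param a x"
      using continuous_on_tendsto_compose[OF continuous_on_param[of UNIV] s(2)] by auto
    then have "(\<lambda>n. G (param a (s n))) \<longlonglongrightarrow> G (param a x)"
    proof (rule continuous_on_tendsto_compose[OF G(1)])
      show "param a x \<in> closure X" using x clU by blast
      have "param a (s n) \<in> closure X" for n
        using s(1)[of n] closure_subset by (auto simp: U_def)
      then show "\<forall>\<^sub>F n in sequentially. param a (s n) \<in> closure X" by simp
    qed
    moreover have "G (param a (s n)) = param b (planar (s n))" for n
      using s(1)[of n] by (simp add: G(2) U_def param_planar)
    moreover have "(\<lambda>n. param b (planar (s n))) \<longlonglongrightarrow> param b y"
      using continuous_on_tendsto_compose[OF continuous_on_param[of UNIV] s(3)] by auto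
    ultimately show ?thesis
      using LIMSEQ_unique by auto
  qed
  have fr: "x \<in> frontier U \<longleftrightarrow> x \<in> closure U \<and> x \<notin> U" "y \<in> frontier V \<longleftrightarrow> y \<in> closure V \<and> y \<notin> V" for x y
    using ex.open_U ex.open_V by (auto simp: U_def V_def frontier_def interior_open)
  obtain D where D: "D \<in> components (- V)" "P = param b ` (D \<inter> frontier V)"
    using sw.component_obtain[OF P] unfolding V_def by blast
  obtain y where y: "y \<in> D" "y \<in> frontier V"
    using sw.ex.component_meets_frontier'[of D] D(1) unfolding V_def by blast
  have D_eq: "D = connected_component_set (- V) y"
    using D(1) y(1) by (metis componentsE connected_component_eq mem_Collect_eq)
  have yV: "y \<notin> param b -` Y" using y fr by (simp add: V_def)
  have swc: "sw.ex.corr = ex.corr\<inverse>" by (rule ex.corr_swap)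
  have preim: "\<exists>s x. (\<forall>n. s n \<in> U) \<and> s \<longlonglongrightarrow> x \<and> (\<lambda>n. planar (s n)) \<longlonglongrightarrow> y' \<and> (x, y') \<in> ex.corr"
    if y': "y' \<in> frontier V" for y'
  proof -
    obtain t x where t: "\<And>n. t n \<in> param b -` Y" "t \<longlonglongrightarrow> y'" "(\<lambda>n. sw.planar (t n)) \<longlonglongrightarrow> x"
        "(y', x) \<in> sw.ex.corr"
    proof -
      have "y' \<in> closure (param b -` Y)" using y' fr by (simp add: V_def)
      then show thesis using that sw.ex.frontier_limit[of y'] by blast
    qed
    have "sw.planar (t n) \<in> U" "planar (sw.planar (t n)) = t n" for n
      using sw.ex.f_in[OF t(1)] sw.ex.hf[OF t(1)] by (simp_all add: U_def)
    then show ?thesis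
      using t by (intro exI[of _ "\<lambda>n. sw.planar (t n)"] exI[of _ x]) (simp add: swc)
  qed
  obtain s0 x0 where x0: "(x0, y) \<in> ex.corr" using preim[OF y(2)] by blast
  have x0U: "x0 \<notin> param a -` X" using ex.corr_in_iff[OF x0] yV by blast
  define C where "C = connected_component_set (- (param a -` X)) x0"
  have CD: "ex.corr `` C = D"
    using ex.corr_component[OF x0 x0U] ex.corr_fiber[OF x0 x0U] by (simp add: C_def D_eq V_def)
  have DC: "ex.corr\<inverse> `` D = C"
    using sw.ex.corr_component[of y x0] sw.ex.corr_fiber[of y x0] x0 yV
    by (simp add: C_def D_eq V_def swc)
  have C: "C \<in> components (- (param a -` X))"
    using x0U by (auto simp: C_def components_def)
  show thesis
  proof (rule that[OF component_param[OF C]], intro subset_antisym subsetI)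
    fix p assume "p \<in> P"
    then obtain y' where y': "y' \<in> D" "y' \<in> frontier V" "p = param b y'" using D(2) by blast
    obtain s x where s: "\<And>n. s n \<in> U" "s \<longlonglongrightarrow> x" "(\<lambda>n. planar (s n)) \<longlonglongrightarrow> y'" "(x, y') \<in> ex.corr"
      using preim[OF y'(2)] by blast
    have "x \<in> C" using s(4) y'(1) DC by blast
    moreover have "x \<in> closure U" unfolding closure_sequential using s(1,2) by blast
    moreover have "x \<notin> U"
      using ex.corr_in_iff[OF s(4)] y'(2) fr by (simp add: U_def V_def)
    ultimately have "x \<in> C \<inter> frontier (param a -` X)" using fr by (simp add: U_def)
    moreover have "p = G (param a x)" using key[OF s(1-3)] y' by simp
    ultimately show "p \<in> G ` param a ` (C \<inter> frontier (param a -` X))" by blast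
  next
    fix p assume "p \<in> G ` param a ` (C \<inter> frontier (param a -` X))"
    then obtain x where x: "x \<in> C" "x \<in> frontier U" "p = G (param a x)" by (auto simp: U_def)
    obtain s y' where s: "\<And>n. s n \<in> U" "s \<longlonglongrightarrow> x" "(\<lambda>n. planar (s n)) \<longlonglongrightarrow> y'" "(x, y') \<in> ex.corr"
    proof -
      have "x \<in> closure (param a -` X)" using x(2) fr by (simp add: U_def)
      then show thesis using that ex.frontier_limit[of x] unfolding U_def by blast
    qed
    have "y' \<in> D" using s(4) x(1) CD by blast
    moreover have "y' \<in> closure V"
    proof -
      have "planar (s n) \<in> V" for n using s(1)[of n] by (simp add: U_def V_def param_planar phi_in)
      then show ?thesis
        unfolding closure_sequential using s(3) by (intro exI[of _ "\<lambda>n. planar (s n)"] conjI allI)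
    qed
    moreover have "y' \<notin> V"
      using ex.corr_in_iff[OF s(4)] x(2) fr by (simp add: U_def V_def)
    ultimately have "y' \<in> D \<inter> frontier V" using fr by simp
    moreover have "p = param b y'" using key[OF s(1-3)] x by simp
    ultimately show "p \<in> P" using D(2) by blast
  qed
qed

end

section \<open>Countability, summability and limits in planar coordinates\<close>

context normalized_pair
begin

text \<open>Summability is given for spherical diameters of boundary components and needed for
  Euclidean diameters of complementary ones. The Lipschitz bound changes the metric, and discs pass
  from the boundary to the whole component.\<close>

lemma diameter_bound_sequence:
  assumes cnt: "countable (nondegenerate_components (frontier X))"
    and sm: "diameter summable_on nondegenerate_components (frontier X)"
  obtains D :: "nat \<Rightarrow> complex set" and d :: "nat \<Rightarrow> real"
  where "summable d" "\<And>n. d n \<ge> 0" "\<And>n x y. x \<in> D n \<Longrightarrow> y \<in> D n \<Longrightarrow> dist x y \<le> d n"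
    "\<And>C. C \<in> components (- (param a -` X)) \<Longrightarrow> (\<exists>y. C = {y}) \<or> C \<in> range D"
proof -
  define \<N> where "\<N> = nondegenerate_components (frontier X)"
  define pc where "pc C = param a ` (C \<inter> frontier (param a -` X))" for C
  obtain e :: "ext_complex set \<Rightarrow> nat" where e: "inj_on e \<N>"
    using cnt by (auto simp: countable_def \<N>_def)
  obtain L where L: "L > 0" "\<And>p q. p \<in> frontier X \<Longrightarrow> q \<in> frontier X \<Longrightarrow>
      norm (coord a p - coord a q) \<le> L * dist p q"
    using coord_lipschitz by blast
  define q where "q n = (if n \<in> e ` \<N> then diameter (inv_into \<N> e n) else 0)" for n
  have q0: "q n \<ge> 0" for n by (simp add: q_def diameter_ge_0)
  have "q summable_on UNIV"
  proof -
    have "(q \<circ> e) summable_on \<N>"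
      using sm e by (subst summable_on_cong[where g = diameter]) (auto simp: q_def \<N>_def)
    then have "q summable_on e ` \<N>"
      by (subst summable_on_reindex[OF e])
    then show ?thesis
      by (subst summable_on_cong_neutral[where T = "e ` \<N>" and g = q]) (auto simp: q_def)
  qed
  then have sq: "summable q"
    using summable_on_UNIV_nonneg_real_iff[of q] q0 by simp
  define D where "D n = \<Union>{C \<in> components (- (param a -` X)). pc C \<in> \<N> \<and> e (pc C) = n}" for n
  have D_eq: "D (e (pc C)) = C" if C: "C \<in> components (- (param a -` X))" "pc C \<in> \<N>" for C
  proof -
    have "C' = C" if "C' \<in> components (- (param a -` X))" "pc C' \<in> \<N>" "e (pc C') = e (pc C)" for C'
      using component_param_inj[of C' C] that C e unfolding inj_on_def pc_def by metis
    then have "{C' \<in> components (- (param a -` X)). pc C' \<in> \<N> \<and> e (pc C') = e (pc C)} = {C}"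
      using C by blast
    then show ?thesis by (simp add: D_def)
  qed
  show thesis
  proof
    show "summable (\<lambda>n. L * q n)" using sq by (rule summable_mult)
    show "L * q n \<ge> 0" for n using L q0[of n] by simp
    show "(\<exists>y. C = {y}) \<or> C \<in> range D" if C: "C \<in> components (- (param a -` X))" for C
    proof (cases "\<exists>y. C = {y}")
      case False
      then have "pc C \<in> \<N>" using nondegenerate_param[OF C] by (simp add: pc_def \<N>_def)
      then have "C = D (e (pc C))" using D_eq[OF C] by simp
      then show ?thesis by blast
    qed simp
    fix n x y assume xy: "x \<in> D n" "y \<in> D n"
    then obtain C where C: "C \<in> components (- (param a -` X))" "pc C \<in> \<N>" "e (pc C) = n"
      by (auto simp: D_def)
    have DC: "D n = C" using D_eq[OF C(1,2)] C(3) by simp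
    define r where "r = L * q n"
    have qn: "q n = diameter (pc C)"
      using C(2) inv_into_f_f[OF e C(2)] by (simp add: q_def C(3)[symmetric])
    have fr: "dist u w \<le> r" if u: "u \<in> C \<inter> frontier (param a -` X)" and w: "w \<in> C \<inter> frontier (param a -` X)" for u w
    proof -
      have "param a u \<in> frontier X" "param a w \<in> frontier X"
        using u w by (auto simp: frontier_vimage_param[OF open_X])
      then have "norm (u - w) \<le> L * dist (param a u) (param a w)"
        using L(2)[of "param a u" "param a w"] by simp
      also have "\<dots> \<le> L * diameter (pc C)"
        using u w L(1) by (intro mult_left_mono diameter_bounded_bound) (auto simp: pc_def)
      finally show ?thesis by (simp add: dist_norm r_def qn)
    qed
    \<comment> \<open>The disc argument is used twice: discs about frontier points contain
      \<open>C\<close>, so discs about any point of \<open>C\<close> contain the frontier part, and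
      hence \<open>C\<close> again.\<close>
    have sub: "C \<subseteq> cball u r" if "C \<inter> frontier (param a -` X) \<subseteq> cball u r" for u
      using that by (intro ex.component_subset_convex[OF C(1)]) auto
    have one: "C \<subseteq> cball u r" if "u \<in> C \<inter> frontier (param a -` X)" for u
      using fr[OF that] by (intro sub) auto
    have "C \<inter> frontier (param a -` X) \<subseteq> cball x r"
    proof
      fix w assume "w \<in> C \<inter> frontier (param a -` X)"
      then have "x \<in> cball w r" using one xy DC by blast
      then show "w \<in> cball x r" by (simp add: dist_commute)
    qed
    then show "dist x y \<le> L * q n"
      using sub[of x] xy DC by (auto simp: r_def)
  qed
qed

lemma countable_nonsingleton_components:
  assumes "countable (nondegenerate_components (frontier X))"
  shows "countable {C \<in> components (- (param a -` X)). \<nexists>x. C = {x}}"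
proof (rule countable_image_inj_on)
  let ?pc = "\<lambda>C. param a ` (C \<inter> frontier (param a -` X))"
  show "countable (?pc ` {C \<in> components (- (param a -` X)). \<nexists>x. C = {x}})"
    by (rule countable_subset[OF _ assms]) (use nondegenerate_param in blast)
  show "inj_on ?pc {C \<in> components (- (param a -` X)). \<nexists>x. C = {x}}"
    using component_param_inj by (intro inj_onI) blast
qed

text \<open>The distance from \<open>coord a p\<close> to \<open>z0\<close> is Lipschitz in
  \<open>p\<close> on the frontier, so level sets can be counted on the sphere itself, without
  transporting Hausdorff measure to the plane.\<close>

lemma countable_points_on_circles:
  assumes "sigma_finite_linear_measure (point_components (frontier X))"
  obtains Z where "negligible Z"
    "\<And>s. s \<notin> Z \<Longrightarrow> countable {x \<in> sphere z0 (exp s). {x} \<in> components (- (param a -` X))}"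
proof -
  obtain L where L: "L > 0" "\<And>p q. p \<in> frontier X \<Longrightarrow> q \<in> frontier X \<Longrightarrow>
      norm (coord a p - coord a q) \<le> L * dist p q"
    using coord_lipschitz by blast
  have sub: "point_components (frontier X) \<subseteq> frontier X"
    using in_components_subset by (auto simp: point_components_def)
  have lip: "\<bar>norm (coord a p - z0) - norm (coord a q - z0)\<bar> \<le> L * dist p q"
    if "p \<in> point_components (frontier X)" "q \<in> point_components (frontier X)" for p q
  proof -
    have "\<bar>norm (coord a p - z0) - norm (coord a q - z0)\<bar> \<le> norm (coord a p - coord a q)"
      using norm_triangle_ineq3[of "coord a p - z0" "coord a q - z0"] by simp
    then show ?thesis using L(2)[of p q] that sub by fastforce
  qed
  obtain Z where Z: "negligible Z"
    "\<And>s. s \<notin> Z \<Longrightarrow> countable {p \<in> point_components (frontier X). norm (coord a p - z0) = exp s}"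
    using countable_level_sets[OF assms less_imp_le[OF L(1)] lip] by blast
  show thesis
  proof (rule that[OF Z(1)])
    fix s assume s: "s \<notin> Z"
    have "param a x \<in> point_components (frontier X)" if x: "{x} \<in> components (- (param a -` X))" for x
    proof -
      have "{x} \<inter> frontier (param a -` X) = {x}"
        using in_components_nonempty[OF ex.component_Int_frontier[OF x]] by blast
      then show ?thesis
        using component_param[OF x] by (simp add: point_components_def)
    qed
    then have "param a ` {x \<in> sphere z0 (exp s). {x} \<in> components (- (param a -` X))} \<subseteq>
        {p \<in> point_components (frontier X). norm (coord a p - z0) = exp s}"
    proof clarify
      fix x assume "x \<in> sphere z0 (exp s)" "{x} \<in> components (- (param a -` X))"
      then show "param a x \<in> point_components (frontier X) \<and> norm (coord a (param a x) - z0) = exp s"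
        using \<open>\<And>x. {x} \<in> components (- (param a -` X)) \<Longrightarrow> param a x \<in> point_components (frontier X)\<close>
        by (simp add: dist_norm norm_minus_commute)
    qed
    then have "countable (param a ` {x \<in> sphere z0 (exp s). {x} \<in> components (- (param a -` X))})"
      using Z(2)[OF s] countable_subset by blast
    then show "countable {x \<in> sphere z0 (exp s). {x} \<in> components (- (param a -` X))}"
      by (rule countable_image_inj_on) (rule inj_param)
  qed
qed

lemma limit_from_planar:
  assumes p: "p \<in> frontier X" and l: "(planar \<longlongrightarrow> y) (at (coord a p) within param a -` X)"
  shows "(\<phi> \<longlongrightarrow> param b y) (at p within X)"
  unfolding tendsto_at_iff_sequentially
proof (intro allI impI)
  fix s assume s: "\<forall>i. s i \<in> X - {p}" "s \<longlonglongrightarrow> p"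
  have pX: "p \<notin> X" using p open_X by (simp add: frontier_def interior_open)
  then have pa: "p \<noteq> Fin a" using a_in by auto
  have "\<forall>\<^sub>F i in sequentially. s i \<in> - {Fin a}"
    using pa by (intro topological_tendstoD[OF s(2)]) auto
  \<comment> \<open>Dropping finitely many terms avoids the dummy value of \<open>coord a\<close> at
    the pole.\<close>
  then obtain N where N: "\<And>i. i \<ge> N \<Longrightarrow> s i \<noteq> Fin a"
    by (auto simp: eventually_sequentially)
  define t where "t i = s (i + N)" for i
  have t: "t i \<in> X" "t i \<noteq> Fin a" for i
    using s(1) N by (auto simp: t_def)
  have "t \<longlonglongrightarrow> p"
    unfolding t_def by (rule LIMSEQ_ignore_initial_segment[OF s(2)])
  then have cp: "(\<lambda>i. coord a (t i)) \<longlonglongrightarrow> coord a p"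
  proof (rule continuous_on_tendsto_compose[OF continuous_on_coord[of a "- {Fin a}"], rotated])
    show "\<forall>\<^sub>F i in sequentially. t i \<in> - {Fin a}" using t by simp
  qed (use pa in auto)
  have ct: "coord a (t i) \<in> param a -` X - {coord a p}" for i
  proof -
    have "param a (coord a (t i)) \<noteq> param a (coord a p)"
      using t[of i] pX pa by (metis param_coord)
    then have "coord a (t i) \<noteq> coord a p" by metis
    then show ?thesis using t[of i] by simp
  qed
  have ty: "(\<lambda>i. planar (coord a (t i))) \<longlonglongrightarrow> y"
    using l[unfolded tendsto_at_iff_sequentially, THEN spec, of "\<lambda>i. coord a (t i)"] ct cp
    by (simp add: comp_def)
  have "(\<lambda>i. param b (planar (coord a (t i)))) \<longlonglongrightarrow> param b y"
    by (rule continuous_on_tendsto_compose[OF continuous_on_param[of UNIV] ty]) auto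
  then have "(\<lambda>i. \<phi> (s (i + N))) \<longlonglongrightarrow> param b y"
    using t by (simp add: param_planar) (simp add: t_def)
  then show "(\<phi> \<circ> s) \<longlonglongrightarrow> param b y"
    unfolding comp_def by (rule LIMSEQ_offset)
qed

lemma limits_if_peano:
  assumes conf: "\<And>p. p \<in> X \<Longrightarrow> conformal_at \<phi> p"
    and jordan: "\<And>K. K \<in> components (frontier X) \<Longrightarrow> (\<exists>x. K = {x}) \<or> jordan_curve K"
    and cntX: "countable (nondegenerate_components (frontier X))"
    and sf: "sigma_finite_linear_measure (point_components (frontier X))"
    and cntY: "countable (nondegenerate_components (frontier Y))"
    and sm: "diameter summable_on nondegenerate_components (frontier Y)"
    and peano: "\<And>P. P \<in> components (frontier Y) \<Longrightarrow> peano_continuum P"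
    and p: "p \<in> frontier X"
  shows "\<exists>l. (\<phi> \<longlongrightarrow> l) (at p within X)"
proof -
  interpret sw: normalized_pair Y X \<psi> \<phi> b a by (rule pair_swap)
  have pX: "p \<notin> X" using p open_X by (simp add: frontier_def interior_open)
  then have pa: "p \<noteq> Fin a" using a_in by auto
  define z0 where "z0 = coord a p"
  have z0p: "param a z0 = p" using pa by (simp add: z0_def)
  have z0: "z0 \<in> frontier (param a -` X)" "z0 \<notin> param a -` X"
    using p pX z0p by (auto simp: frontier_vimage_param[OF open_X])
  obtain D d where D: "summable d" "\<And>n. d n \<ge> 0"
      "\<And>n x y. x \<in> D n \<Longrightarrow> y \<in> D n \<Longrightarrow> dist x y \<le> d n"
      "\<And>C. C \<in> components (- (param b -` Y)) \<Longrightarrow> (\<exists>y. C = {y}) \<or> C \<in> range D"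
    by (rule sw.diameter_bound_sequence[OF cntY sm], rule that)
  obtain Z where Z: "negligible Z"
      "\<And>s. s \<notin> Z \<Longrightarrow> countable {x \<in> sphere z0 (exp s). {x} \<in> components (- (param a -` X))}"
    by (rule countable_points_on_circles[OF sf, of z0], rule that)
  have short: "ex.short_circles z0"
    by (rule ex.short_circlesI[OF planar_holomorphic[OF conf] D(1,2,3,4)
        countable_nonsingleton_components[OF cntX] Z z0(2)])
  define C where "C = connected_component_set (- (param a -` X)) z0"
  have C: "C \<in> components (- (param a -` X))" "z0 \<in> C"
    using z0 by (auto simp: C_def components_def)
  have "\<exists>y. (planar \<longlongrightarrow> y) (at z0 within param a -` X)"
  proof (cases "C = {z0}")
    case True
    then show ?thesis
      using ex.limit_at_point_component[OF _ short] by (simp add: C_def)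
  next
    case False
    define Q where "Q = C \<inter> frontier (param a -` X)"
    have comp: "param a ` Q \<in> components (frontier X)"
      unfolding Q_def by (rule component_param[OF C(1)])
    \<comment> \<open>A complementary component with a single frontier point is itself a point, so
      this boundary component must be a Jordan curve.\<close>
    have "\<nexists>x. param a ` Q = {x}"
    proof
      assume "\<exists>x. param a ` Q = {x}"
      then obtain x where x: "param a ` Q = {x}" by blast
      have "Q \<subseteq> {z0}"
      proof
        fix z assume "z \<in> Q"
        moreover have "z0 \<in> Q" using z0 C by (simp add: Q_def)
        ultimately have "param a z \<in> param a ` Q" "param a z0 \<in> param a ` Q" by blast+
        then have "param a z = param a z0" unfolding x by simp
        then show "z \<in> {z0}" by simp
      qed
      then show False
        using ex.component_singleton[OF C(1)] False by (simp add: Q_def)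
    qed
    then have "jordan_curve (param a ` Q)" using jordan[OF comp] by blast
    moreover have "Fin a \<notin> param a ` Q" using range_param[of a] by blast
    moreover have "inj_on (coord a) (param a ` Q)" by (auto simp: inj_on_def)
    ultimately have "jordan_curve (coord a ` param a ` Q)"
      by (intro jordan_curve_image[of "param a ` Q"] continuous_on_coord)
    then have "jordan_curve Q" by (simp add: image_image)
    show ?thesis
    proof (rule ex.limit_at_curve_point[OF z0(1) short])
      show "Q = connected_component_set (- (param a -` X)) z0 \<inter> frontier (param a -` X)"
        by (simp add: Q_def C_def)
      show "\<exists>S. compact S \<and> connected S \<and> S \<subseteq> Q \<and> z0 \<notin> S \<and> Q - S \<subseteq> ball z0 r" if "r > 0" for r
        using z0 C that by (intro jordan_curve_complementary_arc \<open>jordan_curve Q\<close>) (auto simp: Q_def)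
      fix P assume P: "P \<in> components (frontier (param b -` Y))"
      then have "param b ` P \<in> components (frontier Y)"
        by (simp add: frontier_eq_param_image[OF open_Y b_in] components_param)
      then have "peano_continuum (param b ` P)" by (rule peano)
      moreover have "Fin b \<notin> param b ` P" using range_param[of b] by blast
      ultimately have "peano_continuum (coord b ` param b ` P)"
        by (intro peano_continuum_image[of "param b ` P"] continuous_on_coord)
      then show "peano_continuum P" by (simp add: image_image)
    qed
  qed
  then show ?thesis
    using limit_from_planar[OF p] unfolding z0_def by blast
qed

end

text \<open>Singletons have diameter 0, so large components are nondegenerate, and \<open>m\<close>
  of them sum to at least \<open>m * C\<close>, more than the total for large
  \<open>m\<close>.\<close>

lemma finite_large_if_diameter_summable:
  fixes F :: "'a::metric_space set"
  assumes sm: "diameter summable_on nondegenerate_components F" and C: "C > 0"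
    and bnd: "\<And>K. K \<in> components F \<Longrightarrow> bounded K"
  shows "finite {K \<in> components F. diameter K > C}"
proof (rule ccontr)
  define S where "S = {K \<in> components F. diameter K > C}"
  define M where "M = infsum diameter (nondegenerate_components F)"
  assume "infinite {K \<in> components F. diameter K > C}"
  moreover obtain m :: nat where m: "M < real m * C"
    using reals_Archimedean3[OF C] by blast
  ultimately obtain T where T: "T \<subseteq> S" "finite T" "card T = m"
    using infinite_arbitrarily_large unfolding S_def by metis
  have "S \<subseteq> nondegenerate_components F"
  proof
    fix K assume K: "K \<in> S"
    have "\<exists>x\<in>K. \<exists>y\<in>K. x \<noteq> y"
    proof (rule ccontr)
      assume n: "\<not> (\<exists>x\<in>K. \<exists>y\<in>K. x \<noteq> y)"
      obtain x where "x \<in> K" using K in_components_nonempty by (auto simp: S_def)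
      then have "K = {x}" using n by auto
      then show False using K C by (auto simp: S_def)
    qed
    then show "K \<in> nondegenerate_components F"
      using K by (auto simp: S_def nondegenerate_components_def)
  qed
  then have "sum diameter T \<le> M"
    unfolding M_def using T bnd
    by (intro finite_sum_le_infsum[OF sm])
      (auto simp: nondegenerate_components_def intro!: diameter_ge_0)
  moreover have "real m * C \<le> sum diameter T"
    using sum_bounded_below[of T C diameter] T by (auto simp: S_def subset_iff less_imp_le)
  ultimately show False using m by simp
qed

text \<open>A nonempty open subset of the sphere is infinite, so some point of \<open>X\<close>
  avoids both infinity and the preimage of infinity.\<close>

lemma normalization:
  assumes "open X" "X \<noteq> {}" "homeomorphism X Y \<phi> \<psi>"
  obtains a b where "Fin a \<in> X" "\<phi> (Fin a) = Fin b"
proof -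
  obtain p where p: "p \<in> X" using assms by blast
  obtain a where a: "p \<noteq> Fin a"
    by (metis ext_complex.inject zero_neq_one)
  have "infinite (param a -` X)"
  proof
    assume "finite (param a -` X)"
    moreover have "coord a p \<in> param a -` X" using p a by simp
    ultimately show False
      using finite_imp_not_open[of "param a -` X"] open_vimage_param[OF assms(1)] by blast
  qed
  then have "infinite (param a ` (param a -` X))"
    using finite_imageD inj_param by blast
  then have "infinite X" using finite_subset[of "param a ` (param a -` X)" X] by blast
  then have "X - {Infty, \<psi> Infty} \<noteq> {}"
    by (metis finite.emptyI finite_Diff2 finite_insert)
  then obtain q where q: "q \<in> X" "q \<noteq> Infty" "q \<noteq> \<psi> Infty" by blast
  then have "\<phi> q \<noteq> Infty" using assms(3) by (auto simp: homeomorphism_def)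
  then show thesis
    using that q by (cases q; cases "\<phi> q") auto
qed

theorem theorem4p6:
  fixes \<phi> :: "ext_complex \<Rightarrow> ext_complex"
    and \<Omega>\<^sub>1 \<Omega>\<^sub>2 :: "ext_complex set"
  assumes "generalized_jordan_domain \<Omega>\<^sub>1"
    and "sphere_domain \<Omega>\<^sub>2"
    and "conformal_homeomorphism \<Omega>\<^sub>1 \<Omega>\<^sub>2 \<phi>"
    and "sigma_finite_linear_measure (point_components (frontier \<Omega>\<^sub>1))"
    and "countable (nondegenerate_components (frontier \<Omega>\<^sub>2))"
    and "diameter summable_on nondegenerate_components (frontier \<Omega>\<^sub>2)"
  shows "extends_continuously \<Omega>\<^sub>1 \<Omega>\<^sub>2 \<phi> \<longleftrightarrow> peano_compactum (frontier \<Omega>\<^sub>2)"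
proof (cases "\<Omega>\<^sub>1 = {}")
  \<comment> \<open>The empty set is open and connected and so counts as a domain; both sides then
    hold.\<close>
  case True
  then have "\<Omega>\<^sub>2 = {}"
    using assms(3) by (auto simp: conformal_homeomorphism_def homeomorphism_def)
  then show ?thesis
    using True by (simp add: extends_continuously_def peano_compactum_def)
next
  case False
  obtain \<psi> where \<psi>: "homeomorphism \<Omega>\<^sub>1 \<Omega>\<^sub>2 \<phi> \<psi>" and conf: "\<And>p. p \<in> \<Omega>\<^sub>1 \<Longrightarrow> conformal_at \<phi> p"
    using assms(3) by (auto simp: conformal_homeomorphism_def)
  have dom: "open \<Omega>\<^sub>1" "connected \<Omega>\<^sub>1" "open \<Omega>\<^sub>2"
    using assms(1,2) by (auto simp: generalized_jordan_domain_def sphere_domain_def)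
  have jordan: "(\<exists>x. K = {x}) \<or> jordan_curve K" if "K \<in> components (frontier \<Omega>\<^sub>1)" for K
    using assms(1) that by (auto simp: generalized_jordan_domain_def)
  have cnt: "countable (nondegenerate_components (frontier \<Omega>\<^sub>1))"
    using assms(1) by (simp add: generalized_jordan_domain_def)
  obtain a b where ab: "Fin a \<in> \<Omega>\<^sub>1" "\<phi> (Fin a) = Fin b"
    using normalization[OF dom(1) False \<psi>] .
  interpret normalized_pair \<Omega>\<^sub>1 \<Omega>\<^sub>2 \<phi> \<psi> a b
    by (rule normalized_pair.intro[OF dom(1,3,2) \<psi> ab])
  show ?thesis
  proof
    assume "extends_continuously \<Omega>\<^sub>1 \<Omega>\<^sub>2 \<phi>"
    then obtain G where G: "continuous_on (closure \<Omega>\<^sub>1) G" "\<And>p. p \<in> \<Omega>\<^sub>1 \<Longrightarrow> G p = \<phi> p"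
      by (auto simp: extends_continuously_def)
    have "compact (frontier \<Omega>\<^sub>2)"
      unfolding frontier_eq_param_image[OF open_Y b_in]
      using compact_frontier_bounded[OF ex.bounded_compl_V]
      by (intro compact_continuous_image continuous_on_param) (simp add: frontier_complement)
    moreover have "peano_continuum P" if P: "P \<in> components (frontier \<Omega>\<^sub>2)" for P
    proof -
      obtain Q where Q: "Q \<in> components (frontier \<Omega>\<^sub>1)" "P = G ` Q"
        using extension_component[OF G P] .
      have "peano_continuum Q"
      proof (cases "\<exists>x. Q = {x}")
        case True
        then obtain x where "Q = {x}" by blast
        then show ?thesis
          unfolding peano_continuum_def by (intro exI[of _ "\<lambda>_. x"]) force
      next
        case False
        then show ?thesis using jordan[OF Q(1)] jordan_curve_imp_peano by blast
      qed
      moreover have "Q \<subseteq> closure \<Omega>\<^sub>1"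
        using in_components_subset[OF Q(1)] by (auto simp: frontier_def)
      ultimately show ?thesis
        unfolding Q(2) using G(1) continuous_on_subset by (intro peano_continuum_image) auto
    qed
    moreover have "finite {K \<in> components (frontier \<Omega>\<^sub>2). diameter K > C}" if "C > 0" for C
      using finite_large_if_diameter_summable[OF assms(6) that] by simp
    ultimately show "peano_compactum (frontier \<Omega>\<^sub>2)"
      by (simp add: peano_compactum_def)
  next
    assume "peano_compactum (frontier \<Omega>\<^sub>2)"
    then have peano: "peano_continuum P" if "P \<in> components (frontier \<Omega>\<^sub>2)" for P
      using that by (simp add: peano_compactum_def)
    have "\<exists>l. (\<phi> \<longlongrightarrow> l) (at p within \<Omega>\<^sub>1)" if "p \<in> closure \<Omega>\<^sub>1 - \<Omega>\<^sub>1" for p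
      using that dom(1)
      by (intro limits_if_peano[OF conf jordan cnt assms(4,5,6) peano])
        (auto simp: frontier_def interior_open)
    then obtain g where "continuous_on (closure \<Omega>\<^sub>1) g" "g ` closure \<Omega>\<^sub>1 \<subseteq> closure (\<phi> ` \<Omega>\<^sub>1)"
        "\<And>p. p \<in> \<Omega>\<^sub>1 \<Longrightarrow> g p = \<phi> p"
      using continuous_extension_if_limits[OF cont_phi] by blast
    then show "extends_continuously \<Omega>\<^sub>1 \<Omega>\<^sub>2 \<phi>"
      unfolding extends_continuously_def image_phi by blast
  qed
qed

end
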